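(* Let $H$ be a finite-dimensional Hopf algebra over a field $\mathbb{k}$, with antipode $S$, having the dual Chevalley property. Let $N:=\exp(H_0)<\infty$ be the exponent of the coradical $H_0$ of $H$ (this exponent is finite), and let $L:=\mathrm{Lw}(H)$ be the Loewy length of $H$. Then $$(S^{2N}-\mathrm{id})^{L-1}=0$$ holds on $H$, i.e. as a $\mathbb{k}$-linear endomorphism of $H$ (powers are with respect to composition).
   Context: The field $\mathbb{k}$ is arbitrary. For a coalgebra $H$, $H_0$ denotes the coradical (the sum of all simple subcoalgebras) and $\{H_n\}_{n\ge 0}$ the coradical filtration. A finite-dimensional Hopf algebra $H$ has the dual Chevalley property if its coradical $H_0$ is a Hopf subalgebra of $H$ (equivalently, a subalgebra). The Loewy length $\mathrm{Lw}(H)$ is the least positive integer $L$ such that $H_{L-1}=H$. For a Hopf algebra $A$ with multiplication $m$, unit $u$, comultiplication $\Delta$, counit $\varepsilon$ and bijective antipode $S$, let $m_n:A^{\otimes n}\to A$ be the $n$-fold multiplication and $\Delta_n:A\to A^{\otimes n}$, $h\mapsto\sum h_{(1)}\otimes\cdots\otimes h_{(n)}$. The exponent of $A$ is $\exp(A):=\min\{n\ge 1\mid m_n\circ(\mathrm{id}\otimes S^{-2}\otimes\cdots\otimes S^{-2n+2})\circ\Delta_n=u\circ\varepsilon\}$, with $\min\varnothing=\infty$.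
   Formalization: The Loewy length is assumed to satisfy L ≥ 2, since for L = 1 the formula reads id = 0, which is false (e.g. H = k); finiteness of exp(H_0) is taken as given, as in the "Let" clause. *)

theory Defs
  imports
    "HOL-Library.Poly_Mapping"
    "HOL-Library.Set_Algebras"
    "HOL-Library.Extended_Nat"
    Complex_Main
begin

text \<open>
  The tensor power of a vector space over a field is constructed as usual: it is the quotient of the
  free vector space on words of length \<open>n\<close> by the subspace spanned by the multilinearity relations.
  Its elements are cosets, so that equality of tensors is equality in HOL, and the sum of two
  tensors is the element-wise sum of sets from \<open>Set_Algebras\<close>. The degree zero part is the field.
\<close>

definition free_scale :: "'k::field \<Rightarrow> ('a \<Rightarrow>\<^sub>0 'k) \<Rightarrow> ('a \<Rightarrow>\<^sub>0 'k)" where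
  "free_scale c p = Poly_Mapping.map ((*) c) p"

lemma lookup_free_scale [simp]:
  "Poly_Mapping.lookup (free_scale c p) x = c * Poly_Mapping.lookup p x"
  unfolding free_scale_def by transfer (simp add: when_def)

interpretation free: vector_space "free_scale :: 'k::field \<Rightarrow> ('a \<Rightarrow>\<^sub>0 'k) \<Rightarrow> ('a \<Rightarrow>\<^sub>0 'k)"
  by unfold_locales (auto intro!: poly_mapping_eqI simp: lookup_add algebra_simps)

definition word :: "'a list \<Rightarrow> ('a list \<Rightarrow>\<^sub>0 'k::field)" where
  "word xs = Poly_Mapping.single xs 1"

text \<open>The linear extension of a map \<open>g\<close> from basis elements to a space with scaling \<open>sc\<close>.\<close>

definition lin_ext ::
  "('k::field \<Rightarrow> 'b::ab_group_add \<Rightarrow> 'b) \<Rightarrow> ('a \<Rightarrow> 'b) \<Rightarrow> ('a \<Rightarrow>\<^sub>0 'k) \<Rightarrow> 'b" where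
  "lin_ext sc g p = (\<Sum>x\<in>Poly_Mapping.keys p. sc (Poly_Mapping.lookup p x) (g x))"

text \<open>Juxtaposition of words, extended bilinearly.\<close>

definition juxt ::
  "('a list \<Rightarrow>\<^sub>0 'k::field) \<Rightarrow> ('a list \<Rightarrow>\<^sub>0 'k) \<Rightarrow> ('a list \<Rightarrow>\<^sub>0 'k)" where
  "juxt p q = lin_ext free_scale (\<lambda>us. lin_ext free_scale (\<lambda>vs. word (us @ vs)) q) p"

definition multilinear_rels ::
  "('k::field \<Rightarrow> 'h::ab_group_add \<Rightarrow> 'h) \<Rightarrow> nat \<Rightarrow> ('h list \<Rightarrow>\<^sub>0 'k) set" where
  "multilinear_rels scale n =
     {word (us @ (x + y) # vs) - word (us @ x # vs) - word (us @ y # vs) | us x y vs.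
        length us + 1 + length vs = n} \<union>
     {word (us @ scale c x # vs) - free_scale c (word (us @ x # vs)) | us c x vs.
        length us + 1 + length vs = n}"

type_synonym ('h, 'k) tensor = "('h list \<Rightarrow>\<^sub>0 'k) set"

definition tensor_class ::
  "('k::field \<Rightarrow> 'h::ab_group_add \<Rightarrow> 'h) \<Rightarrow> nat \<Rightarrow> ('h list \<Rightarrow>\<^sub>0 'k) \<Rightarrow> ('h, 'k) tensor" where
  "tensor_class scale n p = {q. q - p \<in> free.span (multilinear_rels scale n)}"

text \<open>
  For subspaces \<open>C\<^sub>1, \<dots>, C\<^sub>n\<close> of \<open>H\<close>, the following is (the image of)
  \<open>C\<^sub>1 \<otimes> \<dots> \<otimes> C\<^sub>n\<close> in the \<open>n\<close>-th tensor power of \<open>H\<close>.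
\<close>

definition tensor_space ::
  "('k::field \<Rightarrow> 'h::ab_group_add \<Rightarrow> 'h) \<Rightarrow> 'h set list \<Rightarrow> ('h, 'k) tensor set" where
  "tensor_space scale Cs =
     tensor_class scale (length Cs) ` free.span {word xs | xs. list_all2 (\<in>) xs Cs}"

definition tensor_rep :: "('h, 'k::field) tensor \<Rightarrow> ('h list \<Rightarrow>\<^sub>0 'k)" where
  "tensor_rep X = (SOME p. p \<in> X)"

definition tensor_scale ::
  "('k::field \<Rightarrow> 'h::ab_group_add \<Rightarrow> 'h) \<Rightarrow> nat \<Rightarrow> 'k \<Rightarrow> ('h, 'k) tensor \<Rightarrow> ('h, 'k) tensor" where
  "tensor_scale scale n c X = tensor_class scale n (free_scale c (tensor_rep X))"

text \<open>
  The linear maps on a tensor power induced by a map \<open>g\<close> on words: with values in a vector space with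
  scaling \<open>sc\<close>, and with values in the \<open>m\<close>-th tensor power (\<open>g\<close> then yields representatives).
  In all uses \<open>g\<close> is multilinear, respectively multilinear modulo the relations, so that the
  choice of representatives does not matter.
\<close>

definition tensor_lift ::
  "('k::field \<Rightarrow> 'b::ab_group_add \<Rightarrow> 'b) \<Rightarrow> ('h list \<Rightarrow> 'b) \<Rightarrow> ('h, 'k) tensor \<Rightarrow> 'b" where
  "tensor_lift sc g X = lin_ext sc g (tensor_rep X)"

definition tensor_map ::
  "('k::field \<Rightarrow> 'h::ab_group_add \<Rightarrow> 'h) \<Rightarrow> nat \<Rightarrow> ('h list \<Rightarrow> ('h list \<Rightarrow>\<^sub>0 'k)) \<Rightarrow>
   ('h, 'k) tensor \<Rightarrow> ('h, 'k) tensor" where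
  "tensor_map scale m g X = tensor_class scale m (lin_ext free_scale g (tensor_rep X))"

text \<open>The map \<open>f\<^sub>1 \<otimes> \<dots> \<otimes> f\<^sub>n\<close>.\<close>

definition tensor_funs ::
  "('k::field \<Rightarrow> 'h::ab_group_add \<Rightarrow> 'h) \<Rightarrow> ('h \<Rightarrow> 'h) list \<Rightarrow> ('h, 'k) tensor \<Rightarrow> ('h, 'k) tensor" where
  "tensor_funs scale fs = tensor_map scale (length fs) (\<lambda>xs. word (map2 (\<lambda>f x. f x) fs xs))"

text \<open>The factor-wise product on the \<open>n\<close>-th tensor power of an algebra.\<close>

definition tensor_times ::
  "('k::field \<Rightarrow> 'h::ring_1 \<Rightarrow> 'h) \<Rightarrow> nat \<Rightarrow> ('h, 'k) tensor \<Rightarrow> ('h, 'k) tensor \<Rightarrow> ('h, 'k) tensor" where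
  "tensor_times scale n X Y =
     tensor_map scale n (\<lambda>xs. lin_ext free_scale (\<lambda>ys. word (map2 (*) xs ys)) (tensor_rep Y)) X"

text \<open>The map \<open>id\<^sup>i \<otimes> \<Delta> \<otimes> id\<^sup>n\<^sup>-\<^sup>1\<^sup>-\<^sup>i\<close> from the \<open>n\<close>-th to the \<open>(n+1)\<close>-st tensor power, for \<open>i < n\<close>.\<close>

definition comult_at ::
  "('k::field \<Rightarrow> 'h::ab_group_add \<Rightarrow> 'h) \<Rightarrow> ('h \<Rightarrow> ('h, 'k) tensor) \<Rightarrow> nat \<Rightarrow> nat \<Rightarrow>
   ('h, 'k) tensor \<Rightarrow> ('h, 'k) tensor" where
  "comult_at scale \<Delta> n i = tensor_map scale (n + 1)
     (\<lambda>xs. juxt (word (take i xs)) (juxt (tensor_rep (\<Delta> (xs ! i))) (word (drop (i + 1) xs))))"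

locale coalgebra = vector_space scale
  for scale :: "'k::field \<Rightarrow> 'h::ab_group_add \<Rightarrow> 'h" +
  fixes \<Delta> :: "'h \<Rightarrow> ('h, 'k) tensor"
    and \<epsilon> :: "'h \<Rightarrow> 'k"
  assumes comult_tensor: "\<Delta> x \<in> tensor_space scale [UNIV, UNIV]"
    and comult_add: "\<Delta> (x + y) = \<Delta> x + \<Delta> y"
    and comult_scale: "\<Delta> (scale c x) = tensor_scale scale 2 c (\<Delta> x)"
    and counit_linear: "Vector_Spaces.linear scale (*) \<epsilon>"
    and coassoc: "comult_at scale \<Delta> 2 0 (\<Delta> x) = comult_at scale \<Delta> 2 1 (\<Delta> x)"
    and counit_left: "tensor_lift scale (\<lambda>xs. scale (\<epsilon> (xs ! 0)) (xs ! 1)) (\<Delta> x) = x"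
    and counit_right: "tensor_lift scale (\<lambda>xs. scale (\<epsilon> (xs ! 1)) (xs ! 0)) (\<Delta> x) = x"
begin

definition subcoalgebra :: "'h set \<Rightarrow> bool" where
  "subcoalgebra C \<longleftrightarrow> subspace C \<and> \<Delta> ` C \<subseteq> tensor_space scale [C, C]"

definition simple_subcoalgebra :: "'h set \<Rightarrow> bool" where
  "simple_subcoalgebra C \<longleftrightarrow> subcoalgebra C \<and> C \<noteq> {0} \<and>
     (\<forall>D. subcoalgebra D \<and> D \<subseteq> C \<longrightarrow> D = {0} \<or> D = C)"

definition coradical :: "'h set" where
  "coradical = span (\<Union> {C. simple_subcoalgebra C})"

primrec coradical_filtration :: "nat \<Rightarrow> 'h set" where
  "coradical_filtration 0 = coradical"
| "coradical_filtration (Suc n) =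
     {x. \<Delta> x \<in> tensor_space scale [UNIV, coradical_filtration n] +
                tensor_space scale [coradical, UNIV]}"

definition loewy_length :: nat where
  "loewy_length = (LEAST L. 1 \<le> L \<and> coradical_filtration (L - 1) = UNIV)"

text \<open>The iterated comultiplication into the \<open>n\<close>-th tensor power; the value at \<open>0\<close> is the counit.\<close>

fun comult_iter :: "nat \<Rightarrow> 'h \<Rightarrow> ('h, 'k) tensor" where
  "comult_iter 0 x = tensor_class scale 0 (free_scale (\<epsilon> x) (word []))"
| "comult_iter (Suc 0) x = tensor_class scale 1 (word [x])"
| "comult_iter (Suc (Suc n)) x = comult_at scale \<Delta> (Suc n) 0 (comult_iter (Suc n) x)"

end

text \<open>
  The ring structure of the carrier type is the multiplication and unit of the algebra. That \<open>1 \<noteq> 0\<close>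
  in class \<open>ring_1\<close> is no restriction, since the counit sends the unit to \<open>1\<close>.
\<close>

locale hopf_algebra = coalgebra scale \<Delta> \<epsilon>
  for scale :: "'k::field \<Rightarrow> 'h::ring_1 \<Rightarrow> 'h"
    and \<Delta> :: "'h \<Rightarrow> ('h, 'k) tensor"
    and \<epsilon> :: "'h \<Rightarrow> 'k" +
  fixes S :: "'h \<Rightarrow> 'h"
  assumes scale_mult_left: "scale c x * y = scale c (x * y)"
    and scale_mult_right: "x * scale c y = scale c (x * y)"
    and comult_mult: "\<Delta> (x * y) = tensor_times scale 2 (\<Delta> x) (\<Delta> y)"
    and comult_one: "\<Delta> 1 = tensor_class scale 2 (word [1, 1])"
    and counit_mult: "\<epsilon> (x * y) = \<epsilon> x * \<epsilon> y"
    and counit_one: "\<epsilon> 1 = 1"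
    and antipode_linear: "Vector_Spaces.linear scale scale S"
    and antipode_left:
      "tensor_lift scale prod_list (tensor_funs scale [S, id] (\<Delta> x)) = scale (\<epsilon> x) 1"
    and antipode_right:
      "tensor_lift scale prod_list (tensor_funs scale [id, S] (\<Delta> x)) = scale (\<epsilon> x) 1"
begin

definition hopf_subalgebra :: "'h set \<Rightarrow> bool" where
  "hopf_subalgebra A \<longleftrightarrow> subcoalgebra A \<and> 1 \<in> A \<and> (\<forall>x\<in>A. \<forall>y\<in>A. x * y \<in> A) \<and> S ` A \<subseteq> A"

definition dual_chevalley :: bool where
  "dual_chevalley \<longleftrightarrow> hopf_subalgebra coradical"

text \<open>
  The exponent of a Hopf subalgebra \<open>A\<close>, whose structure maps are the restrictions of those of \<open>H\<close>;
  the tensor powers of \<open>A\<close> are subspaces of those of \<open>H\<close>. The infimum of the empty set is \<open>\<infinity>\<close>.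
  The antipode of a finite-dimensional Hopf algebra is bijective, and its inverse restricts to the
  inverse of the antipode of \<open>A\<close>. The exponent of \<open>H\<close> itself is obtained for \<open>A = UNIV\<close>.
\<close>

definition exponent :: "'h set \<Rightarrow> enat" where
  "exponent A = Inf (enat ` {n. 1 \<le> n \<and>
     (\<forall>x\<in>A. tensor_lift scale prod_list
               (tensor_funs scale (map (\<lambda>i. inv S ^^ (2 * i)) [0..<n]) (comult_iter n x))
             = scale (\<epsilon> x) 1)})"

end

locale finite_dim_hopf_algebra = hopf_algebra +
  assumes finite_dim: "\<exists>B. finite B \<and> span B = UNIV"

end

theory Submission
  imports Defs
begin

text \<open>
  Let \<open>A\<close> be the coradical and write \<open>\<Delta>(h) = \<Sum> h\<^sub>1 \<otimes> h\<^sub>2\<close>. The wedge \<open>U \<and> V\<close> of two subspaces is the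
  preimage of \<open>H \<otimes> V + U \<otimes> H\<close> under \<open>\<Delta>\<close>, so that \<open>H\<^sub>0 = A\<close> and \<open>H\<^sub>n\<^sub>+\<^sub>1 = A \<and> H\<^sub>n\<close>.

  A linear map \<open>V\<close> that respects the comultiplication and is the identity on \<open>H\<^sub>1 = A \<and> A\<close> satisfies
  \<open>(V - id)(H\<^sub>n) \<subseteq> H\<^sub>n\<^sub>-\<^sub>1\<close>: this follows from
  \<open>\<Delta>(V x - x) = \<Sum> (V x\<^sub>1 - x\<^sub>1) \<otimes> V x\<^sub>2 + x\<^sub>1 \<otimes> (V x\<^sub>2 - x\<^sub>2)\<close> and \<open>H\<^sub>n\<^sub>+\<^sub>2 \<subseteq> H\<^sub>1 \<and> H\<^sub>n\<close>. As \<open>V - id\<close>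
  already vanishes on \<open>H\<^sub>1\<close>, its power \<open>L - 1\<close> vanishes on \<open>H\<^sub>L\<^sub>-\<^sub>1 = H\<close>
  (\<open>coalgebra_map_minus_id_nilpotent\<close>). It remains to see that \<open>S\<^sup>2\<^sup>N\<close> is the identity on \<open>A \<and> A\<close>.

  Let \<open>x \<triangleleft> a = \<Sum> S(a\<^sub>1) x a\<^sub>2\<close> be the right adjoint action and \<open>P\<^sub>n\<close> the convolution product of \<open>id\<close>,
  \<open>S\<^sup>-\<^sup>2\<close>, and so on up to \<open>S\<^sup>-\<^sup>2\<^sup>n\<^sup>+\<^sup>2\<close>. For every \<open>h\<close> in \<open>H\<close> the identity \<open>S\<^sup>-\<^sup>2\<^sup>n(h) = \<Sum> h\<^sub>1 \<triangleleft> S\<^sup>-\<^sup>2(P\<^sub>n(h\<^sub>2))\<close> holds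
  (\<open>funpow_Q_eq_adj\<close>). Since \<open>P\<^sub>N\<close> is the counit on \<open>A\<close>, the map \<open>D = S\<^sup>-\<^sup>2\<^sup>N - id\<close> has the form
  \<open>D(h) = \<Sum> h\<^sub>1 \<triangleleft> f(h\<^sub>2)\<close> with \<open>f\<close> vanishing on \<open>A\<close>. Hence \<open>D\<close> vanishes on \<open>A\<close>; it commutes with left
  multiplication by \<open>A\<close>, as \<open>S\<^sup>-\<^sup>2\<^sup>N\<close> is multiplicative; and it vanishes on each \<open>m\<close> with
  \<open>\<Delta>(m) - 1 \<otimes> m\<close> in \<open>H \<otimes> A\<close>. By the fundamental theorem of Hopf modules, applied to the quotient of \<open>A \<and> A\<close> by \<open>A\<close>, such elements
  \<open>m\<close> generate \<open>A \<and> A\<close> modulo \<open>A\<close> as an \<open>A\<close>-module, so \<open>D\<close> vanishes on \<open>A \<and> A\<close>. The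
  lemma \<open>wedge_square_transfer\<close> is this argument with the fundamental theorem unfolded.

  Two facts are needed besides. The antipode is bijective (\<open>bij_antipode\<close>): projecting the
  cosemisimple coalgebra \<open>A\<close> onto its simple subcoalgebra spanned by \<open>1\<close> gives an integral, from which
  \<open>A \<subseteq> S(A)\<close> follows, and the Hopf module argument, now for the Hopf subalgebra \<open>S(H)\<close>, shows that
  \<open>S(H)\<close> contains \<open>S(H) \<and> S(H)\<close> and therefore every \<open>H\<^sub>n\<close>. And the coradical filtration
  reaches \<open>H\<close> (\<open>filtration_exhausts\<close>): a proper left coideal \<open>M\<close> with \<open>A \<and> M = M\<close> would
  admit a minimal left coideal above it, whose coefficients modulo \<open>M\<close> form a simple subcoalgebra.

  Tensors enter only through the values of multilinear maps on them. An inclusion such as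
  \<open>\<Delta>(x) \<in> H \<otimes> V + U \<otimes> H\<close> is expressed by the vanishing of \<open>\<Sum> F(x\<^sub>1, x\<^sub>2)\<close> for all bilinear \<open>F\<close> that
  vanish on \<open>H \<times> V\<close> and on \<open>U \<times> H\<close>.
\<close>

section \<open>Linear functionals and projections\<close>

lemma vector_space_over_itself: "vector_space ((*) :: 'k::field \<Rightarrow> 'k \<Rightarrow> 'k)"
  by unfold_locales (auto simp: algebra_simps)

context vector_space
begin

lemma exists_functional_separating:
  assumes "subspace U" and "x \<notin> U"
  obtains \<phi> :: "'b \<Rightarrow> 'a" where "Vector_Spaces.linear scale (*) \<phi>" "\<forall>u\<in>U. \<phi> u = 0" "\<phi> x = 1"
proof -
  interpret vector_space_pair scale "(*) :: 'a \<Rightarrow> 'a \<Rightarrow> 'a"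
    by unfold_locales (auto simp: algebra_simps)
  obtain B where B: "B \<subseteq> U" "independent B" "U \<subseteq> span B"
    by (rule maximal_independent_subset)
  have spB: "span B = U"
    by (rule span_subspace[OF B(1,3) assms(1)])
  then have xB: "x \<notin> span B"
    using assms(2) by auto
  then have "independent (insert x B)"
    using B(2) by (rule independent_insertI)
  from linear_independent_extend[OF this, of "\<lambda>b. if b = x then 1 else 0"]
  obtain g where g: "Vector_Spaces.linear scale (*) g"
    "\<And>y. y \<in> insert x B \<Longrightarrow> g y = (if y = x then 1 else 0)"
    by blast
  have "g u = 0" if "u \<in> U" for u
  proof -
    have "u \<in> span B" using that spB by simp
    moreover have "g b = 0" if "b \<in> B" for b
      using g(2)[of b] that xB span_base[of x B] by auto
    ultimately show ?thesis
      using linear_eq_0_on_span[OF g(1)] by blast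
  qed
  moreover have "g x = 1"
    using g(2)[of x] by simp
  ultimately show thesis
    by (intro that[OF g(1)] ballI)
qed

lemma exists_linear_with_kernel:
  assumes "subspace U"
  obtains r where "Vector_Spaces.linear scale scale r" "\<forall>u\<in>U. r u = 0" "\<forall>x. x - r x \<in> U"
proof -
  interpret vector_space_pair scale scale
    by unfold_locales
  obtain B where B: "B \<subseteq> U" "independent B" "U \<subseteq> span B"
    by (rule maximal_independent_subset)
  have spB: "span B = U"
    by (rule span_subspace[OF B(1,3) assms(1)])
  obtain E where E: "B \<subseteq> E" "independent E" "UNIV \<subseteq> span E"
    by (rule maximal_independent_subset_extend[OF subset_UNIV B(2)])
  from linear_independent_extend[OF E(2), of "\<lambda>b. if b \<in> B then 0 else b"]
  obtain r where r: "Vector_Spaces.linear scale scale r"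
    "\<And>y. y \<in> E \<Longrightarrow> r y = (if y \<in> B then 0 else y)"
    by blast
  have "r u = 0" if "u \<in> U" for u
  proof (rule linear_eq_0_on_span[OF r(1)])
    show "r b = 0" if "b \<in> B" for b
      using r(2)[of b] E(1) that by auto
    show "u \<in> span B"
      using that spB by simp
  qed
  moreover have "x - r x \<in> U" for x
  proof -
    have "x \<in> span E" using E(3) by auto
    then show ?thesis
    proof (induction rule: span_induct_alt)
      case base
      then show ?case
        using linear_0[OF r(1)] subspace_0[OF assms] by simp
    next
      case (step c x y)
      have "scale c x + y - r (scale c x + y) = scale c (x - r x) + (y - r y)"
        using linear_add[OF r(1)] linear_scale[OF r(1)]
        by (simp add: scale_right_diff_distrib)
      moreover have "x - r x \<in> U"
        using r(2)[OF step(1)] B(1) subspace_0[OF assms] by auto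
      ultimately show ?case
        using step(2) subspace_add[OF assms] subspace_scale[OF assms] by metis
    qed
  qed
  ultimately show thesis
    by (intro that[OF r(1)] ballI allI)
qed

lemma exists_coordinates:
  assumes "finite B0" "span B0 = UNIV"
  obtains E c where "finite E" "\<forall>e. Vector_Spaces.linear scale (*) (c e)"
    "\<forall>x. x = (\<Sum>e\<in>E. scale (c e x) e)"
proof -
  obtain E where E: "E \<subseteq> UNIV" "independent E" "UNIV \<subseteq> span E"
    by (rule maximal_independent_subset)
  have fin: "finite E"
    using independent_span_bound[OF assms(1) E(2)] assms(2) by simp
  have spE: "span E = UNIV"
    using E(3) by auto
  have "Vector_Spaces.linear scale (*) (\<lambda>x. representation E x e)" for e
    by (rule linear_representation[OF E(2) spE])
  moreover have "x = (\<Sum>e\<in>E. scale (representation E x e) e)" for x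
    by (rule sum_representation_eq[symmetric, OF E(2) _ fin subset_refl]) (simp add: spE)
  ultimately show thesis
    by (intro that[OF fin] allI)
qed

end

section \<open>Evaluating multilinear maps on tensors\<close>

context vector_space
begin

lemma lin_ext_superset:
  assumes "finite K" "Poly_Mapping.keys p \<subseteq> K"
  shows "lin_ext scale g p = (\<Sum>x\<in>K. scale (Poly_Mapping.lookup p x) (g x))"
  unfolding lin_ext_def
  by (rule sum.mono_neutral_left) (use assms in \<open>auto simp: in_keys_iff\<close>)

lemma lin_ext_add: "lin_ext scale g (p + q) = lin_ext scale g p + lin_ext scale g q"
proof -
  let ?K = "Poly_Mapping.keys p \<union> Poly_Mapping.keys q"
  have "Poly_Mapping.keys (p + q) \<subseteq> ?K"
    by (rule Poly_Mapping.keys_add)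
  then show ?thesis
    by (simp add: lin_ext_superset[of ?K] lookup_add scale_left_distrib sum.distrib)
qed

lemma lin_ext_free_scale: "lin_ext scale g (free_scale c p) = scale c (lin_ext scale g p)"
proof -
  have "Poly_Mapping.keys (free_scale c p) \<subseteq> Poly_Mapping.keys p"
    by (auto simp: in_keys_iff)
  then show ?thesis
    by (simp add: lin_ext_superset[of "Poly_Mapping.keys p"] scale_sum_right)
qed

lemma lin_ext_diff: "lin_ext scale g (p - q) = lin_ext scale g p - lin_ext scale g q"
  using lin_ext_add[of g "p - q" q] by simp

lemma lin_ext_zero [simp]: "lin_ext scale g 0 = 0"
  by (simp add: lin_ext_def)

lemma lin_ext_word [simp]: "lin_ext scale g (word xs) = g xs"
  by (simp add: lin_ext_def word_def)

lemma lin_ext_sum: "lin_ext scale g (\<Sum>i\<in>I. p i) = (\<Sum>i\<in>I. lin_ext scale g (p i))"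
  by (induction I rule: infinite_finite_induct) (auto simp: lin_ext_add)

lemma lin_ext_lin_ext:
  "lin_ext scale g (lin_ext free_scale h p) = lin_ext scale (\<lambda>x. lin_ext scale g (h x)) p"
  unfolding lin_ext_def[of free_scale] lin_ext_sum lin_ext_free_scale
  by (simp add: lin_ext_def)

lemma lin_ext_juxt:
  "lin_ext scale g (juxt p q) = lin_ext scale (\<lambda>us. lin_ext scale (\<lambda>vs. g (us @ vs)) q) p"
  by (simp add: juxt_def lin_ext_lin_ext)

lemma lin_ext_eq_0_on_span:
  assumes "p \<in> free.span W" and "\<And>w. w \<in> W \<Longrightarrow> lin_ext scale g w = 0"
  shows "lin_ext scale g p = 0"
  using assms(1)
  by (induction rule: free.span_induct_alt) (auto simp: lin_ext_add lin_ext_free_scale assms(2))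

end

lemma lin_ext_word_id: "lin_ext free_scale word p = p"
proof -
  have "Poly_Mapping.lookup (lin_ext free_scale word p) x = Poly_Mapping.lookup p x" for x
  proof -
    have "Poly_Mapping.lookup (lin_ext free_scale word p) x =
      (\<Sum>y\<in>Poly_Mapping.keys p. if y = x then Poly_Mapping.lookup p y else 0)"
      unfolding lin_ext_def lookup_sum
      by (rule sum.cong) (auto simp: word_def lookup_single when_def)
    then show ?thesis
      by (auto simp: in_keys_iff)
  qed
  then show ?thesis
    by (rule poly_mapping_eqI)
qed

lemma lin_ext_cong:
  "(\<And>x. x \<in> Poly_Mapping.keys p \<Longrightarrow> g x = h x) \<Longrightarrow> lin_ext sc g p = lin_ext sc h p"
  by (simp add: lin_ext_def)

definition homogeneous :: "nat \<Rightarrow> ('a list \<Rightarrow>\<^sub>0 'k::field) \<Rightarrow> bool" where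
  "homogeneous n p \<longleftrightarrow> (\<forall>w\<in>Poly_Mapping.keys p. length w = n)"

lemma homogeneous_add: "homogeneous n p \<Longrightarrow> homogeneous n q \<Longrightarrow> homogeneous n (p + q)"
  using Poly_Mapping.keys_add[of p q] by (auto simp: homogeneous_def)

lemma homogeneous_scale: "homogeneous n p \<Longrightarrow> homogeneous n (free_scale c p)"
  by (auto simp: homogeneous_def in_keys_iff)

lemma homogeneous_diff: "homogeneous n p \<Longrightarrow> homogeneous n q \<Longrightarrow> homogeneous n (p - q)"
  using Poly_Mapping.keys_diff[of p q] by (auto simp: homogeneous_def)

lemma homogeneous_word: "homogeneous n (word xs :: 'a list \<Rightarrow>\<^sub>0 'k::field) \<longleftrightarrow> length xs = n"
  by (simp add: homogeneous_def word_def)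

lemma homogeneous_zero: "homogeneous n 0"
  by (simp add: homogeneous_def)

lemma homogeneous_sum:
  "(\<And>x. x \<in> K \<Longrightarrow> homogeneous n (p x)) \<Longrightarrow> homogeneous n (\<Sum>x\<in>K. p x)"
  by (induction K rule: infinite_finite_induct) (auto intro: homogeneous_add homogeneous_zero)

lemma homogeneous_lin_ext:
  "(\<And>x. x \<in> Poly_Mapping.keys p \<Longrightarrow> homogeneous n (g x)) \<Longrightarrow> homogeneous n (lin_ext free_scale g p)"
  unfolding lin_ext_def
  by (intro homogeneous_sum homogeneous_scale)

lemma homogeneous_juxt:
  "homogeneous m p \<Longrightarrow> homogeneous n q \<Longrightarrow> homogeneous (m + n) (juxt p q)"
  unfolding juxt_def
  by (intro homogeneous_lin_ext) (auto simp: homogeneous_def homogeneous_word word_def)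

lemma homogeneous_span:
  "p \<in> free.span W \<Longrightarrow> (\<And>w. w \<in> W \<Longrightarrow> homogeneous n w) \<Longrightarrow> homogeneous n p"
  by (induction rule: free.span_induct_alt)
    (auto intro: homogeneous_add homogeneous_scale homogeneous_zero)

definition multilinear ::
  "('k::field \<Rightarrow> 'h::ab_group_add \<Rightarrow> 'h) \<Rightarrow> ('k \<Rightarrow> 'b::ab_group_add \<Rightarrow> 'b) \<Rightarrow> nat \<Rightarrow> ('h list \<Rightarrow> 'b) \<Rightarrow> bool" where
  "multilinear scale sc n g \<longleftrightarrow> (\<forall>us vs. length us + 1 + length vs = n \<longrightarrow>
     Vector_Spaces.linear scale sc (\<lambda>x. g (us @ x # vs)))"

context vector_space
begin

lemma lin_ext_multilinear_rels:
  assumes "multilinear sc scale n g" and "p \<in> free.span (multilinear_rels sc n)"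
  shows "lin_ext scale g p = 0"
proof (rule lin_ext_eq_0_on_span[OF assms(2)])
  fix w assume w: "w \<in> multilinear_rels sc n"
  have L: "g (us @ (x + y) # vs) = g (us @ x # vs) + g (us @ y # vs)"
    "g (us @ sc c x # vs) = scale c (g (us @ x # vs))"
    if "length us + 1 + length vs = n" for us vs x y c
    using assms(1) that unfolding multilinear_def by (auto simp: Vector_Spaces.linear_iff)
  from w show "lin_ext scale g w = 0"
    unfolding multilinear_rels_def
    by (auto simp: lin_ext_diff lin_ext_free_scale L)
qed

lemma homogeneous_multilinear_rels:
  "p \<in> free.span (multilinear_rels sc n) \<Longrightarrow> homogeneous n p"
  by (erule homogeneous_span)
    (auto simp: multilinear_rels_def intro!: homogeneous_diff homogeneous_scale
      simp: homogeneous_word)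

end

lemma tensor_rep_class: "tensor_rep (tensor_class sc n p) - p \<in> free.span (multilinear_rels sc n)"
proof -
  have "p \<in> tensor_class sc n p"
    by (simp add: tensor_class_def free.span_zero)
  then have "tensor_rep (tensor_class sc n p) \<in> tensor_class sc n p"
    unfolding tensor_rep_def by (rule someI)
  then show ?thesis
    by (simp add: tensor_class_def)
qed

lemma tensor_class_plus: "tensor_class sc n p + tensor_class sc n q = tensor_class sc n (p + q)"
proof (intro equalityI subsetI)
  fix z assume "z \<in> tensor_class sc n p + tensor_class sc n q"
  then obtain a b where "z = a + b" "a - p \<in> free.span (multilinear_rels sc n)"
    "b - q \<in> free.span (multilinear_rels sc n)"
    by (auto simp: tensor_class_def set_plus_def)
  then show "z \<in> tensor_class sc n (p + q)"
    using free.span_add[of "a - p" _ "b - q"] by (simp add: tensor_class_def algebra_simps)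
next
  fix z assume "z \<in> tensor_class sc n (p + q)"
  then have "z - p \<in> tensor_class sc n q" "p \<in> tensor_class sc n p"
    by (simp_all add: tensor_class_def algebra_simps free.span_zero)
  moreover have "z = p + (z - p)" by simp
  ultimately show "z \<in> tensor_class sc n p + tensor_class sc n q"
    unfolding set_plus_def by blast
qed

lemma tensor_class_eqI:
  assumes "p - q \<in> free.span (multilinear_rels sc n)"
  shows "tensor_class sc n p = tensor_class sc n q"
proof -
  have "z - p \<in> free.span (multilinear_rels sc n) \<longleftrightarrow> z - q \<in> free.span (multilinear_rels sc n)" for z
    using free.span_add[OF _ assms, of "z - p"] free.span_diff[OF _ assms, of "z - q"]
    by (auto simp: algebra_simps)
  then show ?thesis
    by (simp add: tensor_class_def)
qed

text \<open>
  The representative picked from a class may differ from the given one, but only by multilinearity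
  relations between words of the same length. A map on words is thus only ever applied to words of
  the expected length.
\<close>

lemma homogeneous_tensor_rep:
  assumes "homogeneous n p"
  shows "homogeneous n (tensor_rep (tensor_class sc n p))"
proof -
  have "homogeneous n (tensor_rep (tensor_class sc n p) - p)"
    using vector_space.homogeneous_multilinear_rels[OF free.vector_space_axioms tensor_rep_class] .
  from homogeneous_add[OF this assms] show ?thesis by simp
qed

context vector_space
begin

lemma tensor_lift_class:
  assumes "multilinear sc scale n g"
  shows "tensor_lift scale g (tensor_class sc n p) = lin_ext scale g p"
  using lin_ext_multilinear_rels[OF assms tensor_rep_class[of sc n p]]
  by (simp add: tensor_lift_def lin_ext_diff)

text \<open>
  The multilinear map \<open>g\<close> removes the choice of a representative of the image. What remains is the
  map \<open>h\<close> on words, applied to the representative of \<open>X\<close>.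
\<close>

lemma tensor_lift_map:
  assumes "multilinear sc scale m g"
  shows "tensor_lift scale g (tensor_map sc m h X) = tensor_lift scale (\<lambda>xs. lin_ext scale g (h xs)) X"
  unfolding tensor_map_def tensor_lift_class[OF assms] lin_ext_lin_ext
  by (simp add: tensor_lift_def)

lemma tensor_lift_funs:
  assumes "multilinear sc scale (length fs) g"
  shows "tensor_lift scale g (tensor_funs sc fs X) =
    tensor_lift scale (\<lambda>xs. g (map2 (\<lambda>f x. f x) fs xs)) X"
  by (simp add: tensor_funs_def tensor_lift_map[OF assms])

lemma tensor_lift_times:
  assumes "multilinear sc scale n g"
  shows "tensor_lift scale g (tensor_times sc n X Y) =
    tensor_lift scale (\<lambda>xs. tensor_lift scale (\<lambda>ys. g (map2 (*) xs ys)) Y) X"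
  by (simp add: tensor_times_def tensor_lift_map[OF assms] lin_ext_lin_ext)
    (simp add: tensor_lift_def)

lemma tensor_lift_comult_at:
  assumes "multilinear sc scale (n + 1) g"
  shows "tensor_lift scale g (comult_at sc \<Delta> n i X) =
    tensor_lift scale (\<lambda>xs. tensor_lift scale (\<lambda>ys. g (take i xs @ ys @ drop (i + 1) xs)) (\<Delta> (xs ! i))) X"
  unfolding comult_at_def tensor_lift_map[OF assms]
  by (simp add: lin_ext_juxt) (simp add: tensor_lift_def)

lemma tensor_lift_cong:
  assumes "homogeneous n (tensor_rep X)" "\<And>xs. length xs = n \<Longrightarrow> g xs = h xs"
  shows "tensor_lift sc g X = tensor_lift sc h X"
  unfolding tensor_lift_def
  by (rule lin_ext_cong) (use assms in \<open>auto simp: homogeneous_def\<close>)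

end

text \<open>
  Equality of tensors and membership in a subspace of the tensor power can be tested by
  multilinear forms: a linear form on the free space that vanishes on the relations is a
  multilinear form on words.
\<close>

lemma mem_span_if_multilinear_forms_vanish:
  fixes sc :: "'k::field \<Rightarrow> 'h::ab_group_add \<Rightarrow> 'h"
  assumes sc: "vector_space sc"
    and vanish: "\<And>g :: 'h list \<Rightarrow> 'k. multilinear sc (*) n g \<Longrightarrow> (\<And>w. w \<in> W \<Longrightarrow> lin_ext (*) g w = 0) \<Longrightarrow>
      lin_ext (*) g p = 0"
  shows "p \<in> free.span (multilinear_rels sc n \<union> W)"
proof (rule ccontr)
  interpret K: vector_space "(*) :: 'k \<Rightarrow> 'k \<Rightarrow> 'k"
    by unfold_locales (auto simp: algebra_simps)
  interpret sc: vector_space sc by (rule sc)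
  assume "p \<notin> free.span (multilinear_rels sc n \<union> W)"
  then obtain \<Phi> where \<Phi>: "Vector_Spaces.linear free_scale (*) \<Phi>"
    "\<And>q. q \<in> free.span (multilinear_rels sc n \<union> W) \<Longrightarrow> \<Phi> q = 0" "\<Phi> p = 1"
    using free.exists_functional_separating[OF free.subspace_span] by metis
  have add: "\<Phi> (q + q') = \<Phi> q + \<Phi> q'" and scl: "\<Phi> (free_scale c q) = c * \<Phi> q" for q q' c
    using \<Phi>(1) by (auto simp: Vector_Spaces.linear_iff)
  have diff: "\<Phi> (q - q') = \<Phi> q - \<Phi> q'" for q q'
    using add[of "q - q'" q'] by simp
  have zero: "\<Phi> 0 = 0"
    using \<Phi>(2)[OF free.span_zero] .
  have sum: "\<Phi> (\<Sum>i\<in>I. q i) = (\<Sum>i\<in>I. \<Phi> (q i))" for I and q :: "'h list \<Rightarrow> _"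
    by (induction I rule: infinite_finite_induct) (auto simp: add zero)
  define g where "g xs = \<Phi> (word xs)" for xs
  have ext: "lin_ext (*) g q = \<Phi> q" for q
  proof -
    have "\<Phi> q = \<Phi> (lin_ext free_scale word q)"
      by (simp add: lin_ext_word_id)
    also have "\<dots> = lin_ext (*) g q"
      unfolding lin_ext_def g_def sum scl ..
    finally show ?thesis ..
  qed
  have "multilinear sc (*) n g"
    unfolding multilinear_def
  proof (intro allI impI)
    fix us vs :: "'h list" assume len: "length us + 1 + length vs = n"
    have "g (us @ (x + y) # vs) = g (us @ x # vs) + g (us @ y # vs)" for x y
    proof -
      have "word (us @ (x + y) # vs) - word (us @ x # vs) - word (us @ y # vs) \<in>
        free.span (multilinear_rels sc n \<union> W)"
        using len unfolding multilinear_rels_def by (intro free.span_base) blast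
      from \<Phi>(2)[OF this] show ?thesis
        by (simp add: g_def diff) (simp only: diff_eq_eq add.commute)
    qed
    moreover have "g (us @ sc c x # vs) = c * g (us @ x # vs)" for c x
    proof -
      have "word (us @ sc c x # vs) - free_scale c (word (us @ x # vs)) \<in>
        free.span (multilinear_rels sc n \<union> W)"
        using len unfolding multilinear_rels_def by (intro free.span_base) blast
      from \<Phi>(2)[OF this] show ?thesis
        by (simp add: g_def diff scl)
    qed
    ultimately show "Vector_Spaces.linear sc (*) (\<lambda>x. g (us @ x # vs))"
      by (simp add: Vector_Spaces.linear_iff sc.vector_space_axioms K.vector_space_axioms)
  qed
  moreover have "lin_ext (*) g w = 0" if "w \<in> W" for w
    using \<Phi>(2) that by (simp add: ext free.span_base)
  ultimately have "lin_ext (*) g p = 0"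
    by (rule vanish)
  then show False
    using \<Phi>(3) by (simp add: ext)
qed

section \<open>Linear and bilinear maps\<close>

text \<open>
  These rules prove that an expression is linear in a variable that occurs exactly once in each
  summand, by following the path from the root to that occurrence.
\<close>

named_theorems lin_intros

context coalgebra
begin

abbreviation lin :: "('h \<Rightarrow> 'h) \<Rightarrow> bool" where
  "lin \<equiv> Vector_Spaces.linear scale scale"

abbreviation functional :: "('h \<Rightarrow> 'k) \<Rightarrow> bool" where
  "functional \<equiv> Vector_Spaces.linear scale (*)"

definition bilin :: "('h \<Rightarrow> 'h \<Rightarrow> 'h) \<Rightarrow> bool" where
  "bilin F \<longleftrightarrow> (\<forall>b. lin (\<lambda>a. F a b)) \<and> (\<forall>a. lin (\<lambda>b. F a b))"

lemma lin_iff: "lin f \<longleftrightarrow> (\<forall>x y. f (x + y) = f x + f y) \<and> (\<forall>c x. f (scale c x) = scale c (f x))"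
  by (simp add: Vector_Spaces.linear_iff vector_space_axioms)

lemma functional_iff:
  "functional f \<longleftrightarrow> (\<forall>x y. f (x + y) = f x + f y) \<and> (\<forall>c x. f (scale c x) = c * f x)"
  by (simp add: Vector_Spaces.linear_iff vector_space_axioms vector_space_over_itself)

lemma bilinI: "(\<And>b. lin (\<lambda>a. F a b)) \<Longrightarrow> (\<And>a. lin (\<lambda>b. F a b)) \<Longrightarrow> bilin F"
  by (simp add: bilin_def)

lemma lin_add: "lin f \<Longrightarrow> f (x + y) = f x + f y"
  and lin_scale: "lin f \<Longrightarrow> f (scale c x) = scale c (f x)"
  by (auto simp: lin_iff)

lemma lin_zero: "lin f \<Longrightarrow> f 0 = 0"
  using lin_scale[of f 0 0] by simp

lemma lin_diff: "lin f \<Longrightarrow> f (x - y) = f x - f y"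
  using lin_add[of f "x - y" y] by simp

lemma lin_sum: "lin f \<Longrightarrow> f (\<Sum>i\<in>I. g i) = (\<Sum>i\<in>I. f (g i))"
  by (induction I rule: infinite_finite_induct) (auto simp: lin_add lin_zero)

lemma functional_add: "functional f \<Longrightarrow> f (x + y) = f x + f y"
  and functional_scale: "functional f \<Longrightarrow> f (scale c x) = c * f x"
  by (auto simp: functional_iff)

lemma functional_zero: "functional f \<Longrightarrow> f 0 = 0"
  using functional_scale[of f 0 0] by simp

lemma functional_diff: "functional f \<Longrightarrow> f (x - y) = f x - f y"
  using functional_add[of f "x - y" y] by simp

lemma bilinD1: "bilin F \<Longrightarrow> lin (\<lambda>a. F a b)"
  and bilinD2: "bilin F \<Longrightarrow> lin (\<lambda>b. F a b)"
  by (auto simp: bilin_def)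

lemma lin_ident [lin_intros]: "lin (\<lambda>x. x)"
  by (simp add: lin_iff)

lemma lin_scaled [lin_intros]: "lin f \<Longrightarrow> lin (\<lambda>x. scale c (f x))"
  by (simp add: lin_iff scale_right_distrib mult.commute)

lemma lin_scaled_fixed [lin_intros]: "functional f \<Longrightarrow> lin (\<lambda>x. scale (f x) b)"
  by (simp add: lin_iff functional_iff scale_left_distrib)

lemma lin_plus [lin_intros]: "lin f \<Longrightarrow> lin g \<Longrightarrow> lin (\<lambda>x. f x + g x)"
  by (simp add: lin_iff scale_right_distrib)

lemma lin_minus_minus [lin_intros]: "lin f \<Longrightarrow> lin g \<Longrightarrow> lin (\<lambda>x. f x - g x)"
  by (simp add: lin_iff scale_right_diff_distrib)

lemma lin_uminus [lin_intros]: "lin f \<Longrightarrow> lin (\<lambda>x. - f x)"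
  by (simp add: lin_iff)

lemma lin_compose: "lin f \<Longrightarrow> lin g \<Longrightarrow> lin (\<lambda>x. f (g x))"
  by (simp add: lin_iff)

lemma functional_compose: "functional f \<Longrightarrow> lin g \<Longrightarrow> functional (\<lambda>x. f (g x))"
  by (simp add: lin_iff functional_iff)

lemma bilin_compose1: "bilin F \<Longrightarrow> lin g \<Longrightarrow> lin (\<lambda>x. F (g x) b)"
  and bilin_compose2: "bilin F \<Longrightarrow> lin g \<Longrightarrow> lin (\<lambda>x. F a (g x))"
  by (auto simp: lin_iff bilin_def)

lemma functional_times_left: "functional f \<Longrightarrow> functional (\<lambda>x. f x * c)"
  and functional_times_right: "functional f \<Longrightarrow> functional (\<lambda>x. c * f x)"
  by (simp_all add: functional_iff algebra_simps)

lemma lin_funpow: "lin f \<Longrightarrow> lin (f ^^ n)"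
  by (induction n) (auto simp: lin_iff)

end

section \<open>Sweedler sums\<close>

context coalgebra
begin

text \<open>
  The Sweedler sum \<open>\<Sum> F(x\<^sub>1, x\<^sub>2)\<close> of a bilinear map with values in \<open>H\<close>. Forms with values in the
  field enter as multiples of a fixed vector, so that a single sum suffices for the whole theory.
\<close>

definition sw :: "('h \<Rightarrow> 'h \<Rightarrow> 'h) \<Rightarrow> 'h \<Rightarrow> 'h" where
  "sw F x = tensor_lift scale (\<lambda>xs. F (xs ! 0) (xs ! 1)) (\<Delta> x)"

lemma sw_eq_sum:
  "sw F x = (\<Sum>w\<in>Poly_Mapping.keys (tensor_rep (\<Delta> x)).
     scale (Poly_Mapping.lookup (tensor_rep (\<Delta> x)) w) (F (w ! 0) (w ! 1)))"
  by (simp add: sw_def tensor_lift_def lin_ext_def)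

lemma comult_eq_class:
  obtains p where "\<Delta> x = tensor_class scale 2 p" "homogeneous 2 p"
proof -
  obtain p where p: "\<Delta> x = tensor_class scale 2 p"
    "p \<in> free.span {word xs |xs. list_all2 (\<in>) xs [UNIV, UNIV :: 'h set]}"
    using comult_tensor[of x] unfolding tensor_space_def by (auto simp: numeral_2_eq_2)
  from p(2) have "homogeneous 2 p"
    by (rule homogeneous_span) (auto simp: homogeneous_word dest!: list_all2_lengthD)
  with p(1) show thesis
    by (rule that)
qed

lemma homogeneous_comult: "homogeneous 2 (tensor_rep (\<Delta> x))"
  by (rule comult_eq_class[of x]) (simp add: homogeneous_tensor_rep)

lemma multilinear_two:
  assumes "bilin F"
  shows "multilinear scale scale 2 (\<lambda>xs. F (xs ! 0) (xs ! 1))"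
  unfolding multilinear_def
proof (intro allI impI)
  fix us vs :: "'h list" assume "length us + 1 + length vs = 2"
  then consider u where "us = [u]" "vs = []" | v where "us = []" "vs = [v]"
    by (cases us; cases vs) auto
  then show "lin (\<lambda>x. F ((us @ x # vs) ! 0) ((us @ x # vs) ! 1))"
    using assms by cases (auto simp: bilin_def)
qed

lemma sw_class:
  assumes "bilin F" "\<Delta> x = tensor_class scale 2 p"
  shows "sw F x = lin_ext scale (\<lambda>xs. F (xs ! 0) (xs ! 1)) p"
  unfolding sw_def assms(2) by (rule tensor_lift_class[OF multilinear_two[OF assms(1)]])

lemma tensor_lift_comult:
  assumes "\<And>a b. g [a, b] = F a b"
  shows "tensor_lift scale g (\<Delta> x) = sw F x"
  unfolding sw_def
proof (rule tensor_lift_cong[OF homogeneous_comult])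
  fix xs :: "'h list" assume "length xs = 2"
  then obtain a b where "xs = [a, b]"
    by (auto simp: numeral_2_eq_2 length_Suc_conv)
  then show "g xs = F (xs ! 0) (xs ! 1)"
    by (simp add: assms)
qed

lemma sw_add_arg:
  assumes "bilin F"
  shows "sw F (x + y) = sw F x + sw F y"
proof -
  obtain p q where pq: "\<Delta> x = tensor_class scale 2 p" "\<Delta> y = tensor_class scale 2 q"
    by (metis comult_eq_class)
  then have "\<Delta> (x + y) = tensor_class scale 2 (p + q)"
    by (simp add: comult_add tensor_class_plus)
  with pq show ?thesis
    by (simp add: sw_class[OF assms] lin_ext_add)
qed

lemma sw_scale_arg:
  assumes "bilin F"
  shows "sw F (scale c x) = scale c (sw F x)"
proof -
  have "sw F (scale c x) = lin_ext scale (\<lambda>xs. F (xs ! 0) (xs ! 1)) (free_scale c (tensor_rep (\<Delta> x)))"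
    by (rule sw_class[OF assms]) (simp add: comult_scale tensor_scale_def)
  also have "\<dots> = scale c (sw F x)"
    by (simp add: lin_ext_free_scale sw_def tensor_lift_def)
  finally show ?thesis .
qed

lemma lin_sw: "bilin F \<Longrightarrow> lin (sw F)"
  by (simp add: lin_iff sw_add_arg sw_scale_arg)

lemma sw_add: "sw (\<lambda>a b. F a b + G a b) x = sw F x + sw G x"
  by (simp add: sw_eq_sum scale_right_distrib sum.distrib)

lemma sw_diff: "sw (\<lambda>a b. F a b - G a b) x = sw F x - sw G x"
  by (simp add: sw_eq_sum scale_right_diff_distrib sum_subtractf)

lemma sw_scale: "sw (\<lambda>a b. scale c (F a b)) x = scale c (sw F x)"
  by (simp add: sw_eq_sum scale_sum_right mult.commute)

lemma sw_zero [simp]: "sw (\<lambda>a b. 0) x = 0"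
  by (simp add: sw_eq_sum)

lemma sw_sum: "sw (\<lambda>a b. \<Sum>i\<in>I. F i a b) x = (\<Sum>i\<in>I. sw (F i) x)"
  by (induction I rule: infinite_finite_induct) (auto simp: sw_add)

lemma lin_apply_sw: "lin f \<Longrightarrow> f (sw F x) = sw (\<lambda>a b. f (F a b)) x"
  by (simp add: sw_eq_sum lin_sum lin_scale)

lemma sw_swap: "sw (\<lambda>a b. sw (\<lambda>c d. F a b c d) y) x = sw (\<lambda>c d. sw (\<lambda>a b. F a b c d) x) y"
  by (simp add: sw_eq_sum scale_sum_right sum.swap[of _ "Poly_Mapping.keys (tensor_rep (\<Delta> y))"]
      mult.commute)

lemma lin_sw_fun [lin_intros]: "(\<And>a b. lin (\<lambda>x. F x a b)) \<Longrightarrow> lin (\<lambda>x. sw (\<lambda>a b. F x a b) y)"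
  by (simp add: lin_iff sw_eq_sum scale_right_distrib sum.distrib scale_sum_right mult.commute)

lemma lin_sw_arg [lin_intros]:
  "(\<And>b. lin (\<lambda>a. F a b)) \<Longrightarrow> (\<And>a. lin (\<lambda>b. F a b)) \<Longrightarrow> lin f \<Longrightarrow> lin (\<lambda>x. sw (\<lambda>a b. F a b) (f x))"
  using lin_compose[OF lin_sw[OF bilinI]] by auto

lemma counit_functional: "functional \<epsilon>"
  by (rule counit_linear)

lemmas [lin_intros] = lin_scaled_fixed[OF functional_compose[OF counit_functional]]

lemma sw_counit_left: "lin f \<Longrightarrow> sw (\<lambda>a b. scale (\<epsilon> a) (f b)) x = f x"
proof -
  assume f: "lin f"
  have "sw (\<lambda>a b. scale (\<epsilon> a) b) x = x"
    using counit_left[of x] by (simp add: sw_def)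
  then have "f (sw (\<lambda>a b. scale (\<epsilon> a) b) x) = f x" by simp
  then show ?thesis
    by (simp add: lin_apply_sw[OF f] lin_scale[OF f])
qed

lemma sw_counit_right: "lin f \<Longrightarrow> sw (\<lambda>a b. scale (\<epsilon> b) (f a)) x = f x"
proof -
  assume f: "lin f"
  have "sw (\<lambda>a b. scale (\<epsilon> b) a) x = x"
    using counit_right[of x] by (simp add: sw_def)
  then have "f (sw (\<lambda>a b. scale (\<epsilon> b) a) x) = f x" by simp
  then show ?thesis
    by (simp add: lin_apply_sw[OF f] lin_scale[OF f])
qed

lemma multilinear_three:
  assumes "\<And>b c. lin (\<lambda>a. F a b c)" "\<And>a c. lin (\<lambda>b. F a b c)" "\<And>a b. lin (\<lambda>c. F a b c)"
  shows "multilinear scale scale 3 (\<lambda>xs. F (xs ! 0) (xs ! 1) (xs ! 2))"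
  unfolding multilinear_def
proof (intro allI impI)
  fix us vs :: "'h list" assume *: "length us + 1 + length vs = 3"
  consider u u' where "us = [u, u']" "vs = []" | u v where "us = [u]" "vs = [v]"
    | v v' where "us = []" "vs = [v, v']"
    using * by (cases us; cases "tl us"; cases vs; cases "tl vs") auto
  then show "lin (\<lambda>x. F ((us @ x # vs) ! 0) ((us @ x # vs) ! 1) ((us @ x # vs) ! 2))"
    using assms by cases auto
qed

text \<open>Coassociativity, oriented towards splitting the second tensor factor.\<close>

lemma sw_coassoc:
  assumes "\<And>b c. lin (\<lambda>a. F a b c)" "\<And>a c. lin (\<lambda>b. F a b c)" "\<And>a b. lin (\<lambda>c. F a b c)"
  shows "sw (\<lambda>a c. sw (\<lambda>u v. F u v c) a) x = sw (\<lambda>a c. sw (\<lambda>u v. F a u v) c) x"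
proof -
  let ?g = "\<lambda>xs. F (xs ! 0) (xs ! 1) (xs ! 2)"
  have m: "multilinear scale scale (2 + 1) ?g"
    using multilinear_three[of F] assms by simp
  have "tensor_lift scale ?g (comult_at scale \<Delta> 2 0 (\<Delta> x)) = sw (\<lambda>a c. sw (\<lambda>u v. F u v c) a) x"
    unfolding tensor_lift_comult_at[OF m]
    by (rule tensor_lift_comult) (simp, rule tensor_lift_comult, simp)
  moreover have "tensor_lift scale ?g (comult_at scale \<Delta> 2 1 (\<Delta> x)) = sw (\<lambda>a c. sw (\<lambda>u v. F a u v) c) x"
    unfolding tensor_lift_comult_at[OF m]
    by (rule tensor_lift_comult) (simp, rule tensor_lift_comult, simp)
  ultimately show ?thesis
    by (simp add: coassoc)
qed

text \<open>
  If a tensor does not lie in the given subspace, a linear form separates it from the subspace. This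
  form is a scalar bilinear form on \<open>H\<close>; multiplied by a vector \<open>v\<close> it takes values in \<open>H\<close>. The case
  \<open>H = 0\<close>, where no nonzero \<open>v\<close> exists, is settled separately.
\<close>

lemma comult_mem_span_iff:
  "\<Delta> x \<in> tensor_class scale 2 ` free.span ((\<lambda>(a, b). word [a, b]) ` R) \<longleftrightarrow>
    (\<forall>F. bilin F \<longrightarrow> (\<forall>(a, b)\<in>R. F a b = 0) \<longrightarrow> sw F x = 0)"
    (is "?L \<longleftrightarrow> ?R")
proof
  assume ?L
  then obtain p where p: "\<Delta> x = tensor_class scale 2 p"
    "p \<in> free.span ((\<lambda>(a, b). word [a, b]) ` R)"
    by auto
  show ?R
  proof (intro allI impI)
    fix F assume F: "bilin F" "\<forall>(a, b)\<in>R. F a b = 0"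
    show "sw F x = 0"
      unfolding sw_class[OF F(1) p(1)]
      by (rule lin_ext_eq_0_on_span[OF p(2)]) (use F(2) in auto)
  qed
next
  assume R: ?R
  let ?W = "(\<lambda>(a, b). word [a, b]) ` R"
  interpret K: vector_space "(*) :: 'k \<Rightarrow> 'k \<Rightarrow> 'k"
    by (rule vector_space_over_itself)
  obtain p where p: "\<Delta> x = tensor_class scale 2 p" "homogeneous 2 p"
    by (rule comult_eq_class)
  have "p \<in> free.span (multilinear_rels scale 2 \<union> ?W)"
  proof (rule mem_span_if_multilinear_forms_vanish[OF vector_space_axioms])
    fix g :: "'h list \<Rightarrow> 'k"
    assume g: "multilinear scale (*) 2 g" "\<And>w. w \<in> ?W \<Longrightarrow> lin_ext (*) g w = 0"
    have g1: "functional (\<lambda>a. g [a, b])" for b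
      using g(1)[unfolded multilinear_def, rule_format, of "[]" "[b]"] by simp
    have g2: "functional (\<lambda>b. g [a, b])" for a
      using g(1)[unfolded multilinear_def, rule_format, of "[a]" "[]"] by simp
    have gR: "g [a, b] = 0" if "(a, b) \<in> R" for a b
    proof -
      have "lin_ext (*) g (word [a, b]) = 0"
        using that by (intro g(2) image_eqI[of _ _ "(a, b)"]) simp_all
      then show ?thesis
        by simp
    qed
    have word2: "w = [w ! 0, w ! 1]" if "w \<in> Poly_Mapping.keys p" for w
      using p(2) that by (cases w; cases "tl w") (auto simp: homogeneous_def)
    have "scale (lin_ext (*) g p) v = 0" for v
    proof -
      have B: "bilin (\<lambda>a b. scale (g [a, b]) v)"
        by (intro bilinI lin_scaled_fixed g1 g2)
      then have "0 = sw (\<lambda>a b. scale (g [a, b]) v) x"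
        using R gR by auto
      also have "\<dots> = lin_ext scale (\<lambda>xs. scale (g [xs ! 0, xs ! 1]) v) p"
        by (rule sw_class[OF B p(1)])
      also have "\<dots> = (\<Sum>w\<in>Poly_Mapping.keys p. scale (Poly_Mapping.lookup p w * g w) v)"
        unfolding lin_ext_def by (rule sum.cong) (use word2 in auto)
      also have "\<dots> = scale (lin_ext (*) g p) v"
        by (simp add: lin_ext_def scale_sum_left)
      finally show ?thesis ..
    qed
    moreover have "lin_ext (*) g p = 0" if "\<And>v :: 'h. v = 0"
    proof -
      have "g w = 0" if "w \<in> Poly_Mapping.keys p" for w
      proof -
        have "g [0, w ! 1] = 0"
          using functional_zero[OF g1] .
        moreover have "w ! 0 = 0"
          by (rule \<open>\<And>v :: 'h. v = 0\<close>)
        ultimately show ?thesis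
          using word2[OF that] by metis
      qed
      then show ?thesis
        by (simp add: lin_ext_def)
    qed
    ultimately show "lin_ext (*) g p = 0"
      by (metis scale_eq_0_iff)
  qed
  then obtain q r where "p = q + r" "q \<in> free.span (multilinear_rels scale 2)" "r \<in> free.span ?W"
    unfolding free.span_Un by blast
  then have "\<Delta> x = tensor_class scale 2 r"
    unfolding p(1) by (intro tensor_class_eqI) simp
  with \<open>r \<in> free.span ?W\<close> show ?L
    by blast
qed

lemma tensor_space_two:
  "tensor_space scale [C, D] = tensor_class scale 2 ` free.span ((\<lambda>(a, b). word [a, b]) ` (C \<times> D))"
proof -
  have "{word xs :: 'h list \<Rightarrow>\<^sub>0 'k |xs. list_all2 (\<in>) xs [C, D]} = (\<lambda>(a, b). word [a, b]) ` (C \<times> D)"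
    by (auto simp: list_all2_Cons2 image_iff)
  moreover have "length [C, D] = 2"
    by simp
  ultimately show ?thesis
    unfolding tensor_space_def by (simp only:)
qed

lemma tensor_space_two_plus:
  "tensor_space scale [C, D] + tensor_space scale [C', D'] =
    tensor_class scale 2 ` free.span ((\<lambda>(a, b). word [a, b]) ` (C \<times> D \<union> C' \<times> D'))"
proof -
  let ?W = "(\<lambda>(a, b). word [a, b]) ` (C \<times> D)" and ?W' = "(\<lambda>(a, b). word [a, b]) ` (C' \<times> D')"
  have W: "(\<lambda>(a, b). word [a, b]) ` (C \<times> D \<union> C' \<times> D') = ?W \<union> ?W'"
    by (rule image_Un)
  show ?thesis
  proof (intro equalityI subsetI)
    fix X assume "X \<in> tensor_space scale [C, D] + tensor_space scale [C', D']"
    then obtain p q where "X = tensor_class scale 2 p + tensor_class scale 2 q"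
      "p \<in> free.span ?W" "q \<in> free.span ?W'"
      unfolding tensor_space_two by (elim set_plus_elim imageE) simp
    then show "X \<in> tensor_class scale 2 ` free.span ((\<lambda>(a, b). word [a, b]) ` (C \<times> D \<union> C' \<times> D'))"
      unfolding W free.span_Un tensor_class_plus by (intro image_eqI[of _ _ "p + q"] CollectI) auto
  next
    fix X assume "X \<in> tensor_class scale 2 ` free.span ((\<lambda>(a, b). word [a, b]) ` (C \<times> D \<union> C' \<times> D'))"
    then obtain p q where "X = tensor_class scale 2 (p + q)"
      "p \<in> free.span ?W" "q \<in> free.span ?W'"
      unfolding W free.span_Un by auto
    then show "X \<in> tensor_space scale [C, D] + tensor_space scale [C', D']"
      unfolding tensor_space_two tensor_class_plus[symmetric] by (auto intro!: set_plus_intro)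
  qed
qed

text \<open>The wedge \<open>\<Delta>\<^sup>-\<^sup>1(H \<otimes> V + U \<otimes> H)\<close> of two subspaces.\<close>

definition wedge :: "'h set \<Rightarrow> 'h set \<Rightarrow> 'h set" where
  "wedge U V = {x. \<Delta> x \<in> tensor_space scale [UNIV, V] + tensor_space scale [U, UNIV]}"

lemma wedge_iff:
  "x \<in> wedge U V \<longleftrightarrow> (\<forall>F. bilin F \<longrightarrow> (\<forall>u\<in>U. \<forall>b. F u b = 0) \<longrightarrow> (\<forall>a. \<forall>v\<in>V. F a v = 0) \<longrightarrow> sw F x = 0)"
  unfolding wedge_def mem_Collect_eq tensor_space_two_plus comult_mem_span_iff by auto

lemma wedgeI:
  "(\<And>F. bilin F \<Longrightarrow> (\<And>u b. u \<in> U \<Longrightarrow> F u b = 0) \<Longrightarrow> (\<And>a v. v \<in> V \<Longrightarrow> F a v = 0) \<Longrightarrow> sw F x = 0) \<Longrightarrow>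
    x \<in> wedge U V"
  by (auto simp: wedge_iff)

lemma wedgeD:
  "x \<in> wedge U V \<Longrightarrow> bilin F \<Longrightarrow> (\<And>u b. u \<in> U \<Longrightarrow> F u b = 0) \<Longrightarrow> (\<And>a v. v \<in> V \<Longrightarrow> F a v = 0) \<Longrightarrow>
    sw F x = 0"
  by (auto simp: wedge_iff)

lemma wedge_mono: "U \<subseteq> U' \<Longrightarrow> V \<subseteq> V' \<Longrightarrow> wedge U V \<subseteq> wedge U' V'"
  unfolding wedge_iff subset_iff by blast

lemma subspace_wedge: "subspace (wedge U V)"
  unfolding subspace_def
proof (intro conjI ballI allI)
  show "0 \<in> wedge U V"
    by (rule wedgeI) (simp add: lin_zero[OF lin_sw])
  show "x + y \<in> wedge U V" if "x \<in> wedge U V" "y \<in> wedge U V" for x y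
    by (rule wedgeI) (simp add: sw_add_arg wedgeD[OF that(1)] wedgeD[OF that(2)])
  show "scale c x \<in> wedge U V" if "x \<in> wedge U V" for c x
    by (rule wedgeI) (simp add: sw_scale_arg wedgeD[OF that])
qed

lemma coradical_filtration_Suc:
  "coradical_filtration (Suc n) = wedge coradical (coradical_filtration n)"
  by (simp add: wedge_def)

lemma subcoalgebra_iff:
  "subcoalgebra C \<longleftrightarrow> subspace C \<and>
    (\<forall>x\<in>C. \<forall>F. bilin F \<longrightarrow> (\<forall>a\<in>C. \<forall>b\<in>C. F a b = 0) \<longrightarrow> sw F x = 0)"
  unfolding subcoalgebra_def image_subset_iff tensor_space_two comult_mem_span_iff by auto

lemma sw_subcoalgebra_zero:
  assumes "subcoalgebra C" "x \<in> C" "bilin F" "\<And>a b. a \<in> C \<Longrightarrow> b \<in> C \<Longrightarrow> F a b = 0"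
  shows "sw F x = 0"
  using assms by (auto simp: subcoalgebra_iff)

lemma sw_subcoalgebra_cong:
  assumes "subcoalgebra C" "x \<in> C" "bilin F" "bilin G" "\<And>a b. a \<in> C \<Longrightarrow> b \<in> C \<Longrightarrow> F a b = G a b"
  shows "sw F x = sw G x"
proof -
  have "bilin (\<lambda>a b. F a b - G a b)"
    using assms(3,4) unfolding bilin_def by (auto intro: lin_intros)
  then have "sw (\<lambda>a b. F a b - G a b) x = 0"
    by (rule sw_subcoalgebra_zero[OF assms(1,2)]) (simp add: assms(5))
  then show ?thesis
    by (simp add: sw_diff)
qed

end

locale finite_dim_coalgebra = coalgebra scale \<Delta> \<epsilon>
  for scale :: "'k::field \<Rightarrow> 'h::ab_group_add \<Rightarrow> 'h"
    and \<Delta> :: "'h \<Rightarrow> ('h, 'k) tensor"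
    and \<epsilon> :: "'h \<Rightarrow> 'k" +
  assumes finite_dim: "\<exists>B. finite B \<and> span B = UNIV"
begin

lemma coordinates:
  obtains E c where "finite E" "\<forall>e. functional (c e)" "\<forall>x. x = (\<Sum>e\<in>E. scale (c e x) e)"
proof -
  obtain B where "finite B" "span B = UNIV"
    using finite_dim by blast
  then show thesis
    using that by (rule exists_coordinates)
qed

text \<open>
  Expanding one tensor factor in a finite basis turns a Sweedler sum of \<open>F\<close> into values of \<open>F\<close> on the
  slices \<open>\<Sum> \<phi>(x\<^sub>1) x\<^sub>2\<close>, or \<open>\<Sum> \<phi>(x\<^sub>2) x\<^sub>1\<close>, with \<open>\<phi>\<close> running through the coordinate functionals.
\<close>

lemma sw_eq_0_if_right_slices:
  assumes F: "bilin F" and V: "\<And>\<phi>. functional \<phi> \<Longrightarrow> sw (\<lambda>a b. scale (\<phi> a) b) x \<in> V"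
    and zero: "\<And>a v. v \<in> V \<Longrightarrow> F a v = 0"
  shows "sw F x = 0"
proof -
  obtain E c where E: "finite E" "\<forall>e. functional (c e)" "\<forall>x. x = (\<Sum>e\<in>E. scale (c e x) e)"
    by (rule coordinates)
  have "F a b = (\<Sum>e\<in>E. F e (scale (c e a) b))" for a b
  proof -
    have "F a b = F (\<Sum>e\<in>E. scale (c e a) e) b"
      by (rule arg_cong[OF E(3)[rule_format]])
    also have "\<dots> = (\<Sum>e\<in>E. F e (scale (c e a) b))"
      by (simp add: lin_sum[OF bilinD1[OF F]] lin_scale[OF bilinD1[OF F]] lin_scale[OF bilinD2[OF F]])
    finally show ?thesis .
  qed
  then have "sw F x = sw (\<lambda>a b. \<Sum>e\<in>E. F e (scale (c e a) b)) x"
    by (intro arg_cong[of _ _ "\<lambda>G. sw G x"] ext)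
  also have "\<dots> = (\<Sum>e\<in>E. F e (sw (\<lambda>a b. scale (c e a) b) x))"
    by (simp add: sw_sum lin_apply_sw[OF bilinD2[OF F]])
  also have "\<dots> = 0"
    by (simp add: zero V E(2))
  finally show ?thesis .
qed

text \<open>
  If \<open>F\<close> vanishes on \<open>H \<times> E\<close>, its second argument may first be sent through a linear map with kernel
  \<open>E\<close>. The coordinate functionals composed with this map annihilate \<open>E\<close>.
\<close>

lemma sw_eq_0_if_left_slices_annihilator:
  assumes F: "bilin F" and E: "subspace E" "\<And>a v. v \<in> E \<Longrightarrow> F a v = 0"
    and V: "\<And>\<phi>. functional \<phi> \<Longrightarrow> (\<And>v. v \<in> E \<Longrightarrow> \<phi> v = 0) \<Longrightarrow> sw (\<lambda>a b. scale (\<phi> b) a) x \<in> V"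
    and zero: "\<And>v b. v \<in> V \<Longrightarrow> F v b = 0"
  shows "sw F x = 0"
proof -
  obtain K c where K: "finite K" "\<forall>e. functional (c e)" "\<forall>x. x = (\<Sum>e\<in>K. scale (c e x) e)"
    by (rule coordinates)
  obtain s where s: "lin s" "\<forall>u\<in>E. s u = 0" "\<forall>x. x - s x \<in> E"
    by (rule exists_linear_with_kernel[OF E(1)])
  have "F a b = (\<Sum>e\<in>K. F (scale (c e (s b)) a) e)" for a b
  proof -
    have "F a b = F a (s b)"
      using E(2)[OF s(3)[rule_format, of b], of a] by (simp add: lin_diff[OF bilinD2[OF F]])
    also have "\<dots> = F a (\<Sum>e\<in>K. scale (c e (s b)) e)"
      by (rule arg_cong[OF K(3)[rule_format]])
    also have "\<dots> = (\<Sum>e\<in>K. F (scale (c e (s b)) a) e)"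
      by (simp add: lin_sum[OF bilinD2[OF F]] lin_scale[OF bilinD1[OF F]] lin_scale[OF bilinD2[OF F]])
    finally show ?thesis .
  qed
  then have "sw F x = sw (\<lambda>a b. \<Sum>e\<in>K. F (scale (c e (s b)) a) e) x"
    by (intro arg_cong[of _ _ "\<lambda>G. sw G x"] ext)
  also have "\<dots> = (\<Sum>e\<in>K. F (sw (\<lambda>a b. scale (c e (s b)) a) x) e)"
    by (simp add: sw_sum lin_apply_sw[OF bilinD1[OF F]])
  also have "\<dots> = 0"
  proof (intro sum.neutral ballI zero V)
    fix e
    show "functional (\<lambda>b. c e (s b))"
      by (rule functional_compose[OF K(2)[rule_format] s(1)])
    show "c e (s v) = 0" if "v \<in> E" for v
      using s(2) that functional_zero[OF K(2)[rule_format]] by simp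
  qed
  finally show ?thesis .
qed

lemma sw_eq_0_if_left_slices:
  assumes F: "bilin F" and V: "\<And>\<phi>. functional \<phi> \<Longrightarrow> sw (\<lambda>a b. scale (\<phi> b) a) x \<in> V"
    and zero: "\<And>a v. v \<in> V \<Longrightarrow> F v a = 0"
  shows "sw F x = 0"
  by (rule sw_eq_0_if_left_slices_annihilator[OF F subspace_single_0 _ V zero])
    (auto simp: lin_zero[OF bilinD2[OF F]])

text \<open>
  Let \<open>r\<close> be linear with kernel \<open>C\<close> and \<open>x - r x\<close> in \<open>C\<close>. A bilinear \<open>F\<close> that vanishes on \<open>C \<times> C\<close> satisfies
  \<open>F(a, b) = F(a, r b) + F(r a, b - r b)\<close>, and each kind of slices takes care of one summand.
\<close>

lemma subcoalgebraI:
  assumes "subspace C"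
    and "\<And>\<phi> x. functional \<phi> \<Longrightarrow> x \<in> C \<Longrightarrow> sw (\<lambda>a b. scale (\<phi> a) b) x \<in> C"
    and "\<And>\<phi> x. functional \<phi> \<Longrightarrow> x \<in> C \<Longrightarrow> sw (\<lambda>a b. scale (\<phi> b) a) x \<in> C"
  shows "subcoalgebra C"
  unfolding subcoalgebra_iff
proof (intro conjI ballI allI impI)
  fix x F assume x: "x \<in> C" and F: "bilin F" and zero: "\<forall>a\<in>C. \<forall>b\<in>C. F a b = 0"
  obtain r where r: "lin r" "\<forall>u\<in>C. r u = 0" "\<forall>x. x - r x \<in> C"
    by (rule exists_linear_with_kernel[OF assms(1)])
  have F': "F a b = F a (r b) + F (r a) (b - r b)" for a b
  proof -
    have "F a b = F a (r b) + F a (b - r b)"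
      by (simp add: lin_diff[OF bilinD2[OF F]])
    moreover have "F a (b - r b) = F (r a) (b - r b) + F (a - r a) (b - r b)"
      by (simp add: lin_diff[OF bilinD1[OF F]])
    moreover have "F (a - r a) (b - r b) = 0"
      using zero r(3) by blast
    ultimately show ?thesis by simp
  qed
  have "sw F x = sw (\<lambda>a b. F a (r b) + F (r a) (b - r b)) x"
    by (intro arg_cong[of _ _ "\<lambda>G. sw G x"] ext F')
  also have "\<dots> = sw (\<lambda>a b. F a (r b)) x + sw (\<lambda>a b. F (r a) (b - r b)) x"
    by (rule sw_add)
  also have "sw (\<lambda>a b. F a (r b)) x = 0"
    by (rule sw_eq_0_if_right_slices[OF _ assms(2)[OF _ x]])
      (auto intro!: bilinI lin_intros lin_compose[OF r(1)] bilin_compose1[OF F] bilin_compose2[OF F]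
        simp: r(2) lin_zero[OF bilinD2[OF F]])
  also have "sw (\<lambda>a b. F (r a) (b - r b)) x = 0"
    by (rule sw_eq_0_if_left_slices[OF _ assms(3)[OF _ x]])
      (auto intro!: bilinI lin_intros lin_compose[OF r(1)] bilin_compose1[OF F] bilin_compose2[OF F]
        simp: r(2) lin_zero[OF bilinD1[OF F]])
  finally show "sw F x = 0" by simp
qed (rule assms(1))

end

section \<open>The coradical filtration\<close>

context coalgebra
begin

lemma subcoalgebra_span_Union:
  assumes "\<And>C. C \<in> \<C> \<Longrightarrow> subcoalgebra C"
  shows "subcoalgebra (span (\<Union>\<C>))"
  unfolding subcoalgebra_iff
proof (intro conjI ballI allI impI)
  fix x F
  assume x: "x \<in> span (\<Union>\<C>)" and F: "bilin F" "\<forall>a\<in>span (\<Union>\<C>). \<forall>b\<in>span (\<Union>\<C>). F a b = 0"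
  from x show "sw F x = 0"
  proof (induction rule: span_induct_alt)
    case base
    then show ?case by (rule lin_zero[OF lin_sw[OF F(1)]])
  next
    case (step c x y)
    then obtain C where C: "C \<in> \<C>" "x \<in> C" by blast
    then have "C \<subseteq> span (\<Union>\<C>)"
      using span_superset by blast
    then have "sw F x = 0"
      using F C by (intro sw_subcoalgebra_zero[OF assms]) auto
    with step show ?case
      by (simp add: sw_add_arg[OF F(1)] sw_scale_arg[OF F(1)])
  qed
qed (rule subspace_span)

lemma subcoalgebra_coradical: "subcoalgebra coradical"
  unfolding coradical_def
  by (rule subcoalgebra_span_Union) (simp add: simple_subcoalgebra_def)

lemma subspace_filtration: "subspace (coradical_filtration n)"
  using subcoalgebra_coradical
  by (cases n) (auto simp: subcoalgebra_def coradical_filtration_Suc subspace_wedge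
      simp del: coradical_filtration.simps(2))

lemma subcoalgebra_subset_wedge: "subcoalgebra C \<Longrightarrow> C \<subseteq> wedge C C"
  by (intro subsetI wedgeI) (erule sw_subcoalgebra_zero; simp)

lemma filtration_subset_Suc: "coradical_filtration n \<subseteq> coradical_filtration (Suc n)"
proof (induction n)
  case 0
  then show ?case
    unfolding coradical_filtration_Suc
    using subcoalgebra_subset_wedge[OF subcoalgebra_coradical] by simp
next
  case (Suc n)
  then show ?case
    using coradical_filtration_Suc wedge_mono[OF subset_refl] by metis
qed

text \<open>
  The two actions of the dual algebra on the coalgebra. With the convolution product
  \<open>\<phi> * \<psi> = \<psi> \<circ> lslice \<phi>\<close> of functionals, \<open>lslice\<close> is a right and \<open>rslice\<close> a left action.
\<close>

definition lslice :: "('h \<Rightarrow> 'k) \<Rightarrow> 'h \<Rightarrow> 'h" where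
  "lslice \<phi> = sw (\<lambda>a b. scale (\<phi> a) b)"

definition rslice :: "('h \<Rightarrow> 'k) \<Rightarrow> 'h \<Rightarrow> 'h" where
  "rslice \<phi> = sw (\<lambda>a b. scale (\<phi> b) a)"

lemma lin_lslice: "functional \<phi> \<Longrightarrow> lin (lslice \<phi>)"
  unfolding lslice_def by (intro lin_sw bilinI lin_intros)

lemma lin_rslice: "functional \<phi> \<Longrightarrow> lin (rslice \<phi>)"
  unfolding rslice_def by (intro lin_sw bilinI lin_intros)

lemma functional_lslice: "functional \<phi> \<Longrightarrow> functional \<psi> \<Longrightarrow> functional (\<lambda>y. \<psi> (lslice \<phi> y))"
  by (rule functional_compose[OF _ lin_lslice])

lemma scale_functional_sw:
  "functional \<psi> \<Longrightarrow> scale (\<psi> (sw F x)) = (\<lambda>b. sw (\<lambda>u v. scale (\<psi> (F u v)) b) x)"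
  by (intro ext lin_apply_sw[of "\<lambda>z. scale (\<psi> z) b" for b] lin_scaled_fixed)

lemma lslice_lslice:
  assumes "functional \<phi>" "functional \<psi>"
  shows "lslice \<psi> (lslice \<phi> x) = lslice (\<lambda>y. \<psi> (lslice \<phi> y)) x"
proof -
  have "lslice (\<lambda>y. \<psi> (lslice \<phi> y)) x = sw (\<lambda>a b. sw (\<lambda>u v. scale (\<phi> u) (scale (\<psi> v) b)) a) x"
    unfolding lslice_def by (simp add: scale_functional_sw assms functional_scale)
  also have "\<dots> = sw (\<lambda>a c. sw (\<lambda>v b. scale (\<phi> a) (scale (\<psi> v) b)) c) x"
    by (rule sw_coassoc) (intro lin_intros assms)+
  also have "\<dots> = lslice \<psi> (lslice \<phi> x)"
    unfolding lslice_def[of \<phi>] lin_apply_sw[OF lin_lslice[OF assms(2)]] lin_scale[OF lin_lslice[OF assms(2)]]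
    by (simp add: lslice_def sw_scale[symmetric])
  finally show ?thesis ..
qed

lemma rslice_lslice:
  assumes "functional \<phi>" "functional \<psi>"
  shows "rslice \<psi> (lslice \<phi> x) = lslice \<phi> (rslice \<psi> x)"
proof -
  have "lslice \<phi> (rslice \<psi> x) = sw (\<lambda>a b. sw (\<lambda>u v. scale (\<phi> u) (scale (\<psi> b) v)) a) x"
    unfolding rslice_def lin_apply_sw[OF lin_lslice[OF assms(1)]] lin_scale[OF lin_lslice[OF assms(1)]]
    by (simp add: lslice_def sw_scale[symmetric] mult.commute)
  also have "\<dots> = sw (\<lambda>a c. sw (\<lambda>v b. scale (\<phi> a) (scale (\<psi> b) v)) c) x"
    by (rule sw_coassoc) (intro lin_intros assms)+
  also have "\<dots> = rslice \<psi> (lslice \<phi> x)"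
    unfolding lslice_def lin_apply_sw[OF lin_rslice[OF assms(2)]] lin_scale[OF lin_rslice[OF assms(2)]]
    by (simp add: rslice_def sw_scale[symmetric])
  finally show ?thesis ..
qed

lemma functional_rslice:
  assumes "functional \<phi>" "functional \<psi>"
  shows "\<phi> (rslice \<psi> x) = \<psi> (lslice \<phi> x)"
proof (cases "\<exists>v :: 'h. v \<noteq> 0")
  case True
  then obtain v :: 'h where "v \<noteq> 0" by blast
  moreover have "scale (\<phi> (rslice \<psi> x)) v = scale (\<psi> (lslice \<phi> x)) v"
    unfolding rslice_def lslice_def
    by (simp add: scale_functional_sw assms functional_scale mult.commute)
  ultimately show ?thesis by simp
next
  case False
  then have "rslice \<psi> x = 0" "lslice \<phi> x = 0" by auto
  then show ?thesis
    by (simp add: functional_zero assms)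
qed

lemma rslice_rslice:
  assumes "functional \<phi>" "functional \<psi>"
  shows "rslice \<phi> (rslice \<psi> x) = rslice (\<lambda>y. \<psi> (lslice \<phi> y)) x"
proof -
  have "rslice \<phi> (rslice \<psi> x) = sw (\<lambda>a b. sw (\<lambda>u v. scale (\<psi> b) (scale (\<phi> v) u)) a) x"
    unfolding rslice_def[of \<psi>] lin_apply_sw[OF lin_rslice[OF assms(1)]] lin_scale[OF lin_rslice[OF assms(1)]]
    by (simp add: rslice_def sw_scale[symmetric])
  also have "\<dots> = sw (\<lambda>a c. sw (\<lambda>v b. scale (\<psi> b) (scale (\<phi> v) a)) c) x"
    by (rule sw_coassoc) (intro lin_intros assms)+
  also have "\<dots> = rslice (\<lambda>y. \<psi> (lslice \<phi> y)) x"
    unfolding lslice_def rslice_def by (simp add: scale_functional_sw assms functional_scale mult.commute)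
  finally show ?thesis .
qed

lemma lslice_counit: "lslice \<epsilon> x = x"
  unfolding lslice_def by (rule sw_counit_left[OF lin_ident])

lemma rslice_counit: "rslice \<epsilon> x = x"
  unfolding rslice_def by (rule sw_counit_right[OF lin_ident])

lemma lslice_diff_functional: "lslice (\<lambda>y. \<phi> y - \<psi> y) x = lslice \<phi> x - lslice \<psi> x"
  by (simp add: lslice_def scale_left_diff_distrib sw_diff)

lemma lslice_add_functional: "lslice (\<lambda>y. \<phi> y + \<psi> y) x = lslice \<phi> x + lslice \<psi> x"
  by (simp add: lslice_def scale_left_distrib sw_add)

lemma lslice_scale_functional: "lslice (\<lambda>y. c * \<phi> y) x = scale c (lslice \<phi> x)"
  by (simp add: lslice_def sw_scale[symmetric])

lemma lslice_sum_functional: "lslice (\<lambda>y. \<Sum>i\<in>I. \<phi> i y) x = (\<Sum>i\<in>I. lslice (\<phi> i) x)"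
  by (simp add: lslice_def scale_sum_left sw_sum)

lemma functional_sum: "(\<And>i. i \<in> I \<Longrightarrow> functional (\<phi> i)) \<Longrightarrow> functional (\<lambda>y. \<Sum>i\<in>I. \<phi> i y)"
  by (simp add: functional_iff sum.distrib sum_distrib_left)

lemma functional_minus_minus: "functional f \<Longrightarrow> functional g \<Longrightarrow> functional (\<lambda>x. f x - g x)"
  and functional_plus: "functional f \<Longrightarrow> functional g \<Longrightarrow> functional (\<lambda>x. f x + g x)"
  and functional_const_zero: "functional (\<lambda>x. 0)"
  by (simp_all add: functional_iff algebra_simps)

definition left_coideal :: "'h set \<Rightarrow> bool" where
  "left_coideal M \<longleftrightarrow> subspace M \<and> (\<forall>\<phi> x. functional \<phi> \<longrightarrow> x \<in> M \<longrightarrow> lslice \<phi> x \<in> M)"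

text \<open>
  By coassociativity, \<open>\<Sum> \<phi>(x\<^sub>1) F(x\<^sub>2, x\<^sub>3)\<close> is the Sweedler sum over \<open>x\<close> of a bilinear map that vanishes on
  \<open>H \<times> V\<close> and, as \<open>C\<close> is a subcoalgebra, on \<open>C \<times> H\<close>.
\<close>

lemma left_coideal_wedge:
  assumes "subcoalgebra C"
  shows "left_coideal (wedge C V)"
  unfolding left_coideal_def
proof (intro conjI allI impI)
  fix \<phi> x assume \<phi>: "functional \<phi>" and x: "x \<in> wedge C V"
  show "lslice \<phi> x \<in> wedge C V"
  proof (rule wedgeI)
    fix F assume F: "bilin F" "\<And>u b. u \<in> C \<Longrightarrow> F u b = 0" "\<And>a v. v \<in> V \<Longrightarrow> F a v = 0"
    note F_lin = bilin_compose1[OF F(1)] bilin_compose2[OF F(1)]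
    have "sw F (lslice \<phi> x) = sw (\<lambda>a c. sw (\<lambda>u v. scale (\<phi> a) (F u v)) c) x"
      unfolding lslice_def by (simp add: lin_apply_sw[OF lin_sw[OF F(1)]] sw_scale sw_scale_arg[OF F(1)])
    also have "\<dots> = sw (\<lambda>a c. sw (\<lambda>u v. scale (\<phi> u) (F v c)) a) x"
      by (rule sw_coassoc[symmetric]) (intro lin_intros \<phi> F_lin)+
    also have "\<dots> = 0"
    proof (rule wedgeD[OF x])
      show "bilin (\<lambda>a c. sw (\<lambda>u v. scale (\<phi> u) (F v c)) a)"
        by (intro bilinI lin_intros \<phi> F_lin)
      show "sw (\<lambda>u v. scale (\<phi> u) (F v c)) a = 0" if "a \<in> C" for a c
        by (rule sw_subcoalgebra_zero[OF assms that]) (intro bilinI lin_intros \<phi> F_lin, simp add: F(2))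
      show "sw (\<lambda>u v. scale (\<phi> u) (F v c)) a = 0" if "c \<in> V" for a c
        by (simp add: F(3) that)
    qed
    finally show "sw F (lslice \<phi> x) = 0" .
  qed
qed (rule subspace_wedge)

lemma left_coideal_subcoalgebra:
  assumes "subcoalgebra C"
  shows "left_coideal C"
proof -
  have "lslice \<phi> x \<in> C" if \<phi>: "functional \<phi>" and x: "x \<in> C" for \<phi> x
  proof (rule ccontr)
    assume "lslice \<phi> x \<notin> C"
    then obtain \<psi> where \<psi>: "functional \<psi>" "\<forall>u\<in>C. \<psi> u = 0" "\<psi> (lslice \<phi> x) = 1"
      using exists_functional_separating assms unfolding subcoalgebra_def by metis
    have "scale (\<psi> (lslice \<phi> x)) v = 0" for v
      unfolding lslice_def scale_functional_sw[OF \<psi>(1)] functional_scale[OF \<psi>(1)]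
      by (rule sw_subcoalgebra_zero[OF assms x])
        (simp_all add: \<psi>(2) bilin_def lin_iff functional_iff[THEN iffD1, OF \<phi>] functional_iff[THEN iffD1, OF \<psi>(1)] algebra_simps
          scale_left_distrib)
    then have "lslice \<phi> x = 0"
      using \<psi>(3) by (metis scale_one)
    with \<psi>(3) show False
      by (simp add: functional_zero[OF \<psi>(1)])
  qed
  with assms show ?thesis
    by (simp add: left_coideal_def subcoalgebra_def)
qed

end

context finite_dim_coalgebra
begin

text \<open>
  Slicing off the last factor reduces the claim to \<open>\<Sum> \<phi>(x\<^sub>2) x\<^sub>1 \<in> C \<and> D\<close> for \<open>\<phi>\<close> annihilating \<open>E\<close>. For \<open>G\<close>
  vanishing on \<open>C \<times> H\<close> and \<open>H \<times> D\<close>, the map \<open>(a, b) \<mapsto> \<Sum> \<phi>(b\<^sub>2) G(a, b\<^sub>1)\<close> vanishes on \<open>C \<times> H\<close> and on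
  \<open>H \<times> (D \<and> E)\<close>.
\<close>

lemma wedge_assoc:
  assumes "subspace E"
  shows "wedge C (wedge D E) \<subseteq> wedge (wedge C D) E"
proof (intro subsetI wedgeI)
  fix x F
  assume x: "x \<in> wedge C (wedge D E)"
    and F: "bilin F" "\<And>u b. u \<in> wedge C D \<Longrightarrow> F u b = 0" "\<And>a v. v \<in> E \<Longrightarrow> F a v = 0"
  show "sw F x = 0"
  proof (rule sw_eq_0_if_left_slices_annihilator[OF F(1) assms F(3) _ F(2)])
    fix \<phi> assume \<phi>: "functional \<phi>" "\<And>v. v \<in> E \<Longrightarrow> \<phi> v = 0"
    have "rslice \<phi> x \<in> wedge C D"
    proof (rule wedgeI)
      fix G assume G: "bilin G" "\<And>u b. u \<in> C \<Longrightarrow> G u b = 0" "\<And>a v. v \<in> D \<Longrightarrow> G a v = 0"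
      note G_lin = bilin_compose1[OF G(1)] bilin_compose2[OF G(1)]
      have "sw G (rslice \<phi> x) = sw (\<lambda>a b. sw (\<lambda>u v. scale (\<phi> b) (G u v)) a) x"
        unfolding rslice_def by (simp add: lin_apply_sw[OF lin_sw[OF G(1)]] sw_scale sw_scale_arg[OF G(1)])
      also have "\<dots> = sw (\<lambda>a b. sw (\<lambda>u v. scale (\<phi> v) (G a u)) b) x"
        by (rule sw_coassoc) (intro lin_intros \<phi> G_lin)+
      also have "\<dots> = 0"
      proof (rule wedgeD[OF x])
        show bil: "bilin (\<lambda>a b. sw (\<lambda>u v. scale (\<phi> v) (G a u)) b)"
          by (intro bilinI lin_intros \<phi> G_lin)
        show "sw (\<lambda>u v. scale (\<phi> v) (G a u)) b = 0" if "a \<in> C" for a b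
          by (simp add: G(2) that)
        show "sw (\<lambda>u v. scale (\<phi> v) (G a u)) b = 0" if "b \<in> wedge D E" for a b
          by (rule wedgeD[OF that]) (intro bilinI lin_intros \<phi>(1) G_lin, simp_all add: G(3) \<phi>(2))
      qed
      finally show "sw G (rslice \<phi> x) = 0" .
    qed
    then show "sw (\<lambda>a b. scale (\<phi> b) a) x \<in> wedge C D"
      by (simp add: rslice_def)
  qed
qed

lemma filtration_Suc_Suc:
  "coradical_filtration (Suc (Suc n)) \<subseteq> wedge (coradical_filtration 1) (coradical_filtration n)"
  unfolding coradical_filtration_Suc One_nat_def coradical_filtration.simps(1)
  by (rule wedge_assoc[OF subspace_filtration])

text \<open>
  In \<open>\<Delta>(V x - x) = \<Sum> (V x\<^sub>1 - x\<^sub>1) \<otimes> V x\<^sub>2 + x\<^sub>1 \<otimes> (V x\<^sub>2 - x\<^sub>2)\<close> with \<open>x\<close> in \<open>H\<^sub>m\<^sub>+\<^sub>2\<close>, the first sum is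
  controlled by \<open>x \<in> H\<^sub>1 \<and> H\<^sub>m\<close> and \<open>V = id\<close> on \<open>H\<^sub>1\<close>, the second one by \<open>x \<in> A \<and> H\<^sub>m\<^sub>+\<^sub>1\<close> and induction.
\<close>

lemma coalgebra_map_minus_id_lowers_filtration:
  assumes V: "lin V" "\<And>F x. bilin F \<Longrightarrow> sw F (V x) = sw (\<lambda>a b. F (V a) (V b)) x"
    and id: "\<And>x. x \<in> coradical_filtration 1 \<Longrightarrow> V x = x"
    and x: "x \<in> coradical_filtration n"
  shows "V x - x \<in> coradical_filtration (n - 1)"
  using x
proof (induction n arbitrary: x rule: less_induct)
  case (less n)
  show ?case
  proof (cases "n \<le> 1")
    case True
    then consider "n = 0" | "n = 1" by linarith
    then have "x \<in> coradical_filtration 1"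
      using less.prems filtration_subset_Suc[of 0] unfolding One_nat_def by cases blast+
    then show ?thesis
      using id subspace_0[OF subspace_filtration] by simp
  next
    case False
    then obtain m where n: "n = Suc (Suc m)"
      by (metis One_nat_def Suc_le_eq le0 not0_implies_Suc not_less_eq_eq)
    have x1: "x \<in> wedge coradical (coradical_filtration (Suc m))"
      using less.prems n coradical_filtration_Suc by metis
    have x2: "x \<in> wedge (coradical_filtration 1) (coradical_filtration m)"
      using less.prems n filtration_Suc_Suc by blast
    have "V x - x \<in> wedge coradical (coradical_filtration m)"
    proof (rule wedgeI)
      fix F assume F: "bilin F" "\<And>u b. u \<in> coradical \<Longrightarrow> F u b = 0"
        "\<And>a v. v \<in> coradical_filtration m \<Longrightarrow> F a v = 0"
      note lin = lin_intros bilin_compose1[OF F(1)] bilin_compose2[OF F(1)] lin_compose[OF V(1)]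
      have "sw F (V x - x) = sw (\<lambda>a b. F (V a) (V b) - F a b) x"
        by (simp add: lin_diff[OF lin_sw[OF F(1)]] V(2)[OF F(1)] sw_diff)
      also have "\<dots> = sw (\<lambda>a b. F (V a - a) (V b) + F a (V b - b)) x"
        by (simp add: lin_diff[OF bilinD1[OF F(1)]] lin_diff[OF bilinD2[OF F(1)]])
      also have "\<dots> = sw (\<lambda>a b. F (V a - a) (V b)) x + sw (\<lambda>a b. F a (V b - b)) x"
        by (rule sw_add)
      also have "sw (\<lambda>a b. F (V a - a) (V b)) x = 0"
      proof (rule wedgeD[OF x2])
        show "bilin (\<lambda>a b. F (V a - a) (V b))"
          by (intro bilinI lin)
        show "F (V a - a) (V b) = 0" if "a \<in> coradical_filtration 1" for a b
          by (simp add: id[OF that] lin_zero[OF bilinD1[OF F(1)]])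
        show "F (V a - a) (V b) = 0" if b: "b \<in> coradical_filtration m" for a b
        proof -
          have "V b - b \<in> coradical_filtration (m - 1)"
            using less.IH[OF _ b] n by simp
          then have "V b - b \<in> coradical_filtration m"
            using filtration_subset_Suc[of "m - 1"] by (cases m) auto
          then have "V b \<in> coradical_filtration m"
            using subspace_add[OF subspace_filtration _ b] by fastforce
          then show ?thesis by (rule F(3))
        qed
      qed
      also have "sw (\<lambda>a b. F a (V b - b)) x = 0"
      proof (rule wedgeD[OF x1])
        show "bilin (\<lambda>a b. F a (V b - b))"
          by (intro bilinI lin)
        show "F a (V b - b) = 0" if "a \<in> coradical" for a b
          by (simp add: F(2) that)
        show "F a (V b - b) = 0" if b: "b \<in> coradical_filtration (Suc m)" for a b
          using less.IH[OF _ b] n by (intro F(3)) simp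
      qed
      finally show "sw F (V x - x) = 0" by simp
    qed
    then show ?thesis
      using n coradical_filtration_Suc by (metis diff_Suc_1)
  qed
qed

lemma coalgebra_map_minus_id_nilpotent:
  assumes V: "lin V" "\<And>F x. bilin F \<Longrightarrow> sw F (V x) = sw (\<lambda>a b. F (V a) (V b)) x"
    and id: "\<And>x. x \<in> coradical_filtration 1 \<Longrightarrow> V x = x"
    and x: "x \<in> coradical_filtration (Suc n)"
  shows "((\<lambda>x. V x - x) ^^ Suc n) x = 0"
proof -
  have "((\<lambda>x. V x - x) ^^ k) x \<in> coradical_filtration (Suc n - k)" for k
  proof (induction k)
    case (Suc k)
    from coalgebra_map_minus_id_lowers_filtration[OF V id this]
    show ?case by (simp del: coradical_filtration.simps)
  qed (use x in simp)
  from this[of n] have "((\<lambda>x. V x - x) ^^ n) x \<in> coradical_filtration 1"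
    by simp
  from id[OF this] show ?thesis by simp
qed

end

section \<open>The coradical filtration exhausts a finite-dimensional coalgebra\<close>

context coalgebra
begin

lemma lslice_zero_functional: "lslice (\<lambda>y. 0) x = 0"
  using lslice_scale_functional[of 0 "\<lambda>y. 0" x] by simp

lemma left_coideal_subspace: "left_coideal M \<Longrightarrow> subspace M"
  by (simp add: left_coideal_def)

lemma left_coideal_slice: "left_coideal M \<Longrightarrow> functional \<phi> \<Longrightarrow> x \<in> M \<Longrightarrow> lslice \<phi> x \<in> M"
  by (simp add: left_coideal_def)

lemma left_coideal_span:
  assumes "\<And>\<phi> x. functional \<phi> \<Longrightarrow> x \<in> Y \<Longrightarrow> lslice \<phi> x \<in> span Y"
  shows "left_coideal (span Y)"
  unfolding left_coideal_def
proof (intro conjI allI impI)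
  fix \<phi> x assume \<phi>: "functional \<phi>" and "x \<in> span Y"
  from this(2) show "lslice \<phi> x \<in> span Y"
    by (induction rule: span_induct_alt)
      (auto simp: lin_zero[OF lin_lslice[OF \<phi>]] lin_add[OF lin_lslice[OF \<phi>]] lin_scale[OF lin_lslice[OF \<phi>]]
        span_zero intro!: span_add span_scale assms \<phi>)
qed (rule subspace_span)

definition annihilates :: "('h \<Rightarrow> 'k) \<Rightarrow> 'h set \<Rightarrow> bool" where
  "annihilates \<phi> M \<longleftrightarrow> functional \<phi> \<and> (\<forall>m\<in>M. \<phi> m = 0)"

lemma annihilates_product_right:
  assumes "left_coideal M" "functional \<phi>" "annihilates \<psi> M"
  shows "annihilates (\<lambda>y. \<psi> (lslice \<phi> y)) M"
  using assms by (auto simp: annihilates_def functional_lslice left_coideal_slice)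

lemma mem_if_annihilators_vanish:
  assumes "subspace D" "\<And>\<phi>. annihilates \<phi> D \<Longrightarrow> \<phi> x = 0"
  shows "x \<in> D"
  using exists_functional_separating[OF assms(1), of x] assms(2) unfolding annihilates_def
  by (metis zero_neq_one)

end

context finite_dim_coalgebra
begin

lemma finite_dim_basis: obtains E where "finite_dimensional_vector_space scale E"
proof -
  obtain B where B: "finite B" "span B = UNIV"
    using finite_dim by blast
  obtain E where E: "E \<subseteq> UNIV" "independent E" "UNIV \<subseteq> span E"
    by (rule maximal_independent_subset)
  have "finite E"
    using independent_span_bound[OF B(1) E(2)] B(2) by simp
  with E have "finite_dimensional_vector_space scale E"
    by unfold_locales auto
  then show thesis by (rule that)
qed

text \<open>
  For left coideals \<open>M \<subseteq> X\<close> this is the coefficient coalgebra of the comodule \<open>X / M\<close>.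
\<close>

definition coefficient_space :: "'h set \<Rightarrow> 'h set \<Rightarrow> 'h set" where
  "coefficient_space M X = span {rslice \<psi> x |x \<psi>. x \<in> X \<and> annihilates \<psi> M}"

lemma subcoalgebra_coefficient_space:
  assumes M: "left_coideal M" and X: "left_coideal X"
  shows "subcoalgebra (coefficient_space M X)"
proof (rule subcoalgebraI)
  let ?Y = "{rslice \<psi> x |x \<psi>. x \<in> X \<and> annihilates \<psi> M}"
  show "subspace (coefficient_space M X)"
    by (simp add: coefficient_space_def)
  fix \<phi> c assume \<phi>: "functional \<phi>" and "c \<in> coefficient_space M X"
  then have c: "c \<in> span ?Y" by (simp add: coefficient_space_def)
  have l: "lslice \<phi> y \<in> span ?Y" and r: "rslice \<phi> y \<in> span ?Y" if "y \<in> ?Y" for y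
  proof -
    from that obtain x \<psi> where y: "y = rslice \<psi> x" "x \<in> X" "annihilates \<psi> M" by blast
    then have \<psi>: "functional \<psi>" by (simp add: annihilates_def)
    have "lslice \<phi> y = rslice \<psi> (lslice \<phi> x)"
      by (simp add: y(1) rslice_lslice \<phi> \<psi>)
    then show "lslice \<phi> y \<in> span ?Y"
      using left_coideal_slice[OF X \<phi> y(2)] y(3) by (intro span_base) blast
    have "rslice \<phi> y = rslice (\<lambda>z. \<psi> (lslice \<phi> z)) x"
      by (simp add: y(1) rslice_rslice \<phi> \<psi>)
    then show "rslice \<phi> y \<in> span ?Y"
      using annihilates_product_right[OF M \<phi> y(3)] y(2) by (intro span_base) blast
  qed
  from c have "lslice \<phi> c \<in> span ?Y"
    by (induction rule: span_induct_alt)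
      (simp_all add: lin_zero[OF lin_lslice[OF \<phi>]] lin_add[OF lin_lslice[OF \<phi>]]
        lin_scale[OF lin_lslice[OF \<phi>]] span_zero span_add span_scale l)
  then show "sw (\<lambda>a b. scale (\<phi> a) b) c \<in> coefficient_space M X"
    by (simp add: lslice_def coefficient_space_def)
  from c have "rslice \<phi> c \<in> span ?Y"
    by (induction rule: span_induct_alt)
      (simp_all add: lin_zero[OF lin_rslice[OF \<phi>]] lin_add[OF lin_rslice[OF \<phi>]]
        lin_scale[OF lin_rslice[OF \<phi>]] span_zero span_add span_scale r)
  then show "sw (\<lambda>a b. scale (\<phi> b) a) c \<in> coefficient_space M X"
    by (simp add: rslice_def coefficient_space_def)
qed

definition minimal_over :: "'h set \<Rightarrow> 'h set \<Rightarrow> bool" where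
  "minimal_over M X \<longleftrightarrow> left_coideal X \<and> M \<subset> X \<and>
     (\<forall>Y. left_coideal Y \<longrightarrow> M \<subseteq> Y \<longrightarrow> Y \<subseteq> X \<longrightarrow> Y = M \<or> Y = X)"

lemma exists_minimal_over:
  assumes "left_coideal M" "M \<noteq> UNIV"
  obtains X where "minimal_over M X"
proof -
  obtain E where "finite_dimensional_vector_space scale E"
    by (rule finite_dim_basis)
  then interpret fd: finite_dimensional_vector_space scale E .
  let ?P = "\<lambda>X. left_coideal X \<and> M \<subset> X"
  have "?P UNIV"
    using assms by (auto simp: left_coideal_def subspace_UNIV)
  then obtain X where X: "?P X" "\<And>Y. ?P Y \<Longrightarrow> dim X \<le> dim Y"
    using ex_has_least_nat[of ?P UNIV dim] by metis
  have "Y = M \<or> Y = X" if Y: "left_coideal Y" "M \<subseteq> Y" "Y \<subseteq> X" for Y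
  proof (rule disjCI)
    assume "Y \<noteq> X"
    then have "\<not> dim X \<le> dim Y"
      using fd.subspace_dim_equal[of Y X] Y X(1) by (auto simp: left_coideal_def)
    then have "\<not> ?P Y"
      using X(2) by blast
    with Y show "Y = M" by blast
  qed
  with X(1) have "minimal_over M X"
    by (simp add: minimal_over_def)
  then show thesis by (rule that)
qed

text \<open>
  This is dual to the fact that a finite-dimensional algebra is simple if it acts faithfully on a
  simple module. The dual algebra \<open>R\<close> acts on the simple right module \<open>X / M\<close> by \<open>lslice\<close>. A
  subcoalgebra \<open>D\<close> of the coefficient space corresponds to the two-sided ideal \<open>I\<close> of functionals that
  annihilate \<open>D\<close>, and \<open>(X / M) I\<close> is either \<open>0\<close> or \<open>X / M\<close>. In the first case \<open>D\<close> contains all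
  coefficients. In the second case \<open>D = 0\<close> follows by showing that \<open>1 \<in> I + Ann (X / M)\<close>: take a minimal
  finite subset \<open>F\<close> of \<open>X\<close> whose annihilator is \<open>Ann (X / M)\<close>, and for each \<open>i\<close> in \<open>F\<close> find an \<open>s\<^sub>i\<close> in
  \<open>I\<close> that fixes \<open>i\<close> and annihilates \<open>F - {i}\<close> modulo \<open>M\<close>; then \<open>\<epsilon> - \<Sum> s\<^sub>i\<close> annihilates \<open>F\<close>.
\<close>

lemma simple_coefficient_space:
  assumes M: "left_coideal M" and X: "minimal_over M X"
  shows "simple_subcoalgebra (coefficient_space M X)"
  unfolding simple_subcoalgebra_def
proof (intro conjI allI impI)
  let ?C = "coefficient_space M X"
  have Xc: "left_coideal X" and MX: "M \<subset> X"
    and min: "\<And>Y. left_coideal Y \<Longrightarrow> M \<subseteq> Y \<Longrightarrow> Y \<subseteq> X \<Longrightarrow> Y = M \<or> Y = X"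
    using X by (auto simp: minimal_over_def)
  have Ms: "subspace M" and Xs: "subspace X"
    using M Xc by (auto simp: left_coideal_def)
  have C_base: "rslice \<psi> x \<in> ?C" if "x \<in> X" "annihilates \<psi> M" for x \<psi>
    unfolding coefficient_space_def using that by (intro span_base) blast
  show "subcoalgebra ?C"
    by (rule subcoalgebra_coefficient_space[OF M Xc])
  show "?C \<noteq> {0}"
  proof
    assume C0: "?C = {0}"
    from MX obtain x where x: "x \<in> X" "x \<notin> M" by blast
    have "x \<in> M"
    proof (rule mem_if_annihilators_vanish[OF Ms])
      fix \<psi> assume \<psi>: "annihilates \<psi> M"
      then have f: "functional \<psi>" by (simp add: annihilates_def)
      have "\<psi> x = \<psi> (lslice \<epsilon> x)"
        by (simp add: lslice_counit)
      also have "\<dots> = \<epsilon> (rslice \<psi> x)"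
        by (rule functional_rslice[symmetric, OF counit_functional f])
      also have "rslice \<psi> x = 0"
        using C_base[OF x(1) \<psi>] C0 by blast
      finally show "\<psi> x = 0"
        by (simp add: functional_zero[OF counit_functional])
    qed
    with x(2) show False ..
  qed
  fix D assume D: "subcoalgebra D \<and> D \<subseteq> ?C"
  then have Ds: "subspace D" and Dc: "left_coideal D"
    by (auto simp: subcoalgebra_def left_coideal_subcoalgebra)
  \<comment> \<open>\<open>Y / M\<close> is the submodule \<open>(X / M) I\<close>.\<close>
  define Y where "Y = span ({lslice \<phi> x |x \<phi>. x \<in> X \<and> annihilates \<phi> D} \<union> M)"
  have YI: "lslice \<phi> x \<in> Y" if "x \<in> X" "annihilates \<phi> D" for x \<phi>
    unfolding Y_def using that by (intro span_base) blast
  have MY: "M \<subseteq> Y"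
    unfolding Y_def using span_superset by blast
  have "left_coideal Y"
    unfolding Y_def
  proof (rule left_coideal_span)
    fix \<theta> y assume \<theta>: "functional \<theta>" and y: "y \<in> {lslice \<phi> x |x \<phi>. x \<in> X \<and> annihilates \<phi> D} \<union> M"
    show "lslice \<theta> y \<in> span ({lslice \<phi> x |x \<phi>. x \<in> X \<and> annihilates \<phi> D} \<union> M)"
      unfolding Y_def[symmetric]
    proof (cases "y \<in> M")
      case True
      then show "lslice \<theta> y \<in> Y"
        using left_coideal_slice[OF M \<theta>] MY by blast
    next
      case False
      then obtain x \<phi> where x: "y = lslice \<phi> x" "x \<in> X" "annihilates \<phi> D"
        using y by blast
      have \<phi>: "functional \<phi>" using x(3) by (simp add: annihilates_def)
      have "annihilates (\<lambda>z. \<theta> (lslice \<phi> z)) D"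
        unfolding annihilates_def
      proof (intro conjI ballI functional_lslice \<phi> \<theta>)
        fix d assume d: "d \<in> D"
        have "scale (\<theta> (lslice \<phi> d)) v = 0" for v
          unfolding lslice_def scale_functional_sw[OF \<theta>] functional_scale[OF \<theta>]
        proof (rule sw_subcoalgebra_zero[of D d])
          show "bilin (\<lambda>a b. scale (\<phi> a * \<theta> b) v)"
            by (intro bilinI lin_scaled_fixed functional_times_left functional_times_right \<phi> \<theta>)
          show "scale (\<phi> a * \<theta> b) v = 0" if "a \<in> D" for a b
            using x(3) that by (simp add: annihilates_def)
        qed (use D d in auto)
        from this[of d] show "\<theta> (lslice \<phi> d) = 0"
          by (cases "d = 0") (simp_all add: lin_zero[OF lin_lslice[OF \<phi>]] functional_zero[OF \<theta>])
      qed
      then show "lslice \<theta> y \<in> Y"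
        using x(1,2) \<phi> \<theta> by (simp add: lslice_lslice YI)
    qed
  qed
  moreover have "Y \<subseteq> X"
    unfolding Y_def
    by (rule span_minimal[OF _ Xs])
      (use MX left_coideal_slice[OF Xc] in \<open>auto simp: annihilates_def\<close>)
  ultimately consider "Y = M" | "Y = X"
    using min MY by blast
  then show "D = {0} \<or> D = ?C"
  proof cases
    case 1
    have "rslice \<psi> x \<in> D" if x: "x \<in> X" and \<psi>: "annihilates \<psi> M" for x \<psi>
    proof (rule mem_if_annihilators_vanish[OF Ds])
      fix \<phi> assume \<phi>: "annihilates \<phi> D"
      have "\<phi> (rslice \<psi> x) = \<psi> (lslice \<phi> x)"
        using \<phi> \<psi> by (intro functional_rslice) (auto simp: annihilates_def)
      also have "\<dots> = 0"
        using YI[OF x \<phi>] \<psi> 1 by (simp add: annihilates_def)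
      finally show "\<phi> (rslice \<psi> x) = 0" .
    qed
    then have "?C \<subseteq> D"
      unfolding coefficient_space_def by (intro span_minimal[OF _ Ds]) blast
    with D show ?thesis by blast
  next
    case 2
    define kills where "kills \<phi> F \<longleftrightarrow> functional \<phi> \<and> (\<forall>x\<in>F. lslice \<phi> x \<in> M)" for \<phi> F
    let ?P = "\<lambda>F. finite F \<and> F \<subseteq> X \<and> (\<forall>\<phi>. kills \<phi> F \<longrightarrow> kills \<phi> X)"
    have "\<exists>F. ?P F"
    proof -
      obtain B where B: "B \<subseteq> X" "independent B" "X \<subseteq> span B"
        by (rule maximal_independent_subset)
      obtain B0 where B0: "finite B0" "span B0 = UNIV"
        using finite_dim by blast
      have "finite B"
        using independent_span_bound[OF B0(1) B(2)] B0(2) by simp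
      moreover have "kills \<phi> X" if "kills \<phi> B" for \<phi>
        unfolding kills_def
      proof (intro conjI ballI)
        show \<phi>: "functional \<phi>" using that by (simp add: kills_def)
        fix x assume "x \<in> X"
        then have "x \<in> span B" using B(3) by blast
        then show "lslice \<phi> x \<in> M"
          by (induction rule: span_induct_alt)
            (use that in \<open>simp_all add: kills_def lin_zero[OF lin_lslice[OF \<phi>]] lin_add[OF lin_lslice[OF \<phi>]]
              lin_scale[OF lin_lslice[OF \<phi>]] subspace_0[OF Ms] subspace_add[OF Ms] subspace_scale[OF Ms]\<close>)
      qed
      ultimately show ?thesis
        using B(1) by blast
    qed
    then obtain F where F: "?P F" "\<And>G. ?P G \<Longrightarrow> card F \<le> card G"
      using ex_has_least_nat[of ?P _ card] by metis
    have finF: "finite F" and FX: "F \<subseteq> X" using F(1) by auto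
    have "\<exists>s. annihilates s D \<and> (\<forall>x\<in>F - {i}. lslice s x \<in> M) \<and> i - lslice s i \<in> M" if i: "i \<in> F" for i
    proof -
      \<comment> \<open>By minimality of \<open>F\<close> some functional annihilates \<open>F - {i}\<close> but not \<open>i\<close>.\<close>
      have "card (F - {i}) < card F"
        by (rule card_Diff1_less[OF finF i])
      then have "\<not> ?P (F - {i})"
        by (meson F(2) not_less)
      then obtain \<phi>0 where \<phi>0: "kills \<phi>0 (F - {i})" "\<not> kills \<phi>0 X"
        using finF FX by auto
      then have \<phi>0i: "lslice \<phi>0 i \<notin> M"
        using F(1) by (auto simp: kills_def)
      \<comment> \<open>The functionals annihilating \<open>F - {i}\<close> form a right ideal, so they move \<open>i\<close> to all of \<open>X\<close>.\<close>
      define Z where "Z = {z. \<exists>\<phi>. kills \<phi> (F - {i}) \<and> z - lslice \<phi> i \<in> M}"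
      have zero_kills: "kills (\<lambda>y. 0) G" for G
        by (simp add: kills_def functional_const_zero lslice_zero_functional subspace_0[OF Ms])
      have MZ: "m \<in> Z" if "m \<in> M" for m
        unfolding Z_def using zero_kills that by (auto intro!: exI[of _ "\<lambda>y. 0"] simp: lslice_zero_functional)
      have "left_coideal Z"
        unfolding left_coideal_def subspace_def
      proof (intro conjI ballI allI impI)
        show "0 \<in> Z"
          by (rule MZ[OF subspace_0[OF Ms]])
      next
        fix x y assume "x \<in> Z" "y \<in> Z"
        then obtain \<phi> \<psi> where "kills \<phi> (F - {i})" "x - lslice \<phi> i \<in> M"
          "kills \<psi> (F - {i})" "y - lslice \<psi> i \<in> M"
          by (auto simp: Z_def)
        then have "kills (\<lambda>z. \<phi> z + \<psi> z) (F - {i})" "(x - lslice \<phi> i) + (y - lslice \<psi> i) \<in> M"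
          by (auto simp: kills_def functional_plus lslice_add_functional subspace_add[OF Ms])
        then show "x + y \<in> Z"
          unfolding Z_def mem_Collect_eq
          by (intro exI[of _ "\<lambda>z. \<phi> z + \<psi> z"]) (simp add: lslice_add_functional algebra_simps)
      next
        fix c x assume "x \<in> Z"
        then obtain \<phi> where "kills \<phi> (F - {i})" "x - lslice \<phi> i \<in> M"
          by (auto simp: Z_def)
        then have "kills (\<lambda>z. c * \<phi> z) (F - {i})" "scale c (x - lslice \<phi> i) \<in> M"
          by (auto simp: kills_def functional_times_right lslice_scale_functional subspace_scale[OF Ms])
        then show "scale c x \<in> Z"
          unfolding Z_def mem_Collect_eq
          by (intro exI[of _ "\<lambda>z. c * \<phi> z"]) (simp add: lslice_scale_functional scale_right_diff_distrib)
      next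
        fix \<psi> x assume \<psi>: "functional \<psi>" and "x \<in> Z"
        then obtain \<phi> where \<phi>: "kills \<phi> (F - {i})" "x - lslice \<phi> i \<in> M"
          by (auto simp: Z_def)
        then have f: "functional \<phi>" by (simp add: kills_def)
        have "kills (\<lambda>y. \<psi> (lslice \<phi> y)) (F - {i})"
          using \<phi>(1) \<psi> f left_coideal_slice[OF M \<psi>]
          by (auto simp: kills_def functional_lslice lslice_lslice[symmetric])
        moreover have "lslice \<psi> x - lslice (\<lambda>y. \<psi> (lslice \<phi> y)) i \<in> M"
          using left_coideal_slice[OF M \<psi> \<phi>(2)] f \<psi>
          by (simp add: lin_diff[OF lin_lslice[OF \<psi>]] lslice_lslice)
        ultimately show "lslice \<psi> x \<in> Z"
          unfolding Z_def by blast
      qed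
      moreover have "Z \<subseteq> X"
      proof
        fix z assume "z \<in> Z"
        then obtain \<phi> where \<phi>: "functional \<phi>" "z - lslice \<phi> i \<in> X"
          using MX by (auto simp: Z_def kills_def)
        moreover have "lslice \<phi> i \<in> X"
          using left_coideal_slice[OF Xc \<phi>(1)] i FX by blast
        ultimately show "z \<in> X"
          using subspace_add[OF Xs] by fastforce
      qed
      moreover have "lslice \<phi>0 i \<in> Z"
        unfolding Z_def using \<phi>0(1) subspace_0[OF Ms] by auto
      ultimately have ZX: "Z = X"
        using min[of Z] MZ \<phi>0i by blast
      \<comment> \<open>Multiplying them by \<open>I\<close> from the right, functionals in \<open>I\<close> suffice, since \<open>(X / M) I = X / M\<close>.\<close>
      define G where "G = {z. \<exists>s. annihilates s D \<and> kills s (F - {i}) \<and> z - lslice s i \<in> M}"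
      have MG: "m \<in> G" if "m \<in> M" for m
        unfolding G_def using zero_kills that
        by (auto intro!: exI[of _ "\<lambda>y. 0"] simp: lslice_zero_functional annihilates_def functional_const_zero)
      have "subspace G"
        unfolding subspace_def
      proof (intro conjI ballI allI)
        show "0 \<in> G"
          by (rule MG[OF subspace_0[OF Ms]])
      next
        fix x y assume "x \<in> G" "y \<in> G"
        then obtain \<phi> \<psi> where *: "annihilates \<phi> D" "kills \<phi> (F - {i})" "x - lslice \<phi> i \<in> M"
          "annihilates \<psi> D" "kills \<psi> (F - {i})" "y - lslice \<psi> i \<in> M"
          by (auto simp: G_def)
        then have "annihilates (\<lambda>z. \<phi> z + \<psi> z) D" "kills (\<lambda>z. \<phi> z + \<psi> z) (F - {i})"
          by (auto simp: kills_def annihilates_def functional_plus lslice_add_functional subspace_add[OF Ms])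
        moreover have "(x - lslice \<phi> i) + (y - lslice \<psi> i) \<in> M"
          using * by (intro subspace_add[OF Ms])
        ultimately show "x + y \<in> G"
          unfolding G_def mem_Collect_eq
          by (intro exI[of _ "\<lambda>z. \<phi> z + \<psi> z"]) (simp add: lslice_add_functional algebra_simps)
      next
        fix c x assume "x \<in> G"
        then obtain \<phi> where *: "annihilates \<phi> D" "kills \<phi> (F - {i})" "x - lslice \<phi> i \<in> M"
          by (auto simp: G_def)
        then have "annihilates (\<lambda>z. c * \<phi> z) D" "kills (\<lambda>z. c * \<phi> z) (F - {i})"
          by (auto simp: kills_def annihilates_def functional_times_right lslice_scale_functional subspace_scale[OF Ms])
        moreover have "scale c (x - lslice \<phi> i) \<in> M"
          using * by (intro subspace_scale[OF Ms])
        ultimately show "scale c x \<in> G"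
          unfolding G_def mem_Collect_eq
          by (intro exI[of _ "\<lambda>z. c * \<phi> z"]) (simp add: lslice_scale_functional scale_right_diff_distrib)
      qed
      moreover have "lslice \<theta> x \<in> G" if x: "x \<in> X" and \<theta>: "annihilates \<theta> D" for x \<theta>
      proof -
        have \<theta>f: "functional \<theta>" using \<theta> by (simp add: annihilates_def)
        from x ZX obtain \<phi> where \<phi>: "kills \<phi> (F - {i})" "x - lslice \<phi> i \<in> M"
          by (auto simp: Z_def)
        then have f: "functional \<phi>" by (simp add: kills_def)
        have "annihilates (\<lambda>y. \<theta> (lslice \<phi> y)) D"
          by (rule annihilates_product_right[OF Dc f \<theta>])
        moreover have "kills (\<lambda>y. \<theta> (lslice \<phi> y)) (F - {i})"
          using \<phi>(1) \<theta>f f left_coideal_slice[OF M \<theta>f]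
          by (auto simp: kills_def functional_lslice lslice_lslice[symmetric])
        moreover have "lslice \<theta> x - lslice (\<lambda>y. \<theta> (lslice \<phi> y)) i \<in> M"
          using left_coideal_slice[OF M \<theta>f \<phi>(2)] f \<theta>f
          by (simp add: lin_diff[OF lin_lslice[OF \<theta>f]] lslice_lslice)
        ultimately show ?thesis
          unfolding G_def by blast
      qed
      ultimately have "Y \<subseteq> G"
        unfolding Y_def using MG by (intro span_minimal) auto
      then have "i \<in> G"
        using 2 i FX by blast
      then show ?thesis
        by (auto simp: G_def kills_def)
    qed
    then obtain s where s: "\<And>i. i \<in> F \<Longrightarrow> annihilates (s i) D"
      "\<And>i x. i \<in> F \<Longrightarrow> x \<in> F - {i} \<Longrightarrow> lslice (s i) x \<in> M"
      "\<And>i. i \<in> F \<Longrightarrow> i - lslice (s i) i \<in> M"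
      by metis
    define t where "t y = \<epsilon> y - (\<Sum>i\<in>F. s i y)" for y
    have tf: "functional t"
      unfolding t_def using s(1)
      by (intro functional_minus_minus counit_functional functional_sum) (simp add: annihilates_def)
    have "kills t F"
      unfolding kills_def
    proof (intro conjI tf ballI)
      fix x assume x: "x \<in> F"
      have "lslice t x = x - (\<Sum>i\<in>F. lslice (s i) x)"
        unfolding t_def lslice_diff_functional lslice_sum_functional lslice_counit ..
      also have "\<dots> = (x - lslice (s x) x) - (\<Sum>i\<in>F - {x}. lslice (s i) x)"
        using x by (simp add: sum.remove[OF finF])
      also have "\<dots> \<in> M"
        using x by (intro subspace_diff[OF Ms] subspace_sum[OF Ms] s) auto
      finally show "lslice t x \<in> M" .
    qed
    then have tX: "lslice t x \<in> M" if "x \<in> X" for x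
      using F(1) that by (auto simp: kills_def)
    have tC: "t c = 0" if "c \<in> ?C" for c
      using that unfolding coefficient_space_def
    proof (induction rule: span_induct_alt)
      case base
      then show ?case by (rule functional_zero[OF tf])
    next
      case (step a y z)
      then obtain x \<psi> where y: "y = rslice \<psi> x" "x \<in> X" "annihilates \<psi> M" by blast
      then have "t y = \<psi> (lslice t x)"
        by (simp add: functional_rslice tf annihilates_def)
      also have "\<dots> = 0"
        using tX[OF y(2)] y(3) by (simp add: annihilates_def)
      finally show ?case
        using step by (simp add: functional_add[OF tf] functional_scale[OF tf])
    qed
    have \<epsilon>D: "\<epsilon> d = 0" if "d \<in> D" for d
    proof -
      have "t d = 0" using tC that D by blast
      moreover have "(\<Sum>i\<in>F. s i d) = 0"
        using s(1) that by (simp add: annihilates_def)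
      ultimately show ?thesis by (simp add: t_def)
    qed
    have "d = 0" if d: "d \<in> D" for d
    proof -
      have "lslice \<epsilon> d = 0"
        unfolding lslice_def
        by (rule sw_subcoalgebra_zero[of D])
          (use D d in \<open>auto intro!: bilinI lin_intros counit_functional simp: \<epsilon>D\<close>)
      then show ?thesis by (simp add: lslice_counit)
    qed
    then show ?thesis
      using subspace_0[OF Ds] by blast
  qed
qed

text \<open>
  Let \<open>X\<close> be a minimal left coideal above a proper \<open>M\<close>. Modulo \<open>H \<otimes> M\<close>, the first tensor factors of
  \<open>\<Delta>(X)\<close> lie in the coefficient space of \<open>X / M\<close>, which is simple and hence part of the coradical. Thus
  \<open>X\<close> is contained in the wedge of the coradical and \<open>M\<close>.
\<close>

lemma left_coideal_eq_UNIV: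
  assumes M: "left_coideal M" "wedge coradical M \<subseteq> M"
  shows "M = UNIV"
proof (rule ccontr)
  assume "M \<noteq> UNIV"
  then obtain X where X: "minimal_over M X"
    by (rule exists_minimal_over[OF M(1)])
  have C: "coefficient_space M X \<subseteq> coradical"
    unfolding coradical_def
    by (rule order_trans[OF Union_upper span_superset])
      (simp add: simple_coefficient_space[OF M(1) X])
  have "X \<subseteq> wedge coradical M"
  proof (intro subsetI wedgeI)
    fix x F assume x: "x \<in> X" and F: "bilin F" "\<And>u b. u \<in> coradical \<Longrightarrow> F u b = 0"
      "\<And>a v. v \<in> M \<Longrightarrow> F a v = 0"
    show "sw F x = 0"
    proof (rule sw_eq_0_if_left_slices_annihilator[OF F(1) left_coideal_subspace[OF M(1)] F(3) _ F(2)])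
      fix \<phi> assume "functional \<phi>" "\<And>v. v \<in> M \<Longrightarrow> \<phi> v = 0"
      then have "rslice \<phi> x \<in> coefficient_space M X"
        unfolding coefficient_space_def using x by (intro span_base) (auto simp: annihilates_def)
      with C show "sw (\<lambda>a b. scale (\<phi> b) a) x \<in> coradical"
        by (auto simp: rslice_def)
    qed
  qed
  then show False
    using M(2) X by (auto simp: minimal_over_def)
qed

theorem filtration_exhausts: "\<exists>n. coradical_filtration n = UNIV"
proof -
  obtain E where "finite_dimensional_vector_space scale E"
    by (rule finite_dim_basis)
  then interpret fd: finite_dimensional_vector_space scale E .
  obtain n where n: "\<And>m. dim (coradical_filtration m) \<le> dim (coradical_filtration n)"
    using ex_has_greatest_nat[of "\<lambda>_. True" _ "\<lambda>m. dim (coradical_filtration m)" "Suc (dim (UNIV :: 'h set))"]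
      fd.dim_subset[OF subset_UNIV] by (auto simp: less_Suc_eq_le)
  have "coradical_filtration n = coradical_filtration (Suc n)"
    by (rule fd.subspace_dim_equal[OF subspace_filtration subspace_filtration filtration_subset_Suc n])
  then have "wedge coradical (coradical_filtration n) \<subseteq> coradical_filtration n"
    using coradical_filtration_Suc by blast
  moreover have "left_coideal (coradical_filtration n)"
    using left_coideal_subcoalgebra[OF subcoalgebra_coradical] left_coideal_wedge[OF subcoalgebra_coradical]
      coradical_filtration_Suc by (cases n) auto
  ultimately show ?thesis
    using left_coideal_eq_UNIV by blast
qed

lemma filtration_loewy_length: "coradical_filtration (loewy_length - 1) = UNIV"
proof -
  obtain n where "coradical_filtration n = UNIV"
    using filtration_exhausts by blast
  then have "1 \<le> Suc n \<and> coradical_filtration (Suc n - 1) = UNIV"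
    by simp
  from LeastI[of "\<lambda>L. 1 \<le> L \<and> coradical_filtration (L - 1) = UNIV", OF this] show ?thesis
    by (simp add: loewy_length_def)
qed

end

section \<open>Sweedler calculus in a Hopf algebra\<close>

context hopf_algebra
begin

lemma lin_times_left [lin_intros]: "lin f \<Longrightarrow> lin (\<lambda>x. f x * b)"
  by (simp add: lin_iff scale_mult_left distrib_right)

lemma lin_times_right [lin_intros]: "lin f \<Longrightarrow> lin (\<lambda>x. b * f x)"
  by (simp add: lin_iff scale_mult_right distrib_left)

lemma lin_antipode [lin_intros]: "lin f \<Longrightarrow> lin (\<lambda>x. S (f x))"
  by (rule lin_compose[OF antipode_linear])

lemma sw_one: "bilin F \<Longrightarrow> sw F 1 = F 1 1"
  by (simp add: sw_class[OF _ comult_one])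

lemma sw_times:
  assumes "bilin F"
  shows "sw F (x * y) = sw (\<lambda>a b. sw (\<lambda>c d. F (a * c) (b * d)) y) x"
proof -
  have "sw F (x * y) = tensor_lift scale (\<lambda>xs. F (xs ! 0) (xs ! 1)) (tensor_times scale 2 (\<Delta> x) (\<Delta> y))"
    by (simp add: sw_def comult_mult)
  also have "\<dots> = sw (\<lambda>a b. sw (\<lambda>c d. F (a * c) (b * d)) y) x"
    unfolding tensor_lift_times[OF multilinear_two[OF assms]]
    by (rule tensor_lift_comult) (rule tensor_lift_comult, simp)
  finally show ?thesis .
qed

lemma multilinear_prod_list: "multilinear scale scale n prod_list"
  unfolding multilinear_def by (auto intro!: lin_intros)

lemma sw_antipode_left: "lin f \<Longrightarrow> sw (\<lambda>a b. f (S a * b)) x = scale (\<epsilon> x) (f 1)"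
proof -
  assume f: "lin f"
  have "sw (\<lambda>a b. S a * b) x = tensor_lift scale prod_list (tensor_funs scale [S, id] (\<Delta> x))"
    by (subst tensor_lift_funs[OF multilinear_prod_list])
      (rule tensor_lift_comult[symmetric], simp)
  then show ?thesis
    by (simp add: lin_apply_sw[OF f, symmetric] antipode_left lin_scale[OF f])
qed

lemma sw_antipode_right: "lin f \<Longrightarrow> sw (\<lambda>a b. f (a * S b)) x = scale (\<epsilon> x) (f 1)"
proof -
  assume f: "lin f"
  have "sw (\<lambda>a b. a * S b) x = tensor_lift scale prod_list (tensor_funs scale [id, S] (\<Delta> x))"
    by (subst tensor_lift_funs[OF multilinear_prod_list])
      (rule tensor_lift_comult[symmetric], simp)
  then show ?thesis
    by (simp add: lin_apply_sw[OF f, symmetric] antipode_right lin_scale[OF f])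
qed

lemma antipode_one: "S 1 = 1"
proof -
  have "sw (\<lambda>a b. S a * b) 1 = S 1 * 1"
    by (rule sw_one) (intro bilinI lin_intros)
  then show ?thesis
    using sw_antipode_left[OF lin_ident, of 1] by (simp add: counit_one)
qed

lemma counit_antipode: "\<epsilon> (S x) = \<epsilon> x"
proof -
  have l: "lin (\<lambda>z. scale (\<epsilon> z) 1)"
    by (intro lin_intros)
  have "scale (\<epsilon> x) 1 = sw (\<lambda>a b. scale (\<epsilon> (S a * b)) 1) x"
    by (simp add: sw_antipode_left[OF l] counit_one)
  also have "\<dots> = sw (\<lambda>a b. scale (\<epsilon> b) (scale (\<epsilon> (S a)) 1)) x"
    by (simp add: counit_mult mult.commute)
  also have "\<dots> = scale (\<epsilon> (S x)) 1"
    by (rule sw_counit_right) (intro lin_intros)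
  finally show ?thesis by simp
qed

text \<open>
  The sum \<open>\<Sum> S(x\<^sub>1 y\<^sub>1) x\<^sub>2 y\<^sub>2 S(y\<^sub>3) S(x\<^sub>3)\<close> is evaluated in two ways.
\<close>

lemma antipode_times: "S (x * y) = S y * S x"
proof -
  let ?T = "\<lambda>a u v b p q. S (a * b) * (u * (p * S q) * S v)"
  have "sw (\<lambda>a a'. sw (\<lambda>u v. sw (\<lambda>b b'. sw (\<lambda>p q. ?T a u v b p q) b') y) a') x
    = sw (\<lambda>a a'. sw (\<lambda>u v. S (a * y) * (u * S v)) a') x"
  proof (intro arg_cong[of _ _ "\<lambda>G. sw G x"] arg_cong[of _ _ "\<lambda>G. sw G z" for z] ext)
    fix a a' u v
    have "sw (\<lambda>b b'. sw (\<lambda>p q. ?T a u v b p q) b') y = sw (\<lambda>b b'. scale (\<epsilon> b') (S (a * b) * (u * S v))) y"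
      by (subst sw_antipode_right) (intro lin_intros, simp)
    also have "\<dots> = S (a * y) * (u * S v)"
      by (rule sw_counit_right) (intro lin_intros)
    finally show "sw (\<lambda>b b'. sw (\<lambda>p q. ?T a u v b p q) b') y = S (a * y) * (u * S v)" .
  qed
  also have "\<dots> = sw (\<lambda>a a'. scale (\<epsilon> a') (S (a * y))) x"
    by (subst sw_antipode_right) (intro lin_intros, simp)
  also have "\<dots> = S (x * y)"
    by (rule sw_counit_right) (intro lin_intros)
  finally have 1: "S (x * y) = sw (\<lambda>a a'. sw (\<lambda>u v. sw (\<lambda>b b'. sw (\<lambda>p q. ?T a u v b p q) b') y) a') x" ..
  also have "\<dots> = sw (\<lambda>w v. sw (\<lambda>a u. sw (\<lambda>b b'. sw (\<lambda>p q. ?T a u v b p q) b') y) w) x"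
    by (rule sw_coassoc[symmetric]) (intro lin_intros)+
  also have "\<dots> = sw (\<lambda>w v. scale (\<epsilon> w) (S y * S v)) x"
  proof (intro arg_cong[of _ _ "\<lambda>G. sw G x"] ext)
    fix w v
    have "sw (\<lambda>a u. sw (\<lambda>b b'. sw (\<lambda>p q. ?T a u v b p q) b') y) w =
      sw (\<lambda>a u. sw (\<lambda>z q. sw (\<lambda>b p. ?T a u v b p q) z) y) w"
      by (subst sw_coassoc) (intro lin_intros | simp)+
    also have "\<dots> = sw (\<lambda>z q. sw (\<lambda>a u. sw (\<lambda>b p. ?T a u v b p q) z) w) y"
      by (rule sw_swap)
    also have "\<dots> = sw (\<lambda>z q. scale (\<epsilon> z) (scale (\<epsilon> w) (S q * S v))) y"
    proof (intro arg_cong[of _ _ "\<lambda>G. sw G y"] ext)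
      fix z q
      have "sw (\<lambda>a u. sw (\<lambda>b p. ?T a u v b p q) z) w =
        sw (\<lambda>a u. sw (\<lambda>b p. (\<lambda>s t. (S s * t) * (S q * S v)) (a * b) (u * p)) z) w"
        by (simp add: mult.assoc)
      also have "\<dots> = sw (\<lambda>s t. (S s * t) * (S q * S v)) (w * z)"
        by (rule sw_times[symmetric]) (intro bilinI lin_intros)
      also have "\<dots> = scale (\<epsilon> (w * z)) (1 * (S q * S v))"
        by (rule sw_antipode_left) (intro lin_intros)
      finally show "sw (\<lambda>a u. sw (\<lambda>b p. ?T a u v b p q) z) w = scale (\<epsilon> z) (scale (\<epsilon> w) (S q * S v))"
        by (simp add: counit_mult mult.commute)
    qed
    also have "\<dots> = scale (\<epsilon> w) (S y * S v)"
      by (rule sw_counit_left) (intro lin_intros)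
    finally show "sw (\<lambda>a u. sw (\<lambda>b b'. sw (\<lambda>p q. ?T a u v b p q) b') y) w = scale (\<epsilon> w) (S y * S v)" .
  qed
  also have "\<dots> = S y * S x"
    by (rule sw_counit_left) (intro lin_intros)
  finally show ?thesis .
qed

text \<open>
  The antipode reverses the comultiplication. The Sweedler sum of
  \<open>F(S(x\<^sub>1)\<^sub>1 x\<^sub>2 S(x\<^sub>5), S(x\<^sub>1)\<^sub>2 x\<^sub>3 S(x\<^sub>4))\<close> is evaluated in two ways: either \<open>x\<^sub>3 S(x\<^sub>4)\<close> and then
  \<open>x\<^sub>2 S(x\<^sub>5)\<close> collapse, or \<open>x\<^sub>2\<close> and \<open>x\<^sub>3\<close> come from one element \<open>m\<close> and \<open>\<Delta>(S(x\<^sub>1) m)\<close> collapses.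
\<close>

lemma sw_antipode:
  assumes F: "bilin F"
  shows "sw F (S x) = sw (\<lambda>a b. F (S b) (S a)) x"
proof -
  note lin = lin_intros bilin_compose1[OF F] bilin_compose2[OF F]
  let ?G = "\<lambda>s t u v r. sw (\<lambda>p q. F (s * (u * S q)) (t * (v * S p))) r"
  have collapse: "sw (\<lambda>u w'. sw (\<lambda>v r. ?G s t u v r) w') w = scale (\<epsilon> w) (F s t)" for s t w
  proof -
    have "sw (\<lambda>v r. ?G s t u v r) w' = F (s * (u * S w')) t" for u w'
    proof -
      have "sw (\<lambda>v r. ?G s t u v r) w' = sw (\<lambda>z q. sw (\<lambda>v p. F (s * (u * S q)) (t * (v * S p))) z) w'"
        by (rule sw_coassoc[symmetric]) (intro lin)+
      also have "\<dots> = sw (\<lambda>z q. scale (\<epsilon> z) (F (s * (u * S q)) t)) w'"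
        by (subst sw_antipode_right) (intro lin, simp)
      also have "\<dots> = F (s * (u * S w')) t"
        by (rule sw_counit_left) (intro lin)
      finally show ?thesis .
    qed
    then have "sw (\<lambda>u w'. sw (\<lambda>v r. ?G s t u v r) w') w = sw (\<lambda>u w'. F (s * (u * S w')) t) w"
      by simp
    also have "\<dots> = scale (\<epsilon> w) (F (s * 1) t)"
      by (rule sw_antipode_right) (intro lin)
    finally show ?thesis by simp
  qed
  have "sw F (S x) = sw (\<lambda>a w. scale (\<epsilon> w) (sw F (S a))) x"
    by (rule sw_counit_right[symmetric]) (intro lin_compose[OF lin_sw[OF F]] lin)
  also have "\<dots> = sw (\<lambda>a w. sw (\<lambda>s t. sw (\<lambda>u w'. sw (\<lambda>v r. ?G s t u v r) w') w) (S a)) x"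
    by (simp add: collapse sw_scale)
  also have "\<dots> = sw (\<lambda>a w. sw (\<lambda>s t. sw (\<lambda>m r. sw (\<lambda>u v. ?G s t u v r) m) w) (S a)) x"
    by (subst sw_coassoc[where x = w for w]) (intro lin | simp)+
  also have "\<dots> = sw (\<lambda>a w. sw (\<lambda>m r. sw (\<lambda>s t. sw (\<lambda>u v. ?G s t u v r) m) (S a)) w) x"
    by (subst sw_swap) simp
  also have "\<dots> = sw (\<lambda>a w. sw (\<lambda>m r. sw (\<lambda>s t. sw (\<lambda>p q. F (s * S q) (t * S p)) r) (S a * m)) w) x"
    by (subst sw_times) (intro bilinI lin, simp add: mult.assoc)
  also have "\<dots> = sw (\<lambda>c r. sw (\<lambda>a m. sw (\<lambda>s t. sw (\<lambda>p q. F (s * S q) (t * S p)) r) (S a * m)) c) x"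
    by (rule sw_coassoc[symmetric]) (intro lin)+
  also have "\<dots> = sw (\<lambda>c r. scale (\<epsilon> c) (sw (\<lambda>s t. sw (\<lambda>p q. F (s * S q) (t * S p)) r) 1)) x"
    by (subst sw_antipode_left) (intro lin, simp)
  also have "\<dots> = sw (\<lambda>c r. scale (\<epsilon> c) (sw (\<lambda>p q. F (S q) (S p)) r)) x"
    by (subst sw_one) (intro bilinI lin, simp)
  also have "\<dots> = sw (\<lambda>p q. F (S q) (S p)) x"
    by (rule sw_counit_left) (intro lin)
  finally show ?thesis .
qed

section \<open>Extending identities from a Hopf subalgebra to its wedge square\<close>

lemma hopf_subalgebraD:
  assumes "hopf_subalgebra B"
  shows "subcoalgebra B" "subspace B" "1 \<in> B" "\<And>x y. x \<in> B \<Longrightarrow> y \<in> B \<Longrightarrow> x * y \<in> B"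
    "\<And>x. x \<in> B \<Longrightarrow> S x \<in> B"
  using assms by (auto simp: hopf_subalgebra_def subcoalgebra_def)

text \<open>
  The fundamental theorem of Hopf modules for the quotient of \<open>B \<and> B\<close> by \<open>B\<close>, in explicit form. Here \<open>r\<close>
  has kernel \<open>B\<close> and \<open>p = id - r\<close> maps into \<open>B\<close>. For \<open>x\<close> in \<open>B \<and> B\<close> the left coaction of \<open>B\<close> on the class of
  \<open>x\<close> is \<open>\<Sum> p(x\<^sub>1) \<otimes> r(x\<^sub>2)\<close>. Writing \<open>b = p(x\<^sub>1)\<close> and \<open>k = r(x\<^sub>2)\<close>, one has
  \<open>r(x) = \<Sum> b\<^sub>1 (S(b\<^sub>2) k)\<close>, where the elements \<open>S(b\<^sub>2) k\<close> represent coinvariants.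

  For \<open>D(y) = \<Sum> F(y\<^sub>1, y\<^sub>2)\<close>, the hypotheses on \<open>F\<close> say that only the class of the second tensor factor
  modulo \<open>B\<close> matters and that \<open>D\<close> vanishes on coinvariants; therefore \<open>\<Sum> b\<^sub>1 D(S(b\<^sub>2) k) = 0\<close>. The maps
  \<open>L\<close> and \<open>L'\<close> stand for the different ways in which \<open>D\<close> may be compatible with multiplication by \<open>B\<close>.
\<close>

lemma wedge_square_transfer:
  assumes B: "hopf_subalgebra B" and x: "x \<in> wedge B B"
    and r: "lin r" "\<And>u. u \<in> B \<Longrightarrow> r u = 0" "\<And>y. y - r y \<in> B"
    and F: "bilin F" "\<And>a b. b \<in> B \<Longrightarrow> F a b = 0" "\<And>b. F 1 b = 0"
    and L: "lin L" "lin L'" "\<And>b y. b \<in> B \<Longrightarrow> L (b * sw F y) = L' (b * y)"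
  shows "L' (r x) = 0"
proof -
  note B' = hopf_subalgebraD[OF B]
  define p where "p y = y - r y" for y
  have pB: "p y \<in> B" for y
    using r(3) by (simp add: p_def)
  have p_id: "p u = u" if "u \<in> B" for u
    using r(2)[OF that] by (simp add: p_def)
  have p_lin: "lin p"
    unfolding p_def by (intro lin_intros lin_compose[OF r(1)])
  note lin = lin_intros lin_compose[OF r(1)] lin_compose[OF p_lin] bilin_compose1[OF F(1)]
    bilin_compose2[OF F(1)] lin_compose[OF lin_sw[OF F(1)]]
  \<comment> \<open>For \<open>x\<close> in the wedge square the component of \<open>\<Delta>(x)\<close> in \<open>r(H) \<otimes> r(H)\<close> is zero.\<close>
  have project: "sw (\<lambda>c k. K c k) x = sw (\<lambda>c k. K (p c) k) x"
    if K: "bilin K" "\<And>a b. b \<in> B \<Longrightarrow> K a b = 0" for K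
  proof -
    have "sw (\<lambda>c k. K c k) x - sw (\<lambda>c k. K (p c) k) x = sw (\<lambda>c k. K (r c) k) x"
      by (simp add: sw_diff[symmetric] p_def lin_diff[OF bilinD1[OF K(1)], symmetric])
    also have "\<dots> = 0"
    proof (rule wedgeD[OF x])
      show "bilin (\<lambda>c k. K (r c) k)"
        by (intro bilinI bilin_compose1[OF K(1)] bilin_compose2[OF K(1)] lin)
    qed (simp_all add: r(2) K(2) lin_zero[OF bilinD1[OF K(1)]])
    finally show ?thesis by simp
  qed
  \<comment> \<open>The trilinear map with \<open>\<Sum> c\<^sub>1 D(S(c\<^sub>2) k) = \<Sum> M(c, k\<^sub>1, k\<^sub>2)\<close>. It vanishes if \<open>c\<close> and \<open>v\<close> are in \<open>B\<close>,
    and the sum \<open>\<Sum> M(c\<^sub>1, c\<^sub>2, k)\<close>, obtained from it by coassociativity, contains the factor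
    \<open>F(S(c\<^sub>3) c\<^sub>4, \<dots>)\<close>.\<close>
  define M where "M c u v = sw (\<lambda>b b'. b * sw (\<lambda>s t. F (s * u) (t * v)) (S b')) c" for c u v
  have M1: "lin (\<lambda>c. M (f c) u v)" and M2: "lin (\<lambda>u. M c (f u) v)" and M3: "lin (\<lambda>v. M c u (f v))"
    if "lin f" for f c u v
    unfolding M_def by (intro lin that)+
  have M_zero: "M c u v = 0" if "c \<in> B" "v \<in> B" for c u v
    unfolding M_def
  proof (rule sw_subcoalgebra_zero[OF B'(1) that(1)])
    show "bilin (\<lambda>b b'. b * sw (\<lambda>s t. F (s * u) (t * v)) (S b'))"
      by (intro bilinI lin)
    fix b b' assume "b \<in> B" "b' \<in> B"
    then have "sw (\<lambda>s t. F (s * u) (t * v)) (S b') = 0"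
      using that(2) by (intro sw_subcoalgebra_zero[OF B'(1)] B'(5) bilinI lin F(2) B'(4))
    then show "b * sw (\<lambda>s t. F (s * u) (t * v)) (S b') = 0" by simp
  qed
  have expand: "sw (\<lambda>b b'. b * sw F (S b' * k)) c = sw (\<lambda>u v. M c u v) k" for c k
  proof -
    have "sw (\<lambda>b b'. b * sw F (S b' * k)) c =
        sw (\<lambda>b b'. b * sw (\<lambda>u v. sw (\<lambda>s t. F (s * u) (t * v)) (S b')) k) c"
      by (subst sw_times[OF F(1)], subst sw_swap) simp
    also have "\<dots> = sw (\<lambda>b b'. sw (\<lambda>u v. b * sw (\<lambda>s t. F (s * u) (t * v)) (S b')) k) c"
      by (subst lin_apply_sw) (intro lin, simp)
    also have "\<dots> = sw (\<lambda>u v. M c u v) k"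
      unfolding M_def by (rule sw_swap)
    finally show ?thesis .
  qed
  have cancel: "sw (\<lambda>u v. M u v k) c = 0" for c k
  proof -
    have "sw (\<lambda>u v. M u v k) c = sw (\<lambda>u v. sw (\<lambda>b b'. sw (\<lambda>s t. b * F (S t * v) (S s * k)) b') u) c"
    proof -
      have "b * sw (\<lambda>s t. F (s * v) (t * k)) (S b') = sw (\<lambda>s t. b * F (S t * v) (S s * k)) b'" for b b' v
        by (subst sw_antipode, intro bilinI lin, subst lin_apply_sw) (intro lin, simp)
      then show ?thesis by (simp add: M_def)
    qed
    also have "\<dots> = sw (\<lambda>b w. sw (\<lambda>b' v. sw (\<lambda>s t. b * F (S t * v) (S s * k)) b') w) c"
      by (rule sw_coassoc) (intro lin)+
    also have "\<dots> = sw (\<lambda>b w. sw (\<lambda>s w'. sw (\<lambda>t v. b * F (S t * v) (S s * k)) w') w) c"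
      by (subst sw_coassoc) (intro lin | simp)+
    also have "\<dots> = sw (\<lambda>b w. sw (\<lambda>s w'. scale (\<epsilon> w') (b * F 1 (S s * k))) w) c"
      by (subst sw_antipode_left) (intro lin, simp)
    finally show ?thesis
      by (simp add: F(3))
  qed
  have zero: "sw (\<lambda>c k. sw (\<lambda>b b'. b * sw F (S b' * r k)) (p c)) x = 0"
  proof -
    have "sw (\<lambda>u v. M (p c) u v) (r k) = sw (\<lambda>u v. M (p c) u v) k" for c k
    proof -
      have bil: "bilin (\<lambda>u v. M (p c) u v)"
        by (intro bilinI M2 M3 lin)
      have "sw (\<lambda>u v. M (p c) u v) (p k) = 0"
        by (rule sw_subcoalgebra_zero[OF B'(1) pB bil]) (rule M_zero[OF pB])
      then show ?thesis
        using lin_diff[OF lin_sw[OF bil], of k "r k", folded p_def] by simp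
    qed
    then have "sw (\<lambda>c k. sw (\<lambda>b b'. b * sw F (S b' * r k)) (p c)) x =
        sw (\<lambda>c k. sw (\<lambda>u v. M (p c) u v) k) x"
      by (simp add: expand)
    also have "\<dots> = sw (\<lambda>c k. sw (\<lambda>u v. M (p u) v k) c) x"
      by (rule sw_coassoc[symmetric]) (intro M1 M2 M3 lin)+
    also have "\<dots> = sw (\<lambda>c k. sw (\<lambda>u v. M (p u) v k) (p c)) x"
    proof (rule project)
      show "bilin (\<lambda>c k. sw (\<lambda>u v. M (p u) v k) c)"
        by (intro bilinI lin M1 M2 M3)
      show "sw (\<lambda>u v. M (p u) v b) a = 0" if "b \<in> B" for a b
        by (simp add: M_zero[OF pB that])
    qed
    also have "\<dots> = sw (\<lambda>c k. sw (\<lambda>u v. M u v k) (p c)) x"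
    proof (intro arg_cong[of _ _ "\<lambda>G. sw G x"] ext)
      fix c k
      show "sw (\<lambda>u v. M (p u) v k) (p c) = sw (\<lambda>u v. M u v k) (p c)"
        by (rule sw_subcoalgebra_cong[OF B'(1) pB])
          ((intro bilinI M1 M2 lin)+, simp add: p_id)
    qed
    also have "\<dots> = 0"
      by (simp add: cancel)
    finally show ?thesis .
  qed
  have "sw (\<lambda>c k. sw (\<lambda>b b'. b * (S b' * r k)) (p c)) x = sw (\<lambda>c k. scale (\<epsilon> (p c)) (r k)) x"
  proof -
    have "sw (\<lambda>b b'. b * (S b' * r k)) c = scale (\<epsilon> c) (1 * r k)" for c k
      unfolding mult.assoc[symmetric] by (rule sw_antipode_right) (intro lin)
    then show ?thesis by simp
  qed
  also have "\<dots> = sw (\<lambda>c k. scale (\<epsilon> c) (r k)) x"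
    by (rule project[symmetric]) (intro bilinI lin, simp add: r(2))
  also have "\<dots> = r x"
    by (rule sw_counit_left[OF r(1)])
  finally have "L' (r x) = L' (sw (\<lambda>c k. sw (\<lambda>b b'. b * (S b' * r k)) (p c)) x)"
    by (rule arg_cong[OF sym])
  also have "\<dots> = sw (\<lambda>c k. sw (\<lambda>b b'. L' (b * (S b' * r k))) (p c)) x"
    by (simp only: lin_apply_sw[OF L(2)])
  also have "\<dots> = sw (\<lambda>c k. sw (\<lambda>b b'. L (b * sw F (S b' * r k))) (p c)) x"
  proof (intro arg_cong[of _ _ "\<lambda>G. sw G x"] ext)
    fix c k
    show "sw (\<lambda>b b'. L' (b * (S b' * r k))) (p c) = sw (\<lambda>b b'. L (b * sw F (S b' * r k))) (p c)"
      by (rule sw_subcoalgebra_cong[OF B'(1) pB])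
        ((intro bilinI lin_compose[OF L(1)] lin_compose[OF L(2)] lin)+, simp add: L(3))
  qed
  also have "\<dots> = L (sw (\<lambda>c k. sw (\<lambda>b b'. b * sw F (S b' * r k)) (p c)) x)"
    by (simp add: lin_apply_sw[OF L(1)])
  also have "\<dots> = 0"
    by (simp add: zero lin_zero[OF L(1)])
  finally show ?thesis .
qed

section \<open>Bijectivity of the antipode\<close>

lemma sw_mem_subspace: "subspace U \<Longrightarrow> (\<And>a b. F a b \<in> U) \<Longrightarrow> sw F x \<in> U"
  by (simp add: sw_eq_sum subspace_sum subspace_scale)

lemma hopf_subalgebra_range_antipode: "hopf_subalgebra (range S)"
  unfolding hopf_subalgebra_def subcoalgebra_iff
proof (intro conjI ballI allI impI)
  show "subspace (range S)"
    unfolding subspace_def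
    by (auto simp: lin_add[OF antipode_linear, symmetric] lin_scale[OF antipode_linear, symmetric])
      (metis lin_zero[OF antipode_linear] rangeI)
  show "1 \<in> range S"
    using antipode_one by (metis rangeI)
  show "a * b \<in> range S" if "a \<in> range S" "b \<in> range S" for a b
    using that antipode_times[symmetric] by auto
  show "S ` range S \<subseteq> range S"
    by auto
  fix y F assume "y \<in> range S" "bilin F" "\<forall>a\<in>range S. \<forall>b\<in>range S. F a b = 0"
  then show "sw F y = 0"
    by (auto simp: sw_antipode)
qed

text \<open>
  For \<open>B = S(H)\<close> take \<open>F(u, v) = (S(u) - \<epsilon>(u)) r(v)\<close>. Modulo \<open>B\<close> the factor \<open>r(v)\<close> may be replaced by \<open>v\<close>
  in the first term, because \<open>S(u) (v - r(v)) \<in> B\<close>, so that \<open>\<Sum> F(y\<^sub>1, y\<^sub>2) \<equiv> \<epsilon>(y) - y \<equiv> - y\<close>. The transfer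
  lemma thus yields \<open>x \<equiv> 0\<close> modulo \<open>B\<close>.
\<close>

lemma wedge_range_antipode: "wedge (range S) (range S) \<subseteq> range S"
proof
  let ?B = "range S"
  note B' = hopf_subalgebraD[OF hopf_subalgebra_range_antipode]
  fix x assume x: "x \<in> wedge ?B ?B"
  obtain r where r: "lin r" "\<forall>u\<in>?B. r u = 0" "\<forall>y. y - r y \<in> ?B"
    by (rule exists_linear_with_kernel[OF B'(2)])
  note lin = lin_intros lin_compose[OF r(1)]
  define F where "F u v = (S u - scale (\<epsilon> u) 1) * r v" for u v
  have F: "bilin F"
    unfolding F_def by (intro bilinI lin)
  have sum_mem: "sw F y + y \<in> ?B" for y
  proof -
    have "sw F y = sw (\<lambda>u v. S u * v) y - sw (\<lambda>u v. S u * (v - r v)) y - sw (\<lambda>u v. scale (\<epsilon> u) (r v)) y"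
      unfolding F_def sw_diff[symmetric] by (simp add: algebra_simps scale_mult_left)
    also have "\<dots> = scale (\<epsilon> y) 1 - sw (\<lambda>u v. S u * (v - r v)) y - r y"
      by (simp add: sw_antipode_left[OF lin_ident] sw_counit_left[OF r(1)])
    finally have "sw F y + y = scale (\<epsilon> y) 1 - sw (\<lambda>u v. S u * (v - r v)) y + (y - r y)"
      by simp
    moreover have "sw (\<lambda>u v. S u * (v - r v)) y \<in> ?B"
      by (intro sw_mem_subspace[OF B'(2)] B'(4) rangeI r(3)[rule_format])
    moreover have "scale (\<epsilon> y) 1 \<in> ?B"
      by (intro subspace_scale[OF B'(2)] B'(3))
    ultimately show ?thesis
      using r(3) subspace_add[OF B'(2)] subspace_diff[OF B'(2)] by metis
  qed
  have "- r (r x) = 0"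
  proof (rule wedge_square_transfer[OF hopf_subalgebra_range_antipode x r(1) _ _ F _ _ r(1)])
    show "r u = 0" if "u \<in> ?B" for u using r(2) that by blast
    show "y - r y \<in> ?B" for y using r(3) by blast
    show "F a b = 0" if "b \<in> ?B" for a b using r(2) that by (auto simp: F_def)
    show "F 1 b = 0" for b by (simp add: F_def antipode_one counit_one)
    show "lin (\<lambda>y. - r y)" by (intro lin)
    show "r (b * sw F y) = - r (b * y)" if "b \<in> ?B" for b y
    proof -
      have "r (b * (sw F y + y)) = 0"
        using B'(4)[OF that sum_mem] r(2) by blast
      then show ?thesis
        by (simp add: distrib_left lin_add[OF r(1)] eq_neg_iff_add_eq_0)
    qed
  qed
  then have "r x \<in> ?B"
    using r(3)[rule_format, of "r x"] by simp
  then show "x \<in> ?B"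
    using subspace_add[OF B'(2) r(3)[rule_format, of x]] by fastforce
qed

lemma subcoalgebra_span_one: "subcoalgebra (span {1})"
  unfolding subcoalgebra_iff
proof (intro conjI ballI allI impI)
  fix x F assume "x \<in> span {1}" "bilin F" "\<forall>a\<in>span {1}. \<forall>b\<in>span {1}. F a b = 0"
  then show "sw F x = 0"
    by (auto simp: span_singleton sw_scale_arg sw_one) (metis rangeI scale_one scale_zero_right)
qed (rule subspace_span)

text \<open>
  Choose \<open>\<phi>\<close> vanishing on \<open>E\<close> with \<open>\<phi>(1) = 1\<close> and slice \<open>1 \<otimes> 1 = \<Delta>(c) + \<Delta>(e)\<close> with \<open>\<phi>\<close>: the left side gives
  \<open>1\<close>, the right side an element of \<open>C\<close>.
\<close>

lemma one_mem_sum_of_subcoalgebras: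
  assumes C: "subcoalgebra C" and E: "subcoalgebra E" "1 \<notin> E" and ce: "1 = c + e" "c \<in> C" "e \<in> E"
  shows "1 \<in> C"
proof -
  obtain \<phi> where \<phi>: "functional \<phi>" "\<forall>u\<in>E. \<phi> u = 0" "\<phi> 1 = 1"
    using exists_functional_separating[of E 1] E by (metis subcoalgebra_def)
  have "lslice \<phi> 1 = 1"
    unfolding lslice_def by (subst sw_one) (intro bilinI lin_intros \<phi>(1), simp add: \<phi>(3))
  moreover have "lslice \<phi> e = 0"
    unfolding lslice_def
    by (rule sw_subcoalgebra_zero[OF E(1) ce(3)]) (intro bilinI lin_intros \<phi>(1), simp add: \<phi>(2))
  moreover have "lslice \<phi> 1 = lslice \<phi> c + lslice \<phi> e"
    unfolding ce(1) by (rule lin_add[OF lin_lslice[OF \<phi>(1)]])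
  moreover have "lslice \<phi> c \<in> C"
    by (rule left_coideal_slice[OF left_coideal_subcoalgebra[OF C] \<phi>(1) ce(2)])
  ultimately show ?thesis by simp
qed

lemma one_not_mem_span_Union:
  assumes "\<And>C. C \<in> \<C> \<Longrightarrow> subcoalgebra C" "\<And>C. C \<in> \<C> \<Longrightarrow> 1 \<notin> C"
  shows "1 \<notin> span (\<Union>\<C>)"
proof
  assume "1 \<in> span (\<Union>\<C>)"
  then obtain T where T: "finite T" "T \<subseteq> \<Union>\<C>" "1 \<in> span T"
    unfolding span_explicit by (auto intro: that simp: span_explicit)
  obtain \<D> where \<D>: "finite \<D>" "\<D> \<subseteq> \<C>" "T \<subseteq> \<Union>\<D>"
    using finite_subset_Union[OF T(1,2)] by metis
  from \<D>(1,2) have "1 \<notin> span (\<Union>\<D>)"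
  proof (induction rule: finite_induct)
    case empty
    then show ?case by simp
  next
    case (insert C \<D>)
    have C: "subcoalgebra C" "1 \<notin> C" using assms insert.prems by auto
    have E: "subcoalgebra (span (\<Union>\<D>))"
      using assms(1) insert.prems by (intro subcoalgebra_span_Union) auto
    show ?case
    proof
      assume "1 \<in> span (\<Union>(insert C \<D>))"
      then obtain c e where ce: "1 = c + e" "c \<in> span C" "e \<in> span (\<Union>\<D>)"
        by (auto simp: span_Un)
      have "c \<in> C"
        using ce(2) C(1) span_minimal[of C C] by (auto simp: subcoalgebra_def)
      then have "1 \<in> C"
        using ce insert by (intro one_mem_sum_of_subcoalgebras[OF C(1) E _ ce(1)]) auto
      with C(2) show False ..
    qed
  qed
  with T(3) \<D>(3) span_mono show False by blast
qed

text \<open>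
  By the previous lemma, the simple subcoalgebras that do not contain \<open>1\<close> do not span \<open>1\<close>. A functional
  that vanishes on them and is \<open>1\<close> at \<open>1\<close> is an integral: on a simple subcoalgebra without \<open>1\<close>
  both sides are zero, and the only other one is spanned by \<open>1\<close>.
\<close>

lemma exists_coradical_integral:
  obtains \<mu> where "functional \<mu>" "\<mu> 1 = 1" "\<forall>x\<in>coradical. sw (\<lambda>a b. scale (\<mu> b) a) x = scale (\<mu> x) 1"
proof -
  let ?\<C> = "{C. simple_subcoalgebra C \<and> 1 \<notin> C}"
  have "1 \<notin> span (\<Union>?\<C>)"
    by (rule one_not_mem_span_Union) (auto simp: simple_subcoalgebra_def)
  then obtain \<mu> where \<mu>: "functional \<mu>" "\<forall>u\<in>span (\<Union>?\<C>). \<mu> u = 0" "\<mu> 1 = 1"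
    by (rule exists_functional_separating[OF subspace_span])
  let ?I = "\<lambda>x. sw (\<lambda>a b. scale (\<mu> b) a) x"
  have bil: "bilin (\<lambda>a b. scale (\<mu> b) a)"
    by (intro bilinI lin_intros \<mu>(1))
  have "?I x = scale (\<mu> x) 1" if "x \<in> coradical" for x
    using that unfolding coradical_def
  proof (induction rule: span_induct_alt)
    case base
    then show ?case by (simp add: lin_zero[OF lin_sw[OF bil]] functional_zero[OF \<mu>(1)])
  next
    case (step c x y)
    then obtain C where C: "simple_subcoalgebra C" "x \<in> C" by blast
    have "?I x = scale (\<mu> x) 1"
    proof (cases "1 \<in> C")
      case True
      then have "span {1} \<subseteq> C"
        using C(1) by (intro span_minimal) (auto simp: simple_subcoalgebra_def subcoalgebra_def)
      moreover have "span {1 :: 'h} \<noteq> {0}"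
        using span_base[of "1 :: 'h" "{1}"] by auto
      ultimately have "C = span {1}"
        using C(1) subcoalgebra_span_one by (auto simp: simple_subcoalgebra_def)
      then obtain k where "x = scale k 1"
        using C(2) by (auto simp: span_singleton)
      then show ?thesis
        by (simp add: sw_scale_arg[OF bil] sw_one[OF bil] \<mu>(3) functional_scale[OF \<mu>(1)])
    next
      case False
      have CE: "C \<subseteq> span (\<Union>?\<C>)"
        using False C(1) by (intro order_trans[OF Union_upper span_superset]) auto
      have "?I x = 0"
        by (rule sw_subcoalgebra_zero[OF _ C(2) bil])
          (use C(1) CE \<mu>(2) in \<open>auto simp: simple_subcoalgebra_def\<close>)
      moreover have "\<mu> x = 0"
        using CE C(2) \<mu>(2) by blast
      ultimately show ?thesis by simp
    qed
    with step show ?case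
      by (simp add: sw_add_arg[OF bil] sw_scale_arg[OF bil] functional_add[OF \<mu>(1)]
          functional_scale[OF \<mu>(1)] scale_left_distrib)
  qed
  then show thesis
    by (intro that[OF \<mu>(1,3)] ballI)
qed

end

sublocale finite_dim_hopf_algebra \<subseteq> finite_dim_coalgebra
  by unfold_locales (rule finite_dim)

context finite_dim_hopf_algebra
begin

text \<open>
  Let \<open>\<mu>\<close> be the integral. Expanding \<open>\<mu>(x\<^sub>2 y)\<close> by invariance gives the exchange rule
  \<open>\<Sum> y\<^sub>1 \<mu>(x y\<^sub>2) = \<Sum> S(x\<^sub>1) \<mu>(x\<^sub>2 y)\<close> on \<open>A\<close>. Let \<open>N\<close> be the right radical of the form \<open>\<mu>(x y)\<close> on \<open>A\<close>. The
  rule shows that \<open>N\<close> is a left coideal, so that \<open>\<epsilon>(y) = \<epsilon>(y) \<mu>(1) = \<Sum> \<mu>(S(y\<^sub>1) y\<^sub>2) = 0\<close> for \<open>y\<close> in \<open>N\<close>. If now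
  \<open>\<phi>\<close> annihilates \<open>S(H)\<close> and \<open>y\<close> is in \<open>A\<close>, the rule also shows that \<open>z = \<Sum> \<phi>(y\<^sub>1) y\<^sub>2\<close> is in \<open>N\<close>, whence
  \<open>\<phi>(y) = \<epsilon>(z) = 0\<close>.
\<close>

lemma coradical_subset_range_antipode:
  assumes "hopf_subalgebra coradical"
  shows "coradical \<subseteq> range S"
proof
  let ?A = "coradical"
  note A = hopf_subalgebraD[OF assms]
  have lc: "left_coideal ?A"
    by (rule left_coideal_subcoalgebra[OF A(1)])
  obtain \<mu> where \<mu>: "functional \<mu>" "\<mu> 1 = 1" "\<forall>x\<in>?A. sw (\<lambda>a b. scale (\<mu> b) a) x = scale (\<mu> x) 1"
    by (rule exists_coradical_integral)
  have \<mu>_right: "functional (\<lambda>y. \<mu> (x * y))" for x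
    by (rule functional_compose[OF \<mu>(1)]) (intro lin_intros)
  note lin = lin_intros functional_compose[OF \<mu>(1)]
  have exchange: "rslice (\<lambda>b. \<mu> (x * b)) y = sw (\<lambda>a b. scale (\<mu> (b * y)) (S a)) x"
    if x: "x \<in> ?A" and y: "y \<in> ?A" for x y
  proof -
    let ?T = "\<lambda>a u v c d. scale (\<mu> (v * d)) (S a * (u * c))"
    have bil: "bilin (\<lambda>s t. scale (\<mu> t) (S a * s))" for a
      by (intro bilinI lin)
    have "sw (\<lambda>a b. scale (\<mu> (b * y)) (S a)) x = sw (\<lambda>a b. sw (\<lambda>s t. scale (\<mu> t) (S a * s)) (b * y)) x"
    proof (rule sw_subcoalgebra_cong[OF A(1) x])
      show "bilin (\<lambda>a b. scale (\<mu> (b * y)) (S a))"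
        by (intro bilinI lin)
      show "bilin (\<lambda>a b. sw (\<lambda>s t. scale (\<mu> t) (S a * s)) (b * y))"
        by (intro bilinI lin)
      fix a b assume "a \<in> ?A" "b \<in> ?A"
      have "sw (\<lambda>s t. scale (\<mu> t) (S a * s)) (b * y) = S a * sw (\<lambda>s t. scale (\<mu> t) s) (b * y)"
        by (subst lin_apply_sw) (intro lin, simp add: scale_mult_right)
      also have "\<dots> = scale (\<mu> (b * y)) (S a)"
        using \<mu>(3) A(4)[OF \<open>b \<in> ?A\<close> y] by (simp add: scale_mult_right)
      finally show "scale (\<mu> (b * y)) (S a) = sw (\<lambda>s t. scale (\<mu> t) (S a * s)) (b * y)" ..
    qed
    also have "\<dots> = sw (\<lambda>a b. sw (\<lambda>u v. sw (\<lambda>c d. ?T a u v c d) y) b) x"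
      by (simp add: sw_times[OF bil])
    also have "\<dots> = sw (\<lambda>w v. sw (\<lambda>a u. sw (\<lambda>c d. ?T a u v c d) y) w) x"
      by (rule sw_coassoc[symmetric]) (intro lin)+
    also have "\<dots> = sw (\<lambda>w v. sw (\<lambda>c d. sw (\<lambda>a u. scale (\<mu> (v * d)) ((S a * u) * c)) w) y) x"
      by (subst sw_swap) (simp add: mult.assoc)
    also have "\<dots> = sw (\<lambda>w v. sw (\<lambda>c d. scale (\<epsilon> w) (scale (\<mu> (v * d)) (1 * c))) y) x"
      by (subst sw_antipode_left) (intro lin, simp)
    also have "\<dots> = sw (\<lambda>w v. scale (\<epsilon> w) (sw (\<lambda>c d. scale (\<mu> (v * d)) (1 * c)) y)) x"
      by (simp only: sw_scale)
    also have "\<dots> = sw (\<lambda>c d. scale (\<mu> (x * d)) (1 * c)) y"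
      by (rule sw_counit_left) (intro lin)
    finally show ?thesis
      by (simp add: rslice_def)
  qed
  define N where "N = {y \<in> ?A. \<forall>x\<in>?A. \<mu> (x * y) = 0}"
  have N_counit: "\<epsilon> y = 0" if y: "y \<in> N" for y
  proof -
    have yA: "y \<in> ?A" using y by (simp add: N_def)
    obtain r where r: "lin r" "\<forall>u\<in>?A. r u = 0" "\<forall>x. x - r x \<in> ?A"
      by (rule exists_linear_with_kernel[OF A(2)])
    note lin = lin lin_compose[OF r(1)]
    have "sw (\<lambda>a b. scale (\<mu> (S (a - r a) * b)) 1) y = 0"
    proof (rule sw_eq_0_if_right_slices)
      show "bilin (\<lambda>a b. scale (\<mu> (S (a - r a) * b)) 1)"
        by (intro bilinI lin)
      show "scale (\<mu> (S (a - r a) * v)) 1 = 0" if "v \<in> N" for a v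
        using that A(5)[OF r(3)[rule_format, of a]] by (simp add: N_def)
      fix \<phi> assume \<phi>: "functional \<phi>"
      have "\<mu> (x * lslice \<phi> y) = 0" if x: "x \<in> ?A" for x
      proof -
        have "\<mu> (x * lslice \<phi> y) = \<phi> (rslice (\<lambda>b. \<mu> (x * b)) y)"
          by (rule functional_rslice[symmetric, OF \<phi> \<mu>_right])
        also have "rslice (\<lambda>b. \<mu> (x * b)) y = 0"
          unfolding exchange[OF x yA]
          by (rule sw_subcoalgebra_zero[OF A(1) x]) (intro bilinI lin, use y in \<open>simp add: N_def\<close>)
        finally show ?thesis
          by (simp add: functional_zero[OF \<phi>])
      qed
      then show "sw (\<lambda>a b. scale (\<phi> a) b) y \<in> N"
        using left_coideal_slice[OF lc \<phi> yA] by (simp add: N_def lslice_def)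
    qed
    moreover have "sw (\<lambda>a b. scale (\<mu> (S (a - r a) * b)) 1) y = sw (\<lambda>a b. scale (\<mu> (S a * b)) 1) y"
    proof (rule sw_subcoalgebra_cong[OF A(1) yA])
      show "bilin (\<lambda>a b. scale (\<mu> (S (a - r a) * b)) 1)" "bilin (\<lambda>a b. scale (\<mu> (S a * b)) 1)"
        by (intro bilinI lin)+
    qed (simp add: r(2))
    moreover have "sw (\<lambda>a b. scale (\<mu> (S a * b)) 1) y = scale (\<epsilon> y) (scale (\<mu> 1) 1)"
      by (rule sw_antipode_left) (intro lin)
    ultimately show ?thesis
      by (simp add: \<mu>(2))
  qed
  fix y assume y: "y \<in> ?A"
  show "y \<in> range S"
  proof (rule mem_if_annihilators_vanish)
    show "subspace (range S)"
      by (rule hopf_subalgebraD(2)[OF hopf_subalgebra_range_antipode])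
    fix \<phi> assume "annihilates \<phi> (range S)"
    then have \<phi>: "functional \<phi>" "\<And>x. \<phi> (S x) = 0"
      by (auto simp: annihilates_def)
    have "\<mu> (x * lslice \<phi> y) = 0" if x: "x \<in> ?A" for x
    proof -
      have "\<mu> (x * lslice \<phi> y) = \<phi> (rslice (\<lambda>b. \<mu> (x * b)) y)"
        by (rule functional_rslice[symmetric, OF \<phi>(1) \<mu>_right])
      also have "rslice (\<lambda>b. \<mu> (x * b)) y \<in> range S"
        unfolding exchange[OF x y]
        by (rule sw_mem_subspace)
          (auto simp: hopf_subalgebraD(2)[OF hopf_subalgebra_range_antipode] lin_scale[OF antipode_linear, symmetric])
      then have "\<phi> (rslice (\<lambda>b. \<mu> (x * b)) y) = 0"
        using \<phi>(2) by auto
      finally show ?thesis .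
    qed
    then have "lslice \<phi> y \<in> N"
      using left_coideal_slice[OF lc \<phi>(1) y] by (simp add: N_def)
    then have "\<epsilon> (lslice \<phi> y) = 0"
      by (rule N_counit)
    then show "\<phi> y = 0"
      using functional_rslice[OF \<phi>(1) counit_functional, of y] by (simp add: rslice_counit)
  qed
qed

theorem bij_antipode:
  assumes "hopf_subalgebra coradical"
  shows "bij S"
proof -
  have "coradical_filtration n \<subseteq> range S" for n
  proof (induction n)
    case 0
    then show ?case
      using coradical_subset_range_antipode[OF assms] by simp
  next
    case (Suc n)
    have "wedge coradical (coradical_filtration n) \<subseteq> wedge (range S) (range S)"
      by (rule wedge_mono[OF coradical_subset_range_antipode[OF assms] Suc])
    then show ?case
      using wedge_range_antipode coradical_filtration_Suc by blast
  qed
  then have "surj S"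
    using filtration_exhausts by (metis top.extremum_uniqueI)
  obtain E where "finite_dimensional_vector_space scale E"
    by (rule finite_dim_basis)
  then interpret fd: finite_dimensional_vector_space scale E .
  show ?thesis
    using fd.linear_surj_imp_inj[OF antipode_linear \<open>surj S\<close>] \<open>surj S\<close> by (simp add: bij_def)
qed

end

section \<open>Convolution and the exponent\<close>

context coalgebra
begin

lemma homogeneous_comult_iter: "homogeneous (Suc n) (tensor_rep (comult_iter (Suc n) x))"
proof (induction n)
  case 0
  show ?case
    using homogeneous_tensor_rep[of 1 "word [x]"] by (simp add: homogeneous_word)
next
  case (Suc n)
  have "homogeneous (0 + (2 + n)) (juxt (word (take 0 w)) (juxt (tensor_rep (\<Delta> (w ! 0))) (word (drop (0 + 1) w))))"
    if "w \<in> Poly_Mapping.keys (tensor_rep (comult_iter (Suc n) x))" for w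
    using Suc that
    by (intro homogeneous_juxt homogeneous_comult) (auto simp: homogeneous_word homogeneous_def[of _ "tensor_rep _"])
  then have "homogeneous (Suc n + 1) (lin_ext free_scale
      (\<lambda>w. juxt (word (take 0 w)) (juxt (tensor_rep (\<Delta> (w ! 0))) (word (drop (0 + 1) w))))
      (tensor_rep (comult_iter (Suc n) x)))"
    by (intro homogeneous_lin_ext) simp
  from homogeneous_tensor_rep[OF this] show ?case
    unfolding comult_iter.simps comult_at_def tensor_map_def by simp
qed

end

context hopf_algebra
begin

definition conv :: "('h \<Rightarrow> 'h) \<Rightarrow> ('h \<Rightarrow> 'h) \<Rightarrow> 'h \<Rightarrow> 'h" where
  "conv f g = sw (\<lambda>a b. f a * g b)"

lemma lin_conv: "lin f \<Longrightarrow> lin g \<Longrightarrow> lin (conv f g)"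
  unfolding conv_def by (intro lin_sw bilinI lin_intros)

lemma lin_prod_list_map2:
  assumes "\<And>f. f \<in> set fs \<Longrightarrow> lin f" "length us + 1 + length vs = length fs"
  shows "lin (\<lambda>x. prod_list (map2 (\<lambda>f x. f x) fs (us @ x # vs)))"
  using assms
proof (induction us arbitrary: fs)
  case Nil
  then obtain f fs' where "fs = f # fs'" by (cases fs) auto
  with Nil show ?case by (auto intro!: lin_intros)
next
  case (Cons u us)
  then obtain f fs' where "fs = f # fs'" by (cases fs) auto
  with Cons show ?case by (auto intro!: lin_intros)
qed

lemma multilinear_prod_list_map2:
  "(\<And>f. f \<in> set fs \<Longrightarrow> lin f) \<Longrightarrow> length fs = n \<Longrightarrow>
    multilinear scale scale n (\<lambda>xs. prod_list (map2 (\<lambda>f x. f x) fs xs))"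
  unfolding multilinear_def using lin_prod_list_map2 by auto

text \<open>
  The iterated comultiplication always splits the first tensor factor. Each step therefore merges the
  first two maps into their convolution product.
\<close>

lemma tensor_lift_comult_iter:
  assumes "lin f" "\<And>g. g \<in> set fs \<Longrightarrow> lin g"
  shows "tensor_lift scale (\<lambda>xs. prod_list (map2 (\<lambda>f x. f x) (f # fs) xs)) (comult_iter (Suc (length fs)) x)
    = foldl conv f fs x"
  using assms
proof (induction fs arbitrary: f)
  case Nil
  have "tensor_lift scale (\<lambda>xs. prod_list (map2 (\<lambda>f x. f x) [f] xs)) (tensor_class scale 1 (word [x])) = f x"
    using Nil by (subst tensor_lift_class) (auto intro!: multilinear_prod_list_map2)
  then show ?case by simp
next
  case (Cons g fs)
  let ?G = "\<lambda>xs. prod_list (map2 (\<lambda>f x. f x) (f # g # fs) xs)"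
  let ?n = "Suc (length fs)"
  have m: "multilinear scale scale (?n + 1) ?G"
    using Cons.prems by (intro multilinear_prod_list_map2) auto
  have "tensor_lift scale ?G (comult_iter (Suc (length (g # fs))) x) =
    tensor_lift scale (\<lambda>xs. tensor_lift scale (\<lambda>ys. ?G (take 0 xs @ ys @ drop (0 + 1) xs)) (\<Delta> (xs ! 0)))
      (comult_iter ?n x)"
    unfolding length_Cons comult_iter.simps by (rule tensor_lift_comult_at[OF m])
  also have "\<dots> = tensor_lift scale (\<lambda>xs. prod_list (map2 (\<lambda>f x. f x) (conv f g # fs) xs)) (comult_iter ?n x)"
  proof (rule tensor_lift_cong[OF homogeneous_comult_iter])
    fix xs :: "'h list" assume "length xs = Suc (length fs)"
    then obtain h t where xs: "xs = h # t" by (cases xs) auto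
    have "tensor_lift scale (\<lambda>ys. ?G (ys @ t)) (\<Delta> h) =
        sw (\<lambda>a b. (f a * g b) * prod_list (map2 (\<lambda>f x. f x) fs t)) h"
      by (rule tensor_lift_comult) (simp add: mult.assoc)
    also have "\<dots> = conv f g h * prod_list (map2 (\<lambda>f x. f x) fs t)"
      unfolding conv_def by (subst lin_apply_sw[of "\<lambda>z. z * c" for c]) (intro lin_intros, simp)
    finally show "tensor_lift scale (\<lambda>ys. ?G (take 0 xs @ ys @ drop (0 + 1) xs)) (\<Delta> (xs ! 0)) =
        prod_list (map2 (\<lambda>f x. f x) (conv f g # fs) xs)"
      by (simp add: xs)
  qed
  also have "\<dots> = foldl conv (conv f g) fs x"
    using Cons.prems by (intro Cons.IH lin_conv) auto
  finally show ?case by simp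
qed

text \<open>
  The product starts with the unit of the convolution algebra, so that the recursion also covers the
  empty product. For \<open>n \<ge> 1\<close> this is the map in the definition of the exponent.
\<close>

definition antipode_product :: "nat \<Rightarrow> 'h \<Rightarrow> 'h" where
  "antipode_product n = foldl conv (\<lambda>x. scale (\<epsilon> x) 1) (map (\<lambda>i. inv S ^^ (2 * i)) [0..<n])"

lemma antipode_product_0: "antipode_product 0 x = scale (\<epsilon> x) 1"
  by (simp add: antipode_product_def)

lemma antipode_product_Suc:
  "antipode_product (Suc n) = conv (antipode_product n) (inv S ^^ (2 * n))"
  by (simp add: antipode_product_def)

lemma conv_counit_left: "lin f \<Longrightarrow> conv (\<lambda>x. scale (\<epsilon> x) 1) f = f"
  by (rule ext) (simp add: conv_def scale_mult_left sw_counit_left)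

lemma exponent_condition:
  assumes "lin (inv S)" "1 \<le> n"
  shows "tensor_lift scale prod_list
      (tensor_funs scale (map (\<lambda>i. inv S ^^ (2 * i)) [0..<n]) (comult_iter n x)) = antipode_product n x"
proof -
  let ?fs = "map (\<lambda>i. inv S ^^ (2 * i)) [1..<n]"
  have fs: "map (\<lambda>i. inv S ^^ (2 * i)) [0..<n] = (\<lambda>x. x) # ?fs"
    using assms(2) by (simp add: upt_conv_Cons id_def)
  have lin: "\<And>g. g \<in> set ?fs \<Longrightarrow> lin g"
    using lin_funpow[OF assms(1)] by auto
  have n: "n = Suc (length ?fs)"
    using assms(2) by simp
  have "tensor_lift scale prod_list (tensor_funs scale ((\<lambda>x. x) # ?fs) (comult_iter n x)) =
      tensor_lift scale (\<lambda>xs. prod_list (map2 (\<lambda>f x. f x) ((\<lambda>x. x) # ?fs) xs)) (comult_iter n x)"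
    by (rule tensor_lift_funs[OF multilinear_prod_list])
  also have "\<dots> = foldl conv (\<lambda>x. x) ?fs x"
  proof -
    have "comult_iter n x = comult_iter (Suc (length ?fs)) x"
      by (rule arg_cong[OF n])
    then show ?thesis
      by (simp only: tensor_lift_comult_iter[OF lin_ident lin])
  qed
  also have "\<dots> = antipode_product n x"
    unfolding antipode_product_def fs by (simp add: conv_counit_left lin_ident)
  finally show ?thesis
    by (simp add: fs)
qed

lemma Inf_enat_eqD:
  assumes "Inf (enat ` K) = enat n"
  shows "n \<in> K"
proof -
  have ne: "enat ` K \<noteq> {}"
    using assms by (auto simp: Inf_enat_def)
  then have "(LEAST x. x \<in> enat ` K) \<in> enat ` K"
    by (auto intro: LeastI)
  with assms ne show ?thesis
    by (auto simp: Inf_enat_def)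
qed

lemma exponentD:
  assumes "exponent A = enat n" "lin (inv S)" "x \<in> A"
  shows "antipode_product n x = scale (\<epsilon> x) 1"
  using Inf_enat_eqD[OF assms(1)[unfolded exponent_def]] exponent_condition[OF assms(2)] assms(3)
  by auto

section \<open>Powers of the squared antipode as adjoint actions\<close>

text \<open>
  The right adjoint action of \<open>a\<close> on \<open>x\<close>.
\<close>

definition adj :: "'h \<Rightarrow> 'h \<Rightarrow> 'h" where
  "adj x a = sw (\<lambda>s t. S s * x * t) a"

lemma lin_adj_left: "lin f \<Longrightarrow> lin (\<lambda>x. adj (f x) a)"
  unfolding adj_def by (intro lin_intros)

lemma lin_adj_right: "lin f \<Longrightarrow> lin (\<lambda>a. adj x (f a))"
  unfolding adj_def by (intro lin_intros)

lemma adj_times: "adj x (a * b) = adj (adj x a) b"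
proof -
  have "adj x (a * b) = sw (\<lambda>u v. sw (\<lambda>s t. S (u * s) * x * (v * t)) b) a"
    unfolding adj_def by (rule sw_times) (intro bilinI lin_intros)
  also have "\<dots> = sw (\<lambda>s t. sw (\<lambda>u v. S s * (S u * x * v) * t) a) b"
    by (subst sw_swap) (simp add: antipode_times mult.assoc)
  also have "\<dots> = adj (adj x a) b"
  proof -
    have "sw (\<lambda>u v. S s * (S u * x * v) * t) a = S s * adj x a * t" for s t
      unfolding adj_def
      by (rule lin_apply_sw[of "\<lambda>z. S s * z * t", symmetric]) (intro lin_intros)
    then show ?thesis
      by (simp add: adj_def[of "adj x a"])
  qed
  finally show ?thesis .
qed

lemma adj_one_left: "adj 1 a = scale (\<epsilon> a) 1"
  using sw_antipode_left[OF lin_ident, of a] by (simp add: adj_def)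

lemma adj_one_right: "adj x 1 = x"
  unfolding adj_def by (subst sw_one) (intro bilinI lin_intros, simp add: antipode_one)

context
  assumes bij: "bij S"
begin

abbreviation Q :: "'h \<Rightarrow> 'h" where
  "Q \<equiv> inv S"

lemma S_Q [simp]: "S (Q x) = x"
  using bij by (simp add: bij_def surj_f_inv_f)

lemma Q_S [simp]: "Q (S x) = x"
  using bij by (simp add: bij_def)

lemma Q_eqI: "S y = x \<Longrightarrow> Q x = y"
  by auto

lemma lin_Q: "lin Q"
  unfolding lin_iff
  by (auto intro!: Q_eqI simp: lin_add[OF antipode_linear] lin_scale[OF antipode_linear])

lemma Q_times: "Q (x * y) = Q y * Q x"
  by (rule Q_eqI) (simp add: antipode_times)

lemma Q_one: "Q 1 = 1"
  by (rule Q_eqI) (rule antipode_one)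

lemma counit_Q: "\<epsilon> (Q x) = \<epsilon> x"
  using counit_antipode[of "Q x"] by simp

lemma sw_Q:
  assumes F: "bilin F"
  shows "sw F (Q x) = sw (\<lambda>a b. F (Q b) (Q a)) x"
proof -
  have "sw (\<lambda>a b. F (Q b) (Q a)) (S (Q x)) = sw (\<lambda>a b. F (Q (S a)) (Q (S b))) (Q x)"
    by (rule sw_antipode) (intro bilinI bilin_compose1[OF F] bilin_compose2[OF F] lin_Q)
  then show ?thesis by simp
qed

lemmas lin_Q_intros = lin_intros lin_compose[OF lin_Q] lin_compose[OF lin_funpow[OF lin_Q]]
  lin_adj_left lin_adj_right

lemma sw_Q_Q:
  assumes F: "bilin F"
  shows "sw F (Q (Q x)) = sw (\<lambda>a b. F (Q (Q a)) (Q (Q b))) x"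
proof -
  have "bilin (\<lambda>a b. F (Q b) (Q a))"
    by (intro bilinI bilin_compose1[OF F] bilin_compose2[OF F] lin_Q)
  then show ?thesis
    by (simp add: sw_Q F)
qed

lemma Q_Q_adj: "Q (Q (adj x a)) = adj (Q (Q x)) (Q (Q a))"
proof -
  have "Q (Q (adj x a)) = sw (\<lambda>s t. Q (Q (S s * x * t))) a"
    unfolding adj_def by (rule lin_apply_sw[of "\<lambda>z. Q (Q z)"]) (intro lin_Q_intros)
  also have "\<dots> = adj (Q (Q x)) (Q (Q a))"
    unfolding adj_def by (subst sw_Q_Q) (intro bilinI lin_Q_intros, simp add: Q_times)
  finally show ?thesis .
qed

lemma funpow_Q_Suc: "(Q ^^ (2 * Suc n)) x = (Q ^^ (2 * n)) (Q (Q x))"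
  by (simp add: funpow_swap1)

lemma funpow_Q_adj: "(Q ^^ (2 * n)) (adj x a) = adj ((Q ^^ (2 * n)) x) ((Q ^^ (2 * n)) a)"
  by (induction n) (simp_all add: Q_Q_adj)

lemma funpow_Q_times: "(Q ^^ (2 * n)) (x * y) = (Q ^^ (2 * n)) x * (Q ^^ (2 * n)) y"
  by (induction n) (simp_all add: Q_times)

lemma counit_funpow_Q: "\<epsilon> ((Q ^^ n) x) = \<epsilon> x"
  by (induction n) (simp_all add: counit_Q)

text \<open>
  The right-hand side is \<open>\<Sum> S\<^sup>-\<^sup>1(y\<^sub>2) y\<^sub>1 S\<^sup>-\<^sup>2(y\<^sub>3)\<close>, and \<open>\<Sum> S\<^sup>-\<^sup>1(y\<^sub>2) y\<^sub>1 = \<epsilon>(y)\<close>.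
\<close>

lemma Q_Q_eq_adj: "Q (Q y) = sw (\<lambda>a b. adj a (Q (Q b))) y"
proof -
  have "sw (\<lambda>a b. adj a (Q (Q b))) y = sw (\<lambda>a b. sw (\<lambda>s t. Q s * a * Q (Q t)) b) y"
    unfolding adj_def by (subst sw_Q_Q) (intro bilinI lin_Q_intros, simp)
  also have "\<dots> = sw (\<lambda>w t. sw (\<lambda>a s. Q s * a * Q (Q t)) w) y"
    by (rule sw_coassoc[symmetric]) (intro lin_Q_intros)+
  also have "\<dots> = sw (\<lambda>w t. sw (\<lambda>a s. Q (S a * s) * Q (Q t)) w) y"
    by (simp add: Q_times)
  also have "\<dots> = sw (\<lambda>w t. scale (\<epsilon> w) (Q 1 * Q (Q t))) y"
    by (subst sw_antipode_left[of "\<lambda>z. Q z * Q (Q t)" for t]) (intro lin_Q_intros, simp)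
  also have "\<dots> = Q 1 * Q (Q y)"
    by (rule sw_counit_left) (intro lin_Q_intros)
  finally show ?thesis
    by (simp add: Q_one)
qed

lemma lin_antipode_product: "lin (antipode_product n)"
proof (induction n)
  case 0
  have "lin (\<lambda>x. scale (\<epsilon> x) 1)" by (intro lin_intros)
  then show ?case by (simp add: antipode_product_def)
next
  case (Suc n)
  then show ?case
    unfolding antipode_product_Suc by (intro lin_conv lin_funpow lin_Q)
qed

lemma counit_antipode_product: "\<epsilon> (antipode_product n x) = \<epsilon> x"
proof (induction n arbitrary: x)
  case 0
  show ?case
    by (simp add: antipode_product_0 functional_scale[OF counit_functional] counit_one)
next
  case (Suc n)
  have "scale (\<epsilon> (antipode_product (Suc n) x)) 1 = sw (\<lambda>a b. scale (\<epsilon> a) (scale (\<epsilon> b) 1)) x"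
    unfolding antipode_product_Suc conv_def
    by (simp add: scale_functional_sw[OF counit_functional] counit_mult counit_funpow_Q Suc)
  also have "\<dots> = scale (\<epsilon> x) 1"
    by (rule sw_counit_left) (intro lin_intros)
  finally show ?case by simp
qed

lemma Q_Q_antipode_product_Suc:
  "Q (Q (antipode_product (Suc n) x)) = sw (\<lambda>a b. Q (Q (antipode_product n a)) * (Q ^^ (2 * Suc n)) b) x"
  unfolding antipode_product_Suc conv_def
  by (subst lin_apply_sw[OF lin_compose[OF lin_Q lin_Q]]) (simp add: Q_times)

text \<open>
  Each application of \<open>S\<^sup>-\<^sup>2\<close> acts by one more factor from the right, which matches the recursion of
  the convolution product: with \<open>T = S\<^sup>-\<^sup>2\<^sup>n\<close>,
  \<open>T(S\<^sup>-\<^sup>2(y)) = \<Sum> T(y\<^sub>1) \<triangleleft> T(S\<^sup>-\<^sup>2(y\<^sub>2)) = \<Sum> (y\<^sub>1 \<triangleleft> S\<^sup>-\<^sup>2(P\<^sub>n(y\<^sub>2))) \<triangleleft> S\<^sup>-\<^sup>2\<^sup>n\<^sup>-\<^sup>2(y\<^sub>3)\<close>.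
\<close>

lemma funpow_Q_eq_adj:
  "(Q ^^ (2 * n)) y = sw (\<lambda>a b. adj a (Q (Q (antipode_product n b)))) y"
proof (induction n arbitrary: y)
  case 0
  have "sw (\<lambda>a b. adj a (Q (Q (antipode_product 0 b)))) y = sw (\<lambda>a b. scale (\<epsilon> b) a) y"
    by (simp add: antipode_product_0 lin_scale[OF lin_Q] Q_one
        lin_scale[OF lin_adj_right[OF lin_ident]] adj_one_right)
  then show ?case
    by (simp add: sw_counit_right[OF lin_ident])
next
  case (Suc n)
  note lin = lin_Q_intros lin_compose[OF lin_antipode_product]
  let ?R = "\<lambda>b. Q (Q (antipode_product n b))" and ?T = "Q ^^ (2 * n)" and ?T' = "Q ^^ (2 * Suc n)"
  have "sw (\<lambda>a b. adj a (Q (Q (antipode_product (Suc n) b)))) y =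
      sw (\<lambda>a b. sw (\<lambda>u v. adj (adj a (?R u)) (?T' v)) b) y"
    unfolding Q_Q_antipode_product_Suc adj_times[symmetric]
    by (subst lin_apply_sw[OF lin_adj_right[OF lin_ident]]) simp
  also have "\<dots> = sw (\<lambda>w v. sw (\<lambda>a u. adj (adj a (?R u)) (?T' v)) w) y"
    by (rule sw_coassoc[symmetric]) (intro lin)+
  also have "\<dots> = sw (\<lambda>w v. adj (?T w) (?T' v)) y"
    by (simp only: Suc lin_apply_sw[OF lin_adj_left[OF lin_ident]])
  also have "\<dots> = sw (\<lambda>w v. ?T (adj w (Q (Q v)))) y"
    by (simp only: funpow_Q_adj funpow_Q_Suc)
  also have "\<dots> = ?T (sw (\<lambda>w v. adj w (Q (Q v))) y)"
    by (rule lin_apply_sw[OF lin_funpow[OF lin_Q], symmetric])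
  also have "\<dots> = ?T' y"
    by (simp only: Q_Q_eq_adj[symmetric] funpow_Q_Suc)
  finally show ?case ..
qed

text \<open>
  Here \<open>S\<^sup>-\<^sup>2\<^sup>n(y) - y = \<Sum> y\<^sub>1 \<triangleleft> f(y\<^sub>2)\<close> with \<open>f = S\<^sup>-\<^sup>2 P\<^sub>n - \<epsilon>\<close> vanishing on \<open>A\<close>. Moreover
  \<open>1 \<triangleleft> f(y) = \<epsilon>(f(y)) = 0\<close>, so the transfer lemma applies with \<open>D = S\<^sup>-\<^sup>2\<^sup>n - id\<close>, \<open>L = id\<close> and \<open>L' = D\<close>; the last
  two are compatible since \<open>S\<^sup>-\<^sup>2\<^sup>n\<close> is multiplicative and fixes \<open>A\<close>.
\<close>

lemma funpow_Q_eq_id_on_wedge: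
  assumes A: "hopf_subalgebra A" and P: "\<And>a. a \<in> A \<Longrightarrow> antipode_product n a = scale (\<epsilon> a) 1"
    and x: "x \<in> wedge A A"
  shows "(Q ^^ (2 * n)) x = x"
proof -
  note A' = hopf_subalgebraD[OF A]
  note lin = lin_Q_intros lin_compose[OF lin_antipode_product]
  let ?T = "Q ^^ (2 * n)"
  define f where "f v = Q (Q (antipode_product n v)) - scale (\<epsilon> v) 1" for v
  define F where "F u v = adj u (f v)" for u v
  have f: "lin f"
    unfolding f_def by (intro lin)
  have F: "bilin F"
    unfolding F_def by (intro bilinI lin lin_compose[OF f])
  have f_A: "f a = 0" if "a \<in> A" for a
    by (simp add: f_def P[OF that] lin_scale[OF lin_Q] Q_one)
  have F_A: "F a b = 0" if "b \<in> A" for a b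
    by (simp add: F_def f_A[OF that] lin_zero[OF lin_adj_right[OF lin_ident]])
  have F_one: "F 1 b = 0" for b
    by (simp add: F_def f_def adj_one_left functional_diff[OF counit_functional]
        functional_scale[OF counit_functional] counit_Q counit_antipode_product counit_one)
  have swF: "sw F y = ?T y - y" for y
  proof -
    have "sw F y = sw (\<lambda>u v. adj u (Q (Q (antipode_product n v)))) y - sw (\<lambda>u v. scale (\<epsilon> v) u) y"
      unfolding F_def f_def sw_diff[symmetric]
      by (simp add: lin_diff[OF lin_adj_right[OF lin_ident]] lin_scale[OF lin_adj_right[OF lin_ident]] adj_one_right)
    then show ?thesis
      by (simp only: funpow_Q_eq_adj[symmetric] sw_counit_right[OF lin_ident])
  qed
  have T_A: "?T a = a" if "a \<in> A" for a
    using sw_subcoalgebra_zero[OF A'(1) that F F_A] swF[of a] by simp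
  obtain r where r: "lin r" "\<forall>u\<in>A. r u = 0" "\<forall>y. y - r y \<in> A"
    by (rule exists_linear_with_kernel[OF A'(2)])
  have "?T (r x) - r x = 0"
  proof (rule wedge_square_transfer[OF A x r(1) _ _ F F_A F_one lin_ident])
    show "r u = 0" if "u \<in> A" for u using r(2) that by blast
    show "y - r y \<in> A" for y using r(3) by blast
    show "lin (\<lambda>y. ?T y - y)" by (intro lin)
    show "b * sw F y = ?T (b * y) - b * y" if "b \<in> A" for b y
      by (simp only: swF funpow_Q_times T_A[OF that] right_diff_distrib)
  qed
  moreover have "?T (x - r x) = x - r x"
    using T_A r(3) by blast
  ultimately show ?thesis
    by (simp add: lin_diff[OF lin_funpow[OF lin_Q]])
qed

lemma funpow_S_Q: "(S ^^ n) ((Q ^^ n) x) = x"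
  by (induction n arbitrary: x) (simp_all add: funpow_swap1)

end

lemma sw_funpow_antipode:
  assumes "bilin F"
  shows "sw F ((S ^^ (2 * n)) x) = sw (\<lambda>a b. F ((S ^^ (2 * n)) a) ((S ^^ (2 * n)) b)) x"
  using assms
proof (induction n arbitrary: F)
  case (Suc n)
  note lin = bilin_compose1[OF Suc.prems] bilin_compose2[OF Suc.prems] lin_intros
  have "sw F ((S ^^ (2 * Suc n)) x) = sw F (S (S ((S ^^ (2 * n)) x)))"
    by simp
  also have "\<dots> = sw (\<lambda>a b. F (S b) (S a)) (S ((S ^^ (2 * n)) x))"
    by (rule sw_antipode[OF Suc.prems])
  also have "\<dots> = sw (\<lambda>a b. F (S (S a)) (S (S b))) ((S ^^ (2 * n)) x)"
    by (rule sw_antipode) (intro bilinI lin)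
  also have "\<dots> = sw (\<lambda>a b. F (S (S ((S ^^ (2 * n)) a))) (S (S ((S ^^ (2 * n)) b)))) x"
    by (rule Suc.IH) (intro bilinI lin)
  finally show ?case by simp
qed simp

end

theorem theorem3p1:
  fixes scale :: "'k::field \<Rightarrow> 'h::ring_1 \<Rightarrow> 'h"
    and \<Delta> :: "'h \<Rightarrow> ('h, 'k) tensor"
    and \<epsilon> :: "'h \<Rightarrow> 'k"
    and S :: "'h \<Rightarrow> 'h"
    and N L :: nat
  assumes "finite_dim_hopf_algebra scale \<Delta> \<epsilon> S"
    and "hopf_algebra.dual_chevalley scale \<Delta> S"
    and "hopf_algebra.exponent scale \<Delta> \<epsilon> S (coalgebra.coradical scale \<Delta>) = enat N"
    and "L = coalgebra.loewy_length scale \<Delta>"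
    and "2 \<le> L"
  shows "(\<lambda>x. (S ^^ (2 * N)) x - x) ^^ (L - 1) = (\<lambda>x. 0)"
proof
  fix x
  interpret finite_dim_hopf_algebra scale \<Delta> \<epsilon> S
    by (rule assms(1))
  have A: "hopf_subalgebra coradical"
    using assms(2) by (simp add: dual_chevalley_def)
  have bij: "bij S"
    by (rule bij_antipode[OF A])
  have id: "(S ^^ (2 * N)) y = y" if "y \<in> coradical_filtration 1" for y
  proof -
    have "y \<in> wedge coradical coradical"
      using that by (simp add: wedge_def)
    then have "(inv S ^^ (2 * N)) y = y"
      using funpow_Q_eq_id_on_wedge[OF bij A exponentD[OF assms(3) lin_Q[OF bij]]] by blast
    then show ?thesis
      using funpow_S_Q[OF bij, of "2 * N" y] by simp
  qed
  obtain n where n: "L - 1 = Suc n"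
    using assms(5) by (cases "L - 1") auto
  have x: "x \<in> coradical_filtration (Suc n)"
    using filtration_loewy_length n assms(4) by auto
  show "((\<lambda>x. (S ^^ (2 * N)) x - x) ^^ (L - 1)) x = 0"
    unfolding n
    by (rule coalgebra_map_minus_id_nilpotent[OF lin_funpow[OF antipode_linear] sw_funpow_antipode id x])
qed

end
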